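(* Let $\varGamma=\sum_{j=1}^N\mathrm{graph}(g_j)$ be a correspondence on $\mathbb{P}^1$, where $g_1,\dots,g_N$ are rational maps (not necessarily distinct) with $\deg(g_j)\ge2$ for at least one $j$. Let $\mathrm{Rep}^\bullet(n)$ be the list of repelling fixed points of $\varGamma^{\circ n}$, repeated according to multiplicity. Then \[ \mu_n:=d_1(\varGamma)^{-n}\sum_{x\in\mathrm{Rep}^\bullet(n)}\delta_x\ \longrightarrow\ \mu_\varGamma \] in the weak-$*$ topology as $n\to\infty$, where $\mu_\varGamma$ is the equilibrium measure of $\varGamma$.
   Context: Here $d_1(\varGamma)=\sum_j\deg(g_j)$ and $d_0(\varGamma)=N<d_1(\varGamma)$. The $n$-th iterate is $\varGamma^{\circ n}=\sum_{(j_1,\dots,j_n)}\mathrm{graph}(g_{j_n}\circ\cdots\circ g_{j_1})$, summed over all index sequences with multiplicity. Repelling fixed points of $\varGamma^{\circ n}$: a point $x$ is one if it is a repelling fixed point of some composite $g_{j_n}\circ\cdots\circ g_{j_1}$. Its multiplicity is the number of index sequences $(j_1,\dots,j_n)$ for which this holds. Pull-back and equilibrium measure: $F^*_{\varGamma^{\circ n}}(\delta_w)$ is the measure $\sum_{(j_1,\dots,j_n)}\sum_{z:\,g_{j_n}\circ\cdots\circ g_{j_1}(z)=w}\delta_z$, with preimages counted with local degree. The equilibrium measure $\mu_\varGamma$ is the Borel probability measure such that $d_1(\varGamma)^{-n}F^*_{\varGamma^{\circ n}}(\delta_w)\to\mu_\varGamma$ weak-$*$ for all $w$ outside a polar set.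 *)

theory Defs
  imports "HOL-Probability.Probability" "HOL-Computational_Algebra.Polynomial"
begin

section \<open>The Riemann sphere as complex option (None = infinity)\<close>

definition rat_map_of :: "complex poly \<Rightarrow> complex poly \<Rightarrow> complex option \<Rightarrow> complex option" where
  "rat_map_of p q x = (case x of
      Some z \<Rightarrow> (if poly q z = 0 then None else Some (poly p z / poly q z))
    | None \<Rightarrow> (if degree p > degree q then None
              else Some (if degree p = degree q then lead_coeff p / lead_coeff q else 0)))"

definition is_rational_map :: "(complex option \<Rightarrow> complex option) \<Rightarrow> nat \<Rightarrow> bool" where
  "is_rational_map F d \<longleftrightarrow>
     (\<exists>p q. coprime p q \<and> (p \<noteq> 0 \<or> q \<noteq> 0) \<and> max (degree p) (degree q) = d \<and> F = rat_map_of p q)"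

definition chart :: "complex option \<Rightarrow> complex option \<Rightarrow> complex" where
  "chart x = (if x = None then (\<lambda>y. case y of None \<Rightarrow> 0 | Some u \<Rightarrow> 1 / u)
                          else (\<lambda>y. case y of None \<Rightarrow> 0 | Some u \<Rightarrow> u))"

definition chart_inv :: "complex option \<Rightarrow> complex \<Rightarrow> complex option" where
  "chart_inv x = (if x = None then (\<lambda>w. if w = 0 then None else Some (1 / w)) else Some)"

definition chart_pt :: "complex option \<Rightarrow> complex" where
  "chart_pt x = chart x x"

definition loc_rep :: "(complex option \<Rightarrow> complex option) \<Rightarrow> complex option \<Rightarrow> complex \<Rightarrow> complex" where
  "loc_rep F x = chart (F x) \<circ> F \<circ> chart_inv x"

definition local_degree :: "(complex option \<Rightarrow> complex option) \<Rightarrow> complex option \<Rightarrow> nat" where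
  "local_degree F x = (LEAST k. k \<ge> 1 \<and> (deriv ^^ k) (loc_rep F x) (chart_pt x) \<noteq> 0)"

definition repelling_fixed_point :: "(complex option \<Rightarrow> complex option) \<Rightarrow> complex option \<Rightarrow> bool" where
  "repelling_fixed_point F x \<longleftrightarrow> F x = x \<and>
     (\<exists>m. (loc_rep F x has_field_derivative m) (at (chart_pt x)) \<and> cmod m > 1)"

definition index_seqs :: "nat \<Rightarrow> nat \<Rightarrow> nat list set" where
  "index_seqs N n = {js. length js = n \<and> set js \<subseteq> {..<N}}"

definition comp_seq :: "(nat \<Rightarrow> complex option \<Rightarrow> complex option) \<Rightarrow> nat list \<Rightarrow> complex option \<Rightarrow> complex option" where
  "comp_seq g js = fold (\<lambda>j f. g j \<circ> f) js id"

definition P1_continuous :: "(complex option \<Rightarrow> real) \<Rightarrow> bool" where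
  "P1_continuous \<phi> \<longleftrightarrow> continuous_on UNIV (\<lambda>z. \<phi> (Some z)) \<and>
     ((\<lambda>z. \<phi> (Some z)) \<longlongrightarrow> \<phi> None) at_infinity"

text \<open>Borel sigma-algebra of the Riemann sphere.\<close>
definition P1_sets :: "complex option set set" where
  "P1_sets = {A. Some -` A \<in> sets (borel :: complex measure)}"

definition log_energy :: "complex measure \<Rightarrow> ereal" where
  "log_energy \<mu> =
     enn2ereal (\<integral>\<^sup>+ z. (\<integral>\<^sup>+ w. (if z = w then 0 else ennreal (max 0 (ln (cmod (z - w))))) \<partial>\<mu>) \<partial>\<mu>)
   - enn2ereal (\<integral>\<^sup>+ z. (\<integral>\<^sup>+ w. (if z = w then \<infinity> else ennreal (max 0 (- ln (cmod (z - w))))) \<partial>\<mu>) \<partial>\<mu>)"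

definition polar :: "complex set \<Rightarrow> bool" where
  "polar E \<longleftrightarrow> (\<forall>\<mu>. finite_measure \<mu> \<and> sets \<mu> = sets borel \<and> emeasure \<mu> (space \<mu>) \<noteq> 0 \<and>
       (\<exists>K. compact K \<and> K \<subseteq> E \<and> emeasure \<mu> (space \<mu> - K) = 0)
     \<longrightarrow> log_energy \<mu> = -\<infinity>)"

definition P1_polar :: "complex option set \<Rightarrow> bool" where
  "P1_polar E \<longleftrightarrow> polar (Some -` E)"

text \<open>Integral of phi against d1^{-n} times the pull-back of delta_w by Gamma^n.\<close>
definition pullback_avg ::
  "(nat \<Rightarrow> complex option \<Rightarrow> complex option) \<Rightarrow> nat \<Rightarrow> nat \<Rightarrow> complex option \<Rightarrow> nat \<Rightarrow> (complex option \<Rightarrow> real) \<Rightarrow> real" where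
  "pullback_avg g N d1 w n \<phi> = (1 / real d1 ^ n) *
     (\<Sum>js\<in>index_seqs N n. \<Sum>z\<in>{z. comp_seq g js z = w}. real (local_degree (comp_seq g js) z) * \<phi> z)"

definition is_equilibrium_measure ::
  "(nat \<Rightarrow> complex option \<Rightarrow> complex option) \<Rightarrow> nat \<Rightarrow> nat \<Rightarrow> complex option measure \<Rightarrow> bool" where
  "is_equilibrium_measure g N d1 \<mu> \<longleftrightarrow> prob_space \<mu> \<and> sets \<mu> = P1_sets \<and>
     (\<exists>E. P1_polar E \<and> (\<forall>w. w \<notin> E \<longrightarrow>
        (\<forall>\<phi>. P1_continuous \<phi> \<longrightarrow> (\<lambda>n. pullback_avg g N d1 w n \<phi>) \<longlonglongrightarrow> integral\<^sup>L \<mu> \<phi>)))"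

text \<open>Integral of phi against mu_n = d1^{-n} sum over Rep(n) (with multiplicity) of delta_x.\<close>
definition repelling_avg ::
  "(nat \<Rightarrow> complex option \<Rightarrow> complex option) \<Rightarrow> nat \<Rightarrow> nat \<Rightarrow> nat \<Rightarrow> (complex option \<Rightarrow> real) \<Rightarrow> real" where
  "repelling_avg g N d1 n \<phi> = (1 / real d1 ^ n) *
     (\<Sum>js\<in>index_seqs N n. \<Sum>x\<in>{x. repelling_fixed_point (comp_seq g js) x}. \<phi> x)"

end

theory Submission
  imports Defs "HOL-Complex_Analysis.Complex_Analysis"
    "HOL-Computational_Algebra.Fundamental_Theorem_Algebra"
    "HOL-Computational_Algebra.Field_as_Ring" "HOL-Computational_Algebra.Polynomial_Factorial"
begin

text \<open>
  Fix a generic point \<open>w\<close> and a slit plane \<open>U\<close> around it which avoids the first \<open>l\<close> generations of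
  critical values and carries full equilibrium mass. Distinct inverse branches along one index
  sequence have disjoint images, so each of the \<open>N ^ n\<close> sequences loses only boundedly many
  branches when it is prolonged, and the fraction of all \<open>d1 ^ n\<close> branches that do not extend to
  \<open>U\<close> is at most a constant times the tail of the geometric series of \<open>N / d1 < 1\<close>. The branches omit
  0, 1 and infinity, so Schottky's and Bloch's theorems bound, again for each sequence separately,
  the number of branches which fail to contract on a given compact set. A contracting branch that
  returns into that compact set has a fixed point next to the preimage of \<open>w\<close>, and it is repelling
  for the iterate. This compares the repelling average from below with the pull-back average; the
  total repelling mass is at most \<open>1 + 2 * (N / d1) ^ n\<close>, and applying the lower bound to \<open>C + \<phi>\<close>
  and \<open>C - \<phi>\<close> yields the limit. That the slits are null sets for a generic direction uses that the
  equilibrium measure has no atoms, which follows from a Jensen type estimate for the homogeneous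
  iterates, once more because \<open>N < d1\<close>.
\<close>

section \<open>Rational maps in homogeneous coordinates\<close>

text \<open>The critical values of all composites together may be dense, so an open set over which
  every inverse branch exists need not be available. The slits must not depend on \<open>n\<close>,
  because the bound for non-contracting branches depends on the domain; therefore \<open>l\<close>
  is fixed first and later critical values are only counted. The domain has to carry full mass
  because the only upper bound on repelling points is the number of all fixed points: mass missed
  from below could not be recovered, and a disc around \<open>w\<close> would be too small. Parallel
  rays keep the complement simply connected. The point \<open>w\<close> does more than miss the
  orbits of finitely many points: its distance from generation \<open>n\<close> is at least a
  constant over \<open>(2 * real N) ^ n\<close>. The Jensen type estimate sees the logarithm of this
  distance once per sequence, that is at most a linear term in \<open>n\<close>, which
  \<open>N ^ n\<close> sequences can afford. Homogeneous coordinates treat infinity like any other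
  point: asymptotically a disc of radius about \<open>exp (- M)\<close> receives at most a constant
  over \<open>M\<close> of the preimages of \<open>w\<close>, the constant depending on the
  centre.\<close>

definition to_curve_pt :: "complex \<Rightarrow> complex \<Rightarrow> complex option" where
  "to_curve_pt x y = (if y = 0 then None else Some (x / y))"

text \<open>Value at \<open>(x, y)\<close> of the form of degree \<open>d\<close> that homogenizes
  \<open>p\<close>. The degree is a parameter because numerator and denominator must be homogenized
  to the same degree, the larger of the two.\<close>

definition hval :: "nat \<Rightarrow> complex poly \<Rightarrow> complex \<Rightarrow> complex \<Rightarrow> complex" where
  "hval d p x y = (\<Sum>i\<le>d. coeff p i * x ^ i * y ^ (d - i))"

text \<open>The same form with polynomials inserted for both variables: a map is applied to a whole
  polynomial curve without any division.\<close>

definition hcomp :: "nat \<Rightarrow> complex poly \<Rightarrow> complex poly \<Rightarrow> complex poly \<Rightarrow> complex poly" where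
  "hcomp d p P Q = (\<Sum>i\<le>d. smult (coeff p i) (P ^ i * Q ^ (d - i)))"

lemma poly_hcomp: "poly (hcomp d p P Q) t = hval d p (poly P t) (poly Q t)"
  by (simp add: hcomp_def hval_def poly_sum mult.assoc)

lemma degree_hcomp_le:
  assumes "degree P \<le> m" "degree Q \<le> m"
  shows "degree (hcomp d p P Q) \<le> d * m"
  unfolding hcomp_def
proof (rule degree_sum_le)
  fix i assume i: "i \<in> {..d}"
  have "degree (smult (coeff p i) (P ^ i * Q ^ (d - i))) \<le> degree (P ^ i * Q ^ (d - i))"
    by (rule degree_smult_le)
  also have "\<dots> \<le> degree (P ^ i) + degree (Q ^ (d - i))" by (rule degree_mult_le)
  also have "\<dots> \<le> degree P * i + degree Q * (d - i)"
    by (intro add_mono degree_power_le)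
  also have "\<dots> \<le> m * i + m * (d - i)"
    using assms by (intro add_mono mult_right_mono) auto
  also have "\<dots> = d * m" using i by (metis add_mult_distrib2 atMost_iff le_add_diff_inverse mult.commute)
  finally show "degree (smult (coeff p i) (P ^ i * Q ^ (d - i))) \<le> d * m" .
qed auto

lemma hval_nonzero:
  assumes "degree p \<le> d" "y \<noteq> 0"
  shows "hval d p x y = y ^ d * poly p (x / y)"
proof -
  have "poly p (x / y) = (\<Sum>i\<le>d. coeff p i * (x / y) ^ i)"
    unfolding poly_altdef
    by (rule sum.mono_neutral_left) (use assms(1) in \<open>auto simp: coeff_eq_0\<close>)
  then have "y ^ d * poly p (x / y) = (\<Sum>i\<le>d. y ^ d * (coeff p i * (x / y) ^ i))"
    by (simp add: sum_distrib_left)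
  also have "\<dots> = hval d p x y"
    unfolding hval_def
    by (rule sum.cong) (use assms(2) in \<open>auto simp: power_divide power_diff field_simps\<close>)
  finally show ?thesis by simp
qed

lemma hval_zero: "hval d p x 0 = coeff p d * x ^ d"
proof -
  have "hval d p x 0 = (\<Sum>i\<in>{d}. coeff p i * x ^ i * 0 ^ (d - i))"
    unfolding hval_def by (rule sum.mono_neutral_right) auto
  then show ?thesis by simp
qed

lemma hval_scale: "hval d p (c * x) (c * y) = c ^ d * hval d p x y"
  unfolding hval_def sum_distrib_left
proof (rule sum.cong)
  fix i assume "i \<in> {..d}"
  then have "c ^ d = c ^ i * c ^ (d - i)" by (simp flip: power_add)
  then show "coeff p i * (c * x) ^ i * (c * y) ^ (d - i) = c ^ d * (coeff p i * x ^ i * y ^ (d - i))"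
    by (simp add: power_mult_distrib algebra_simps)
qed auto

locale rational_map =
  fixes p q :: "complex poly" and d :: nat
  assumes cop: "coprime p q" and deg: "max (degree p) (degree q) = d" and pos: "d \<ge> 1"
begin

lemma degs: "degree p \<le> d" "degree q \<le> d" using deg by auto

lemma no_common_root: "poly p z = 0 \<Longrightarrow> poly q z \<noteq> 0"
  using cop coprime_poly_0 by blast

text \<open>For \<open>y \<noteq> 0\<close> a common zero would be a common root of \<open>p\<close>
  and \<open>q\<close>; for \<open>y = 0\<close> the coefficient of degree \<open>d\<close> survives
  in at least one of the two forms.\<close>

lemma hval_ne:
  assumes "x \<noteq> 0 \<or> y \<noteq> 0"
  shows "hval d p x y \<noteq> 0 \<or> hval d q x y \<noteq> 0"
proof (cases "y = 0")
  case True
  have "coeff p d \<noteq> 0 \<or> coeff q d \<noteq> 0"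
    using deg pos by (metis degree_0 leading_coeff_0_iff max_def not_one_le_zero)
  then show ?thesis using True assms by (auto simp: hval_zero)
next
  case False
  then show ?thesis using no_common_root by (auto simp: hval_nonzero degs)
qed

lemma rat_map_of_to_curve_pt:
  assumes "x \<noteq> 0 \<or> y \<noteq> 0"
  shows "rat_map_of p q (to_curve_pt x y) = to_curve_pt (hval d p x y) (hval d q x y)"
proof (cases "y = 0")
  case True
  then have x: "x \<noteq> 0" using assms by simp
  consider "degree p > degree q" "coeff q d = 0" | "degree p = degree q" "degree p = d" "coeff q d \<noteq> 0"
     | "degree p < degree q" "degree q = d" "coeff p d = 0" "coeff q d \<noteq> 0"
    using deg pos by (metis coeff_eq_0 degree_0 leading_coeff_0_iff linorder_neqE_nat max.absorb2 max.absorb4 max.idem max.strict_order_iff not_one_le_zero)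
  then show ?thesis
    using x True by cases (auto simp: to_curve_pt_def rat_map_of_def hval_zero)
next
  case False
  then show ?thesis
    by (auto simp: to_curve_pt_def rat_map_of_def hval_nonzero degs)
qed

text \<open>Two forms of degree \<open>d\<close> without common zero attain a positive minimum and a
  maximum on the unit sphere of the maximum norm, and homogeneity carries both bounds to all
  vectors. The lower one is what coprimality buys.\<close>

lemma hval_bounds:
  obtains c where "c \<ge> 1"
    "\<And>x y. max (cmod (hval d p x y)) (cmod (hval d q x y)) \<le> c * max (cmod x) (cmod y) ^ d"
    "\<And>x y. max (cmod x) (cmod y) ^ d \<le> c * max (cmod (hval d p x y)) (cmod (hval d q x y))"
proof -
  define F where "F = (\<lambda>v::complex \<times> complex. max (cmod (hval d p (fst v) (snd v))) (cmod (hval d q (fst v) (snd v))))"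
  define S where "S = {v::complex \<times> complex. max (cmod (fst v)) (cmod (snd v)) = 1}"
  have "closed S" unfolding S_def by (intro closed_Collect_eq continuous_intros)
  moreover have "bounded S"
  proof (rule bounded_subset)
    show "bounded (cball (0::complex) 1 \<times> cball (0::complex) 1)" by (intro bounded_Times bounded_cball)
    show "S \<subseteq> cball 0 1 \<times> cball 0 1" unfolding S_def by (auto simp: max_def split: if_splits)
  qed
  ultimately have S: "compact S" by (simp add: compact_eq_bounded_closed)
  have S0: "S \<noteq> {}" unfolding S_def by (auto intro!: exI[of _ 1])
  have cF: "continuous_on S F" unfolding F_def hval_def by (intro continuous_intros)
  obtain a where a: "a \<in> S" "\<And>v. v \<in> S \<Longrightarrow> F a \<le> F v"
    using continuous_attains_inf[OF S S0 cF] by auto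
  obtain b where b: "b \<in> S" "\<And>v. v \<in> S \<Longrightarrow> F v \<le> F b"
    using continuous_attains_sup[OF S S0 cF] by auto
  have Fa: "F a > 0"
  proof -
    have "fst a \<noteq> 0 \<or> snd a \<noteq> 0" using a(1) by (auto simp: S_def)
    from hval_ne[OF this] show ?thesis by (auto simp: F_def max_def)
  qed
  define c where "c = max 1 (max (F b) (1 / F a))"
  have key: "\<exists>e\<in>S. F (x, y) = max (cmod x) (cmod y) ^ d * F e" if "max (cmod x) (cmod y) > 0" for x y
  proof -
    define m where "m = max (cmod x) (cmod y)"
    define e where "e = (x / of_real m, y / of_real m)"
    have m: "m > 0" using that by (simp add: m_def)
    have "e \<in> S" using m unfolding S_def e_def
      by (auto simp: norm_divide max_def m_def)
    moreover have "hval d p x y = of_real m ^ d * hval d p (fst e) (snd e)" 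
         "hval d q x y = of_real m ^ d * hval d q (fst e) (snd e)"
      using m by (simp_all add: e_def flip: hval_scale)
    then have "F (x,y) = m ^ d * F e" using m
      by (simp add: F_def norm_mult norm_power max_mult_distrib_left)
    ultimately show ?thesis unfolding m_def by blast
  qed
  have z: "F (0,0) = 0" using pos by (simp add: F_def hval_zero power_0_left)
  show ?thesis
  proof
    show "c \<ge> 1" by (simp add: c_def)
    fix x y
    have "F (x,y) \<le> c * max (cmod x) (cmod y) ^ d \<and> max (cmod x) (cmod y) ^ d \<le> c * F (x,y)"
    proof (cases "max (cmod x) (cmod y) > 0")
      case True
      from key[OF this] obtain e where e: "e \<in> S" "F (x, y) = max (cmod x) (cmod y) ^ d * F e" by auto
      have 1: "F e \<le> c" using b(2)[OF e(1)] by (auto simp: c_def)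
      have "1 / F a \<le> c" by (auto simp: c_def)
      then have "1 \<le> c * F a" using Fa by (simp add: field_simps)
      also have "\<dots> \<le> c * F e" using a(2)[OF e(1)] by (intro mult_left_mono) (auto simp: c_def)
      finally have 2: "1 \<le> c * F e" .
      have p: "max (cmod x) (cmod y) ^ d \<ge> 0" by (simp add: le_max_iff_disj)
      show ?thesis unfolding e(2)
        using mult_left_mono[OF 1 p] mult_left_mono[OF 2 p] by (auto simp: algebra_simps)
    next
      case False
      then have "x = 0" "y = 0" by (auto simp: max_def split: if_splits)
      then show ?thesis using z pos by (auto simp: power_0_left)
    qed
    then show "max (cmod (hval d p x y)) (cmod (hval d q x y)) \<le> c * max (cmod x) (cmod y) ^ d"
      "max (cmod x) (cmod y) ^ d \<le> c * max (cmod (hval d p x y)) (cmod (hval d q x y))"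
      by (auto simp: F_def)
  qed
qed

text \<open>Numerator of the derivative of \<open>p / q\<close>. Its roots are all finite critical
  points of the map, including the multiple poles.\<close>

definition wronskian :: "complex poly" where
  "wronskian = pderiv p * q - p * pderiv q"

text \<open>If it vanished, coprimality would make \<open>p\<close> and \<open>q\<close> divide
  their own derivatives, so both would be constant, against \<open>d \<ge> 1\<close>.\<close>

lemma wronskian_nonzero: "wronskian \<noteq> 0"
proof
  assume "wronskian = 0"
  then have eq: "pderiv p * q = p * pderiv q" by (simp add: wronskian_def)
  have const: "degree r = 0" if "r dvd pderiv r" for r :: "complex poly"
    using that degree_pderiv[of r] dvd_imp_degree_le[OF that] pderiv_eq_0_iff[of r] by fastforce
  have "p dvd pderiv p * q" using eq by simp
  then have "p dvd pderiv p" using coprime_dvd_mult_left_iff[of p q] cop by simp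
  moreover have "q dvd p * pderiv q" using eq by (metis dvd_triv_right)
  then have "q dvd pderiv q" using coprime_dvd_mult_right_iff[of q p "pderiv q"] cop by (simp add: coprime_commute)
  ultimately show False using const deg pos by fastforce
qed

lemma fibre_poly_nonzero: "p - smult c q \<noteq> 0"
proof
  assume "p - smult c q = 0"
  then have eq: "p = smult c q" by simp
  then have "q dvd p" by (metis dvd_refl dvd_smult)
  then have "is_unit q" using cop by (metis coprime_commute coprime_self dvd_refl not_coprimeI)
  then have "degree q = 0" by (cases "q = 0") (auto simp: is_unit_iff_degree)
  then have "degree p = 0" using eq by simp
  then show False using \<open>degree q = 0\<close> deg pos by simp
qed

lemma rat_map_of_Some_eq: "rat_map_of p q (Some z) = Some c \<longleftrightarrow> poly (p - smult c q) z = 0"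
  using no_common_root[of z] by (auto simp: rat_map_of_def field_simps)

lemma fibre_finite: "finite {z. rat_map_of p q (Some z) = Some c}"
  unfolding rat_map_of_Some_eq by (rule poly_roots_finite) (rule fibre_poly_nonzero)

lemma card_fibre_le: "card {z. rat_map_of p q (Some z) = Some c} \<le> d"
proof -
  have "card {z. poly (p - smult c q) z = 0} \<le> degree (p - smult c q)"
    by (rule card_poly_roots_bound) (rule fibre_poly_nonzero)
  also have "\<dots> \<le> d" using degs by (intro degree_diff_le) auto
  finally show ?thesis unfolding rat_map_of_Some_eq .
qed

lemma has_derivative_quotient:
  assumes "poly q z \<noteq> 0"
  shows "((\<lambda>z. poly p z / poly q z) has_field_derivative poly wronskian z / (poly q z)\<^sup>2) (at z)"
  using assms unfolding wronskian_def
  by (auto intro!: derivative_eq_intros simp: power2_eq_square)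

text \<open>A double root of \<open>p - smult c q\<close> is a root of the Wronskian, so all roots
  are simple; and since infinity is not in the fibre, the degree does not drop below
  \<open>d\<close>.\<close>

lemma card_fibre_eq:
  assumes "rat_map_of p q None \<noteq> Some c"
    and nc: "\<And>z. rat_map_of p q (Some z) = Some c \<Longrightarrow> poly wronskian z \<noteq> 0"
  shows "card {z. rat_map_of p q (Some z) = Some c} = d"
proof -
  let ?r = "p - smult c q"
  have "rsquarefree ?r"
    unfolding rsquarefree_roots
  proof (intro allI notI)
    fix a assume a: "poly ?r a = 0 \<and> poly (pderiv ?r) a = 0"
    then have 1: "poly p a = c * poly q a" "poly (pderiv p) a = c * poly (pderiv q) a"
      by (auto simp: pderiv_diff pderiv_smult)
    then have "poly wronskian a = 0" by (simp add: wronskian_def)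
    with nc[of a] a show False unfolding rat_map_of_Some_eq by blast
  qed
  then have dec: "smult (lead_coeff ?r) (\<Prod>z|poly ?r z = 0. [:-z, 1:]) = ?r"
    by (rule complex_poly_decompose_rsquarefree)
  have "degree ?r = degree (\<Prod>z|poly ?r z = 0. [:-z, 1:])"
    by (metis dec degree_smult_eq fibre_poly_nonzero leading_coeff_0_iff)
  also have "\<dots> = (\<Sum>z|poly ?r z = 0. 1)"
    by (subst degree_prod_sum_eq) auto
  finally have "card {z. poly ?r z = 0} = degree ?r" by simp
  moreover have "coeff ?r d \<noteq> 0"
  proof
    assume 0: "coeff ?r d = 0"
    then have "coeff p d = c * coeff q d" by simp
    then have "rat_map_of p q None = Some c"
      using rat_map_of_to_curve_pt[of 1 0] hval_ne[of 1 0] by (auto simp: to_curve_pt_def hval_zero)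
    with assms(1) show False by simp
  qed
  then have "degree ?r = d" using degs le_degree[of ?r d] degree_diff_le[of p d "smult c q"] by force
  ultimately show ?thesis unfolding rat_map_of_Some_eq by simp
qed

end

section \<open>Unbranched covers and lifts\<close>

text \<open>In Caratheodory's form of the derivative the increment of \<open>f\<close> at
  \<open>K a\<close> is \<open>h z * (z - K a)\<close> with \<open>h\<close> continuous and nonzero
  there. Continuity of \<open>K\<close> then suffices: its difference quotient is that of
  \<open>H\<close> divided by \<open>h (K z)\<close>.\<close>

lemma holomorphic_on_continuous_lift:
  fixes K H f :: "complex \<Rightarrow> complex"
  assumes "open A" "continuous_on A K" "H holomorphic_on A"
    and f: "\<And>z. z \<in> A \<Longrightarrow> f (K z) = H z"
    and der: "\<And>z. z \<in> A \<Longrightarrow> \<exists>D. D \<noteq> 0 \<and> (f has_field_derivative D) (at (K z))"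
  shows "K holomorphic_on A"
  unfolding holomorphic_on_open[OF \<open>open A\<close>]
proof
  fix a assume a: "a \<in> A"
  obtain D where D: "D \<noteq> 0" "(f has_field_derivative D) (at (K a))" using der[OF a] by blast
  then obtain h where h: "\<And>z. f z - f (K a) = h z * (z - K a)" "isCont h (K a)" "h (K a) = D"
    unfolding CARAT_DERIV by blast
  have K: "isCont K a" using assms(1,2) a continuous_on_eq_continuous_at by blast
  have hK: "((\<lambda>z. h (K z)) \<longlongrightarrow> D) (at a)"
    using isCont_o2[OF K h(2)] h(3) by (simp add: isCont_def)
  obtain E where E: "(H has_field_derivative E) (at a)"
    using assms(1,3) a holomorphic_on_open by blast
  have "((\<lambda>z. (H z - H a) / (z - a) / h (K z)) \<longlongrightarrow> E / D) (at a)"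
    using E hK D(1) by (intro tendsto_divide) (auto simp: has_field_derivative_iff)
  moreover have "eventually (\<lambda>z. (H z - H a) / (z - a) / h (K z) = (K z - K a) / (z - a)) (at a)"
  proof -
    have "eventually (\<lambda>z. h (K z) \<noteq> 0) (at a)"
      using tendsto_imp_eventually_ne[OF hK D(1)] .
    moreover have "eventually (\<lambda>z. z \<in> A) (at a)"
      using assms(1) a by (intro eventually_at_in_open') auto
    ultimately show ?thesis
    proof eventually_elim
      case (elim z)
      have "H z - H a = h (K z) * (K z - K a)" using h(1)[of "K z"] f[OF elim(2)] f[OF a] by simp
      then have "(H z - H a) / h (K z) = K z - K a" using elim(1) by simp
      then show ?case by (metis divide_divide_eq_left mult.commute)
    qed
  qed
  ultimately have "((\<lambda>z. (K z - K a) / (z - a)) \<longlongrightarrow> E / D) (at a)"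
    by (rule Lim_transform_eventually)
  then show "\<exists>f'. (K has_field_derivative f') (at a)"
    by (auto simp: has_field_derivative_iff)
qed

section \<open>The covering over the regular values and its holomorphic lifts\<close>

context rational_map
begin

text \<open>Infinity is kept out of the fibre too, so that all \<open>d\<close> preimages are simple
  and visible in the finite chart.\<close>

definition regular_value :: "complex \<Rightarrow> bool" where
  "regular_value c \<longleftrightarrow> rat_map_of p q None \<noteq> Some c \<and>
     (\<forall>z. rat_map_of p q (Some z) = Some c \<longrightarrow> poly wronskian z \<noteq> 0)"

lemma rat_map_of_Some_iff: "rat_map_of p q (Some z) = Some c \<longleftrightarrow> poly q z \<noteq> 0 \<and> c = poly p z / poly q z"
  by (auto simp: rat_map_of_def)

text \<open>Every point of \<open>S\<close> has exactly \<open>d\<close> preimages, so the local inverses at one fibre already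
  exhaust the nearby fibres; no properness argument is needed.\<close>

lemma covering_space_quotient:
  assumes "open S" and S: "\<And>c. c \<in> S \<Longrightarrow> regular_value c"
  shows "covering_space {z. \<exists>c\<in>S. rat_map_of p q (Some z) = Some c} (\<lambda>z. poly p z / poly q z) S"
proof -
  define f where "f = (\<lambda>z. poly p z / poly q z)"
  have f_iff: "rat_map_of p q (Some z) = Some c \<longleftrightarrow> poly q z \<noteq> 0 \<and> c = f z" for z c
    unfolding f_def by (rule rat_map_of_Some_iff)
  have "covering_space {z. \<exists>c\<in>S. rat_map_of p q (Some z) = Some c} f S"
  proof
  let ?C = "{z. \<exists>c\<in>S. rat_map_of p q (Some z) = Some c}"
  let ?Q = "{z. poly q z \<noteq> 0}"
  have C: "z \<in> ?C \<longleftrightarrow> poly q z \<noteq> 0 \<and> f z \<in> S" for z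
    by (auto simp: f_iff)
  have openQ: "open ?Q" by (intro open_Collect_neq continuous_intros)
  have hol: "f holomorphic_on ?Q" unfolding f_def by (intro holomorphic_intros) auto
  have cont: "continuous_on ?Q f" unfolding f_def by (intro continuous_intros) auto
  show "continuous_on ?C f"
    by (rule continuous_on_subset[OF cont]) (auto simp: f_iff)
  have card: "card {z. rat_map_of p q (Some z) = Some c} = d" if "c \<in> S" for c
    using S[OF that] card_fibre_eq unfolding regular_value_def by blast
  show "f ` ?C = S"
  proof
    show "f ` ?C \<subseteq> S" using C by blast
    show "S \<subseteq> f ` ?C"
    proof
      fix c assume c: "c \<in> S"
      have "card {z. rat_map_of p q (Some z) = Some c} \<noteq> 0" using card[OF c] pos by simp
      then have "{z. rat_map_of p q (Some z) = Some c} \<noteq> {}" by (metis card.empty)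
      then obtain z where "rat_map_of p q (Some z) = Some c" by blast
      then show "c \<in> f ` ?C" using c by (auto simp: f_iff intro!: image_eqI[of _ _ z])
    qed
  qed
  show "\<exists>T. y \<in> T \<and> openin (top_of_set S) T \<and>
            (\<exists>v. \<Union>v = ?C \<inter> f -` T \<and> (\<forall>u\<in>v. openin (top_of_set ?C) u) \<and> pairwise disjnt v \<and>
               (\<forall>u\<in>v. \<exists>k. homeomorphism u T f k))" if y: "y \<in> S" for y
  proof -
  define F where "F = {z. rat_map_of p q (Some z) = Some y}"
  have finF: "finite F" unfolding F_def by (rule fibre_finite)
  have cF: "card F = d" unfolding F_def using card[OF y] .
  obtain e where e: "e > 0" "\<And>a b. a \<in> F \<Longrightarrow> b \<in> F \<Longrightarrow> a \<noteq> b \<Longrightarrow> ball a e \<inter> ball b e = {}"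
  proof -
    have "finite ((\<lambda>(a,b). dist a b) ` {(a,b). a \<in> F \<and> b \<in> F \<and> a \<noteq> b})" (is "finite ?D")
      by (rule finite_imageI, rule finite_subset[of _ "F \<times> F"]) (use finF in auto)
    then obtain e0 where e0: "e0 > 0" "\<And>x. x \<in> ?D \<Longrightarrow> e0 \<le> x"
    proof (cases "?D = {}")
      case False
      have "Min ?D \<in> ?D" using \<open>finite ?D\<close> False by (rule Min_in)
      then have "Min ?D > 0" by auto
      then show ?thesis using that[of "Min ?D"] \<open>finite ?D\<close> by auto
    qed (auto intro: that[of 1])
    show ?thesis
    proof (rule that[of "e0 / 2"])
      show "e0 / 2 > 0" using e0 by simp
      fix a b assume ab: "a \<in> F" "b \<in> F" "a \<noteq> b"
      then have "e0 \<le> dist a b" using e0(2)[of "dist a b"] by force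
      then show "ball a (e0/2) \<inter> ball b (e0/2) = {}"
        by (intro disjoint_ballI) auto
    qed
  qed
  have "\<exists>r. \<forall>a\<in>F. r a > 0 \<and> ball a (r a) \<subseteq> ball a e \<inter> ?Q \<and> open (f ` ball a (r a)) \<and> inj_on f (ball a (r a))"
  proof (rule bchoice, rule ballI)
    fix a assume a: "a \<in> F"
    then have q: "poly q a \<noteq> 0" by (auto simp: F_def f_iff)
    have "poly wronskian a \<noteq> 0" using S[OF y] a by (auto simp: regular_value_def F_def)
    then have "deriv f a \<noteq> 0" using DERIV_imp_deriv[OF has_derivative_quotient[OF q]] q by (auto simp: f_def)
    moreover have "f holomorphic_on (ball a e \<inter> ?Q)" by (rule holomorphic_on_subset[OF hol]) auto
    moreover have "a \<in> ball a e \<inter> ?Q" "open (ball a e \<inter> ?Q)" using q e openQ by auto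
    ultimately obtain r where "r > 0" "ball a r \<subseteq> ball a e \<inter> ?Q" "open (f ` ball a r)" "inj_on f (ball a r)"
      using has_complex_derivative_locally_invertible[of f "ball a e \<inter> ?Q" a] by blast
    then show "\<exists>r. r > 0 \<and> ball a r \<subseteq> ball a e \<inter> ?Q \<and> open (f ` ball a r) \<and> inj_on f (ball a r)"
      by blast
  qed
  then obtain r where R: "\<forall>a\<in>F. r a > 0 \<and> ball a (r a) \<subseteq> ball a e \<inter> ?Q \<and> open (f ` ball a (r a)) \<and> inj_on f (ball a (r a))"
    by (elim exE)
  have r: "\<And>a. a \<in> F \<Longrightarrow> r a > 0" "\<And>a. a \<in> F \<Longrightarrow> ball a (r a) \<subseteq> ball a e \<inter> ?Q"
     "\<And>a. a \<in> F \<Longrightarrow> open (f ` ball a (r a))" "\<And>a. a \<in> F \<Longrightarrow> inj_on f (ball a (r a))"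
    using R by simp_all
  define T where "T = S \<inter> (\<Inter>a\<in>F. f ` ball a (r a))"
  have openT: "open T" unfolding T_def using r finF \<open>open S\<close> by (intro open_Int open_INT) auto
  have "y \<in> T" unfolding T_def
  proof (intro IntI INT_I y)
    fix a assume a: "a \<in> F"
    then have "y = f a" by (simp add: F_def f_iff)
    then show "y \<in> f ` ball a (r a)" using r(1)[OF a] by (auto intro!: image_eqI[of _ _ a])
  qed
  define u where "u = (\<lambda>a. ball a (r a) \<inter> f -` T)"
  have openu: "open (u a)" if "a \<in> F" for a
  proof -
    have "continuous_on (ball a (r a)) f" using r(2)[OF that] by (intro continuous_on_subset[OF cont]) auto
    then show ?thesis unfolding u_def using openT by (simp add: continuous_open_preimage)
  qed
  have uC: "u a \<subseteq> ?C" if "a \<in> F" for a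
    using r(2)[OF that] by (auto simp: u_def T_def f_iff)
  have homeo: "\<exists>k. homeomorphism (u a) T f k" if a: "a \<in> F" for a
  proof -
    have "T \<subseteq> f ` ball a (r a)" using a by (auto simp: T_def)
    then have "f ` u a = T" unfolding u_def by blast
    moreover have "continuous_on (u a) f" using uC[OF a] \<open>continuous_on ?C f\<close> continuous_on_subset by blast
    moreover have "inj_on f (u a)" using r(4)[OF a] by (auto simp: u_def inj_on_def)
    ultimately show ?thesis using invariance_of_domain_homeomorphism[OF openu[OF a], of f] by (metis order_refl)
  qed
  have un: "\<Union>(u ` F) = ?C \<inter> f -` T"
  proof
    show "\<Union>(u ` F) \<subseteq> ?C \<inter> f -` T" using uC by (auto simp: u_def)
    show "?C \<inter> f -` T \<subseteq> \<Union>(u ` F)"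
    proof
      fix z assume z: "z \<in> ?C \<inter> f -` T"
      define G where "G = {x. rat_map_of p q (Some x) = Some (f z)}"
      have cG: "card G = d" "finite G" unfolding G_def using z card[of "f z"] fibre_finite by (auto simp: T_def)
      have "\<exists>k. \<forall>a\<in>F. k a \<in> ball a (r a) \<and> f (k a) = f z"
      proof (rule bchoice, rule ballI)
        fix a assume "a \<in> F"
        then have "f z \<in> f ` ball a (r a)" using z by (auto simp: T_def)
        then show "\<exists>x. x \<in> ball a (r a) \<and> f x = f z" by force
      qed
      then obtain k where k: "\<And>a. a \<in> F \<Longrightarrow> k a \<in> ball a (r a)" "\<And>a. a \<in> F \<Longrightarrow> f (k a) = f z" by metis
      have "k ` F \<subseteq> G"
        using k r(2) by (force simp: G_def f_iff)
      moreover have "inj_on k F"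
        using k(1) r(2) e(2) by (intro inj_onI) (metis IntI emptyE le_inf_iff subsetD)
      ultimately have "k ` F = G" using cG cF by (metis card_image card_subset_eq)
      moreover have "z \<in> G" using z by (auto simp: G_def f_iff)
      ultimately obtain a where "a \<in> F" "z = k a" by auto
      then have "z \<in> u a" using k(1)[of a] z unfolding u_def by blast
      then show "z \<in> \<Union>(u ` F)" using \<open>a \<in> F\<close> by blast
    qed
  qed
  have 1: "openin (top_of_set S) T" using openT by (auto simp: T_def intro!: open_subset)
  have 2: "\<forall>w\<in>u ` F. openin (top_of_set ?C) w" using openu uC by (auto intro!: open_subset)
  have 3: "\<forall>w\<in>u ` F. \<exists>k. homeomorphism w T f k" using homeo by blast
  have dis: "disjnt (u a) (u b)" if "a \<in> F" "b \<in> F" "u a \<noteq> u b" for a b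
  proof -
    have "u a \<subseteq> ball a e" "u b \<subseteq> ball b e" using r(2) that by (auto simp: u_def)
    moreover have "ball a e \<inter> ball b e = {}" using e(2) that by metis
    ultimately show ?thesis by (auto simp: disjnt_def)
  qed
  have 4: "pairwise disjnt (u ` F)" by (rule pairwise_imageI) (use dis in blast)
  show ?thesis
    by (rule exI[of _ T], intro conjI, fact, fact, rule exI[of _ "u ` F"], intro conjI, fact+)
  qed
  qed
  then show ?thesis unfolding f_def .
qed

text \<open>Simple connectivity of \<open>U\<close> gives a continuous lift through the covering,
  and the derivative of the quotient does not vanish along it, which makes the lift
  holomorphic.\<close>

lemma holomorphic_lift:
  assumes "open S" and S: "\<And>c. c \<in> S \<Longrightarrow> regular_value c"
    and U: "open U" "simply_connected U" "a \<in> U"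
    and H: "H holomorphic_on U" "\<And>\<zeta>. \<zeta> \<in> U \<Longrightarrow> H \<zeta> \<in> S"
    and z0: "rat_map_of p q (Some z0) = Some (H a)"
  obtains K where "K holomorphic_on U" "K a = z0"
    "\<And>\<zeta>. \<zeta> \<in> U \<Longrightarrow> rat_map_of p q (Some (K \<zeta>)) = Some (H \<zeta>)"
proof -
  let ?C = "{z. \<exists>c\<in>S. rat_map_of p q (Some z) = Some c}"
  let ?f = "\<lambda>z. poly p z / poly q z"
  have cov: "covering_space ?C ?f S" by (rule covering_space_quotient) (use assms in auto)
  have "z0 \<in> ?C" using z0 H(2) U by auto
  moreover have "?f z0 = H a" using z0 by (simp add: rat_map_of_Some_iff)
  ultimately obtain K where K: "continuous_on U K" "K \<in> U \<rightarrow> ?C" "K a = z0" "\<And>\<zeta>. \<zeta> \<in> U \<Longrightarrow> ?f (K \<zeta>) = H \<zeta>"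
    using covering_space_lift_strong[OF cov, of z0 a U H] U H holomorphic_on_imp_continuous_on
      open_imp_locally_path_connected by (metis (no_types, lifting) Pi_I)
  have 1: "rat_map_of p q (Some (K \<zeta>)) = Some (H \<zeta>)" if "\<zeta> \<in> U" for \<zeta>
  proof -
    have "K \<zeta> \<in> ?C" using K(2) that by blast
    then show ?thesis using K(4)[OF that] by (auto simp: rat_map_of_Some_iff)
  qed
  have "K holomorphic_on U"
  proof (rule holomorphic_on_continuous_lift[OF U(1) K(1) H(1) K(4)])
    fix z assume z: "z \<in> U"
    have q: "poly q (K z) \<noteq> 0" using 1[OF z] by (simp add: rat_map_of_Some_iff)
    moreover have "poly wronskian (K z) \<noteq> 0" using S[OF H(2)[OF z]] 1[OF z] by (auto simp: regular_value_def)
    ultimately show "\<exists>D. D \<noteq> 0 \<and> (?f has_field_derivative D) (at (K z))"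
      using has_derivative_quotient[OF q] by (metis divide_eq_0_iff power_not_zero)
  qed
  then show ?thesis using that K(3) 1 by blast
qed

lemma holomorphic_lift_unique:
  assumes "open S" and S: "\<And>c. c \<in> S \<Longrightarrow> regular_value c"
    and U: "connected U" "a \<in> U" "x \<in> U"
    and H: "continuous_on U H" "\<And>\<zeta>. \<zeta> \<in> U \<Longrightarrow> H \<zeta> \<in> S"
    and K: "continuous_on U K" "\<And>\<zeta>. \<zeta> \<in> U \<Longrightarrow> rat_map_of p q (Some (K \<zeta>)) = Some (H \<zeta>)"
    and L: "continuous_on U L" "\<And>\<zeta>. \<zeta> \<in> U \<Longrightarrow> rat_map_of p q (Some (L \<zeta>)) = Some (H \<zeta>)"
    and eq: "K a = L a"
  shows "K x = L x"
proof (rule covering_space_lift_unique[OF covering_space_quotient[OF assms(1,2)] eq H(1) _ K(1) _ _ L(1)])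
  show "H \<zeta> = poly p (K \<zeta>) / poly q (K \<zeta>)" "H \<zeta> = poly p (L \<zeta>) / poly q (L \<zeta>)" if "\<zeta> \<in> U" for \<zeta>
    using K(2)[OF that] L(2)[OF that] by (auto simp: rat_map_of_Some_iff)
qed (use assms in auto)

end

section \<open>Complements of polar sets\<close>

text \<open>For \<open>x \<le> 1\<close> the number of \<open>k\<close> with
  \<open>x \<le> exp (- real k)\<close> is one more than the integer part of \<open>- ln x\<close>.
  The logarithmic kernel can thus be integrated by adding up areas of discs.\<close>

lemma neg_ln_le_suminf_indicator:
  fixes x :: real
  assumes "x > 0"
  shows "ennreal (max 0 (- ln x)) \<le> (\<Sum>k. indicator {..exp (- real k)} x)"
proof (cases "- ln x \<le> 0")
  case True
  then have "max 0 (- ln x) = 0" by simp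
  then show ?thesis by simp
next
  case False
  define n where "n = nat \<lfloor>- ln x\<rfloor>"
  have n: "real n \<le> - ln x" "- ln x \<le> real (Suc n)" using False unfolding n_def by linarith+
  have "x \<le> exp (- real k)" if "k < Suc n" for k
  proof -
    have "ln x \<le> - real k" using n(1) that by auto
    then show ?thesis using assms by (metis exp_ln exp_le_cancel_iff)
  qed
  then have "(\<Sum>k<Suc n. indicator {..exp (- real k)} x :: ennreal) = (\<Sum>k<Suc n. 1)"
    by (intro sum.cong) auto
  also have "\<dots> = of_nat (Suc n)" by simp
  finally have s: "(\<Sum>k<Suc n. indicator {..exp (- real k)} x :: ennreal) = of_nat (Suc n)" .
  have "ennreal (max 0 (- ln x)) \<le> ennreal (real (Suc n))" using n False by (intro ennreal_leI) auto
  also have "\<dots> = of_nat (Suc n)" by (rule ennreal_of_nat_eq_real_of_nat[symmetric])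
  also have "\<dots> \<le> (\<Sum>k. indicator {..exp (- real k)} x)"
    unfolding s[symmetric] by (rule sum_le_suminf) auto
  finally show ?thesis .
qed

lemma suminf_one_ennreal: "(\<Sum>k. 1 :: ennreal) = \<top>"
proof -
  have "of_nat n \<le> (\<Sum>k. 1 :: ennreal)" for n :: nat
  proof -
    have "(\<Sum>k<n. 1 :: ennreal) \<le> (\<Sum>k. 1)" by (rule sum_le_suminf) auto
    then show ?thesis by simp
  qed
  then have "(SUP n. of_nat n :: ennreal) \<le> (\<Sum>k. 1 :: ennreal)" by (intro SUP_least) auto
  then show ?thesis by (simp add: ennreal_SUP_of_nat_eq_top top_unique)
qed

lemma emeasure_ball_complex:
  "r \<ge> 0 \<Longrightarrow> emeasure lborel (ball (c::complex) r) = ennreal (pi * r\<^sup>2)"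
  "r \<ge> 0 \<Longrightarrow> emeasure lborel (cball (c::complex) r) = ennreal (pi * r\<^sup>2)"
  by (simp_all add: emeasure_ball emeasure_cball unit_ball_vol_2)

text \<open>Area restricted to \<open>K\<close> is a measure of energy greater than
  \<open>-\<infinity>\<close>: around every point the singular part of the kernel is bounded by the
  summed areas of discs of radius \<open>exp (- real k)\<close>, uniformly in the point.\<close>

lemma not_polar_of_positive_measure:
  assumes K: "compact K" "emeasure lborel K \<noteq> 0" "K \<subseteq> E"
  shows "\<not> polar E"
proof
  assume pol: "polar E"
  define \<nu> where "\<nu> = density lborel (indicator K :: complex \<Rightarrow> ennreal)"
  have Kb: "K \<in> sets borel" using K(1) by (simp add: borel_compact)
  have em: "emeasure \<nu> A = emeasure lborel (K \<inter> A)" if "A \<in> sets borel" for A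
  proof -
    have "emeasure \<nu> A = (\<integral>\<^sup>+x. indicator K x * indicator A x \<partial>lborel)"
      unfolding \<nu>_def using Kb that by (subst emeasure_density) auto
    also have "\<dots> = (\<integral>\<^sup>+x. indicator (K \<inter> A) x \<partial>lborel)"
      by (intro nn_integral_cong) (auto simp: indicator_def)
    also have "\<dots> = emeasure lborel (K \<inter> A)" using Kb that by simp
    finally show ?thesis .
  qed
  have sp: "space \<nu> = UNIV" "sets \<nu> = sets borel" by (simp_all add: \<nu>_def)
  have finite_part: "emeasure \<nu> UNIV < \<infinity>"
    using em[of UNIV] emeasure_bounded_finite[OF compact_imp_bounded[OF K(1)]] by simp
  have "finite_measure \<nu>" using finite_part by (intro finite_measureI) (auto simp: sp)
  moreover have "emeasure \<nu> (space \<nu>) \<noteq> 0" using K(2) by (simp add: sp em)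
  moreover have "emeasure \<nu> (space \<nu> - K) = 0" using Kb by (simp add: sp em)
  ultimately have energy: "log_energy \<nu> = - \<infinity>"
    using pol K(1,3) sp unfolding polar_def by blast
  let ?h = "\<lambda>z w. (\<Sum>k. indicator (cball z (exp (- real k))) w) :: ennreal"
  define C where "C = (\<Sum>k. ennreal (pi * (exp (- real k))\<^sup>2))"
  have C: "C < \<infinity>"
  proof -
    have "(\<lambda>k. pi * (exp (- real k))\<^sup>2) = (\<lambda>k. pi * (exp (- 2)) ^ k)"
      by (rule ext) (simp flip: exp_of_nat_mult exp_double)
    moreover have "summable (\<lambda>k. pi * (exp (- 2)) ^ k :: real)"
      by (intro summable_mult summable_geometric) auto
    ultimately have "summable (\<lambda>k. pi * (exp (- real k))\<^sup>2)" by simp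
    then have "C = ennreal (\<Sum>k. pi * (exp (- real k))\<^sup>2)"
      unfolding C_def by (intro suminf_ennreal2) auto
    then show ?thesis by simp
  qed
  have inner: "(\<integral>\<^sup>+ w. (if z = w then \<infinity> else ennreal (max 0 (- ln (cmod (z - w))))) \<partial>\<nu>) \<le> C" for z
  proof -
    have "(\<integral>\<^sup>+ w. (if z = w then \<infinity> else ennreal (max 0 (- ln (cmod (z - w))))) \<partial>\<nu>) \<le> (\<integral>\<^sup>+ w. ?h z w \<partial>\<nu>)"
    proof (rule nn_integral_mono)
      fix w
      show "(if z = w then \<infinity> else ennreal (max 0 (- ln (cmod (z - w))))) \<le> ?h z w"
      proof (cases "z = w")
        case True
        then show ?thesis by (simp add: suminf_one_ennreal)
      next
        case False
        have "indicator {..exp (- real k)} (cmod (z - w)) = (indicator (cball z (exp (- real k))) w :: ennreal)" for k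
          by (auto simp: indicator_def dist_norm)
        then show ?thesis using neg_ln_le_suminf_indicator[of "cmod (z - w)"] False by simp
      qed
    qed
    also have "\<dots> = (\<integral>\<^sup>+ w. indicator K w * ?h z w \<partial>lborel)"
      unfolding \<nu>_def using Kb by (intro nn_integral_density borel_measurable_suminf_order borel_measurable_indicator) auto
    also have "\<dots> \<le> (\<integral>\<^sup>+ w. ?h z w \<partial>lborel)"
      by (intro nn_integral_mono) (auto simp: indicator_def)
    also have "\<dots> = (\<Sum>k. \<integral>\<^sup>+ w. indicator (cball z (exp (- real k))) w \<partial>lborel)"
      by (intro nn_integral_suminf borel_measurable_indicator) auto
    also have "\<dots> = C" by (simp add: C_def emeasure_ball_complex)
    finally show ?thesis .
  qed
  define J where "J = (\<integral>\<^sup>+ z. (\<integral>\<^sup>+ w. (if z = w then \<infinity> else ennreal (max 0 (- ln (cmod (z - w))))) \<partial>\<nu>) \<partial>\<nu>)"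
  have "J \<le> (\<integral>\<^sup>+ z. C \<partial>\<nu>)" unfolding J_def by (intro nn_integral_mono inner)
  also have "\<dots> = C * emeasure \<nu> UNIV" by (simp add: sp)
  also have "\<dots> < \<infinity>" using C finite_part by (simp add: ennreal_mult_less_top)
  finally have J: "J < \<infinity>" .
  then have Jr: "enn2ereal J \<noteq> \<infinity>" by (cases J) (auto)
  \<comment> \<open>The positive part of the energy needs no bound: as long as the negative part is
    finite, the difference cannot be \<open>-\<infinity>\<close>.\<close>
  have "enn2ereal x - enn2ereal J \<noteq> - \<infinity>" for x
  proof -
    have "enn2ereal x \<ge> 0" by simp
    then show ?thesis using Jr by (cases "enn2ereal x"; cases "enn2ereal J") auto
  qed
  then show False using energy unfolding log_energy_def J_def by blast
qed

text \<open>The polar set need not be measurable. The discs to be avoided have small total area, so the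
  rest of the unit disc is a compact set of positive area, which is too large to lie in it.\<close>

lemma P1_polar_avoid:
  fixes X :: "nat \<Rightarrow> complex set"
  assumes pol: "P1_polar E" and finite_part: "\<And>n. finite (X n)"
    and card: "\<And>n. card (X n) \<le> M * N ^ n" and N: "N \<ge> 1"
  obtains w c where "Some w \<notin> E" "0 < c" "c \<le> 1"
    "\<And>n y. y \<in> X n \<Longrightarrow> c / (2 * real N) ^ n \<le> dist w y"
proof -
  \<comment> \<open>The discs of generation \<open>n\<close> have total area at most
    \<open>M * pi * c ^ 2 / 4 ^ n\<close>. This \<open>c\<close> keeps the sum over all
    \<open>n\<close>, which brings the factor 4/3, below the area of the unit disc.\<close>
  define c where "c = 1 / (real M + 2)"
  have c: "0 < c" "c \<le> 1" by (auto simp: c_def)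
  define r where "r = (\<lambda>n. c / (2 * real N) ^ n)"
  have r0: "r n \<ge> 0" for n using c by (auto simp: r_def)
  define Bad where "Bad = (\<Union>n. \<Union>y\<in>X n. ball y (r n))"
  have openB: "open Bad" unfolding Bad_def by auto
  have "emeasure lborel Bad \<le> (\<Sum>n. emeasure lborel (\<Union>y\<in>X n. ball y (r n)))"
    unfolding Bad_def by (rule emeasure_subadditive_countably) (auto intro!: borel_open open_UN)
  also have "\<dots> \<le> (\<Sum>n. ennreal (M * pi * c\<^sup>2 * (1/4) ^ n))"
  proof (rule suminf_le)
    fix n
    have "emeasure lborel (\<Union>y\<in>X n. ball y (r n)) \<le> (\<Sum>y\<in>X n. emeasure lborel (ball y (r n)))"
      using finite_part by (intro emeasure_subadditive_finite) auto
    also have "\<dots> = (\<Sum>y\<in>X n. ennreal (pi * (r n)\<^sup>2))" using r0 by (simp add: emeasure_ball_complex)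
    also have "\<dots> = ennreal (card (X n) * (pi * (r n)\<^sup>2))" by (simp add: ennreal_mult'' ennreal_of_nat_eq_real_of_nat)
    also have "\<dots> \<le> ennreal (M * pi * c\<^sup>2 * (1/4) ^ n)"
    proof (rule ennreal_leI)
      have r2: "(r n)\<^sup>2 = c\<^sup>2 * (1/4) ^ n * (1 / real N ^ n)\<^sup>2"
      proof -
        have "((2::real) ^ n)\<^sup>2 = 4 ^ n" by (simp add: power2_eq_square flip: power_mult_distrib)
        then show ?thesis by (simp add: r_def power_divide power_mult_distrib)
      qed
      have "real (card (X n)) * (pi * (r n)\<^sup>2) \<le> real (M * N ^ n) * (pi * (r n)\<^sup>2)"
        using card[of n] by (intro mult_right_mono) (auto simp del: of_nat_mult of_nat_power)
      also have "\<dots> = M * pi * c\<^sup>2 * (1/4) ^ n * (real N ^ n * (1 / real N ^ n)\<^sup>2)"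
        by (simp add: r2)
      also have "real N ^ n * (1 / real N ^ n)\<^sup>2 = 1 / real N ^ n"
        using N by (simp add: power2_eq_square)
      also have "M * pi * c\<^sup>2 * (1/4) ^ n * (1 / real N ^ n) \<le> M * pi * c\<^sup>2 * (1/4) ^ n * 1"
        using N by (intro mult_left_mono) auto
      finally show "real (card (X n)) * (pi * (r n)\<^sup>2) \<le> M * pi * c\<^sup>2 * (1/4) ^ n" by simp
    qed
    finally show "emeasure lborel (\<Union>y\<in>X n. ball y (r n)) \<le> ennreal (M * pi * c\<^sup>2 * (1/4) ^ n)" .
  qed auto
  also have "\<dots> = ennreal (\<Sum>n. M * pi * c\<^sup>2 * (1/4) ^ n)"
    by (intro suminf_ennreal2 summable_mult summable_geometric) auto
  also have "(\<Sum>n. M * pi * c\<^sup>2 * (1/4) ^ n) = M * pi * c\<^sup>2 * (4/3)"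
    by (subst suminf_mult) (auto simp: suminf_geometric summable_geometric)
  also have "ennreal (M * pi * c\<^sup>2 * (4/3)) < ennreal pi"
  proof (rule ennreal_lessI)
    have "3 * (real M + 2)\<^sup>2 = 12 + 12 * real M + 3 * (real M * real M)"
      by (simp add: power2_eq_square algebra_simps)
    moreover have "0 \<le> real M * real M" "0 \<le> real M" by simp_all
    ultimately have "real M * 4 < 3 * (real M + 2)\<^sup>2" by linarith
    then have "real M * c\<^sup>2 * (4/3) < 1" by (simp add: c_def power_divide field_simps)
    then have "pi * (real M * c\<^sup>2 * (4/3)) < pi * 1" by (intro mult_strict_left_mono) auto
    then show "M * pi * c\<^sup>2 * (4/3) < pi" by (simp add: mult_ac)
  qed auto
  finally have Bad: "emeasure lborel Bad < ennreal pi" .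
  define K where "K = cball 0 1 - Bad"
  have K: "compact K" unfolding K_def using openB by (intro compact_diff) auto
  have "emeasure lborel K \<noteq> 0"
  proof
    assume 0: "emeasure lborel K = 0"
    have "ennreal pi = emeasure lborel (cball (0::complex) 1)" by (simp add: emeasure_ball_complex)
    also have "\<dots> \<le> emeasure lborel (K \<union> Bad)"
      using K openB by (intro emeasure_mono) (auto simp: K_def borel_compact)
    also have "\<dots> \<le> emeasure lborel K + emeasure lborel Bad"
      using K openB by (intro emeasure_subadditive) (auto simp: borel_compact)
    finally show False using 0 Bad by simp
  qed
  then have "\<not> K \<subseteq> Some -` E" using not_polar_of_positive_measure K pol unfolding P1_polar_def by blast
  then obtain w where w: "w \<in> K" "Some w \<notin> E" by auto
  show ?thesis
  proof (rule that[OF w(2) c])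
    fix n y assume "y \<in> X n"
    then show "c / (2 * real N) ^ n \<le> dist w y"
      using w(1) by (force simp: K_def Bad_def r_def dist_commute)
  qed
qed

section \<open>Two estimates from function theory\<close>

text \<open>Schottky's theorem asks for holomorphy on the closed disc, so it is applied to
  \<open>f\<close> shrunk by a factor strictly between \<open>r\<close> and 1. The bound
  \<open>M\<close> serves all functions \<open>f\<close> at once.\<close>

lemma Schottky_bound:
  assumes r: "0 < r" "r < 1"
  obtains M where "\<And>f z. \<lbrakk>f holomorphic_on ball 0 1; \<And>u. u \<in> ball 0 1 \<Longrightarrow> f u \<noteq> 0 \<and> f u \<noteq> 1;
      cmod (f 0) \<le> R; cmod z \<le> r\<rbrakk> \<Longrightarrow> cmod (f z) \<le> M"
proof -
  define \<rho> where "\<rho> = (1 + r) / 2"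
  define \<tau> where "\<tau> = r / \<rho>"
  have \<rho>: "0 < \<rho>" "\<rho> < 1" "r < \<rho>" using r by (auto simp: \<rho>_def)
  have \<tau>: "0 < \<tau>" "\<tau> < 1" using \<rho> r by (auto simp: \<tau>_def)
  show ?thesis
  proof (rule that)
    fix f :: "complex \<Rightarrow> complex" and z :: complex
    assume f: "f holomorphic_on ball 0 1" and nz: "\<And>u. u \<in> ball 0 1 \<Longrightarrow> f u \<noteq> 0 \<and> f u \<noteq> 1"
      and R: "cmod (f 0) \<le> R" and z: "cmod z \<le> r"
    have im: "of_real \<rho> * u \<in> ball 0 1" if "u \<in> cball 0 1" for u :: complex
    proof -
      have "\<rho> * cmod u \<le> \<rho> * 1" using that \<rho> by (intro mult_left_mono) auto
      then have "\<rho> * cmod u < 1" using \<rho> by linarith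
      then show ?thesis using \<rho> by (simp add: norm_mult)
    qed
    have "cmod ((\<lambda>u. f (of_real \<rho> * u)) (z / of_real \<rho>)) \<le> exp (pi * exp (pi * (2 + 2 * R + 12 * \<tau> / (1 - \<tau>))))"
    proof (rule Schottky[where f = "\<lambda>u. f (of_real \<rho> * u)" and z = "z / of_real \<rho>" and t = \<tau> and r = R])
      have "f \<circ> (\<lambda>u. of_real \<rho> * u) holomorphic_on cball 0 1"
        by (rule holomorphic_on_compose_gen[OF _ f]) (use im in \<open>auto intro!: holomorphic_intros\<close>)
      then show "(\<lambda>u. f (of_real \<rho> * u)) holomorphic_on cball 0 1" by (simp add: o_def)
      show "\<not> (f (of_real \<rho> * u) = 0 \<or> f (of_real \<rho> * u) = 1)" if "u \<in> cball 0 1" for u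
        using nz[OF im[OF that]] by simp
      show "cmod (z / of_real \<rho>) \<le> \<tau>" using z \<rho> by (simp add: norm_divide \<tau>_def divide_right_mono)
    qed (use \<tau> R in auto)
    then show "cmod (f z) \<le> exp (pi * exp (pi * (2 + 2 * R + 12 * \<tau> / (1 - \<tau>))))" using \<rho> by simp
  qed
qed

text \<open>A packing argument. Where the derivative is at least \<open>\<delta>\<close>, Bloch's
  theorem puts a disc of fixed radius into the image; by Schottky its centre lies in a fixed compact
  disc; and the images are disjoint. The bound \<open>k\<close> depends only on \<open>r\<close>,
  \<open>\<delta>\<close> and \<open>R\<close>, so it is the same for all index sequences.\<close>

lemma card_large_derivative_le:
  assumes r: "0 < r" "r < 1" and \<delta>: "\<delta> > 0"
  obtains k :: nat where
    "\<And>(Z :: complex set) H. \<lbrakk>\<And>z. z \<in> Z \<Longrightarrow> H z holomorphic_on ball 0 1;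
       \<And>z u. z \<in> Z \<Longrightarrow> u \<in> ball 0 1 \<Longrightarrow> H z u \<noteq> 0 \<and> H z u \<noteq> 1;
       \<And>z. z \<in> Z \<Longrightarrow> cmod (H z 0) \<le> R;
       \<And>z. z \<in> Z \<Longrightarrow> \<exists>u\<in>cball 0 r. \<delta> \<le> cmod (deriv (H z) u);
       \<And>z y. z \<in> Z \<Longrightarrow> y \<in> Z \<Longrightarrow> z \<noteq> y \<Longrightarrow> H z ` ball 0 1 \<inter> H y ` ball 0 1 = {}\<rbrakk> \<Longrightarrow> card Z \<le> k"
proof -
  define t where "t = (1 + r) / 2"
  have t: "r < t" "t < 1" "0 < t" using r by (auto simp: t_def)
  obtain M where M: "\<And>f z. \<lbrakk>f holomorphic_on ball 0 1; \<And>u. u \<in> ball 0 1 \<Longrightarrow> f u \<noteq> 0 \<and> f u \<noteq> 1;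
      cmod (f 0) \<le> R; cmod z \<le> t\<rbrakk> \<Longrightarrow> cmod (f z) \<le> M"
    using Schottky_bound[OF t(3,2), of R] by metis
  \<comment> \<open>Bloch's radius, with its constant 1/12, for discs of radius \<open>t - r\<close>
    around points of \<open>cball 0 r\<close>; these discs stay inside \<open>ball 0 t\<close>,
    where the Schottky bound holds.\<close>
  define s where "s = (t - r) * \<delta> / 12"
  have s: "s > 0" using t \<delta> by (simp add: s_def)
  \<comment> \<open>Half the radius: two Bloch discs whose centres lie in the same piece of the
    cover overlap, which disjointness of the images forbids.\<close>
  obtain T where T: "finite T" "cball (0::complex) M \<subseteq> (\<Union>x\<in>T. ball x (s / 2))"
  proof (rule compactE_image[OF compact_cball, of UNIV "\<lambda>x::complex. ball x (s / 2)" 0 M])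
    show "cball 0 M \<subseteq> (\<Union>x. ball x (s / 2))" using s by (meson UN_I UNIV_I centre_in_ball half_gt_zero subsetI)
  qed auto
  show ?thesis
  proof (rule that[of "card T"])
    fix Z :: "complex set" and H
    assume hol: "\<And>z. z \<in> Z \<Longrightarrow> H z holomorphic_on ball 0 1"
      and nz: "\<And>z u. z \<in> Z \<Longrightarrow> u \<in> ball 0 1 \<Longrightarrow> H z u \<noteq> 0 \<and> H z u \<noteq> 1"
      and R: "\<And>z. z \<in> Z \<Longrightarrow> cmod (H z 0) \<le> R"
      and big: "\<And>z. z \<in> Z \<Longrightarrow> \<exists>u\<in>cball 0 r. \<delta> \<le> cmod (deriv (H z) u)"
      and dis: "\<And>z y. z \<in> Z \<Longrightarrow> y \<in> Z \<Longrightarrow> z \<noteq> y \<Longrightarrow> H z ` ball 0 1 \<inter> H y ` ball 0 1 = {}"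
    have "\<exists>b. ball b s \<subseteq> H z ` ball 0 t" if z: "z \<in> Z" for z
    proof -
      obtain u where u: "cmod u \<le> r" "\<delta> \<le> cmod (deriv (H z) u)" using big[OF z] by auto
      have sub: "ball u (t - r) \<subseteq> ball 0 t"
      proof
        fix y assume "y \<in> ball u (t - r)"
        then have "cmod (y - u) < t - r" by (simp add: dist_norm norm_minus_commute)
        then show "y \<in> ball 0 t" using norm_triangle_sub[of y u] u(1) by simp
      qed
      have "ball 0 t \<subseteq> ball (0::complex) 1" using t by auto
      then have "H z holomorphic_on ball u (t - r)" using hol[OF z] sub holomorphic_on_subset by blast
      moreover have "s \<le> (t - r) * cmod (deriv (H z) u) / 12" using u(2) t by (auto simp: s_def mult_left_mono)
      ultimately obtain b where "ball b s \<subseteq> H z ` ball u (t - r)" using Bloch t by (metis diff_gt_0_iff_gt)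
      then show ?thesis using sub by blast
    qed
    then obtain b where b: "\<And>z. z \<in> Z \<Longrightarrow> ball (b z) s \<subseteq> H z ` ball 0 t" by metis
    have "\<exists>x\<in>T. b z \<in> ball x (s / 2)" if z: "z \<in> Z" for z
    proof -
      have "b z \<in> H z ` ball 0 t" using b[OF z] s by auto
      then obtain u where u: "cmod u < t" "b z = H z u" by auto
      then have "cmod (b z) \<le> M" using M[OF hol[OF z] nz[OF z] R[OF z], of u] by auto
      then have "b z \<in> cball 0 M" by simp
      then show ?thesis using T(2) by blast
    qed
    then obtain x where x: "\<And>z. z \<in> Z \<Longrightarrow> x z \<in> T" "\<And>z. z \<in> Z \<Longrightarrow> b z \<in> ball (x z) (s / 2)" by metis
    have "inj_on x Z"
    proof (rule inj_onI, rule ccontr)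
      fix z y assume zy: "z \<in> Z" "y \<in> Z" "x z = x y" "z \<noteq> y"
      have "dist (b z) (b y) < s"
        using x(2)[OF zy(1)] x(2)[OF zy(2)] zy(3) by (auto intro: dist_triangle_half_r)
      then have "b y \<in> ball (b z) s" "b y \<in> ball (b y) s" using s by auto
      then have "b y \<in> H z ` ball 0 t" "b y \<in> H y ` ball 0 t" using b[OF zy(1)] b[OF zy(2)] by auto
      moreover have "ball 0 t \<subseteq> ball (0::complex) 1" using t by auto
      ultimately show False using dis[OF zy(1,2,4)] by blast
    qed
    then show "card Z \<le> card T" using x(1) T(1) by (intro card_inj_on_le[of x]) auto
  qed
qed

text \<open>Jensen's inequality in a weak form, by dividing out one root at a time. A root
  \<open>z\<close> contributes the factor \<open>cmod z < \<rho>\<close> to the value at 0, while on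
  the unit circle \<open>cmod (v - z) \<ge> 1 - \<rho>\<close>, so the maximum grows by at most
  \<open>1 / (1 - \<rho>)\<close>. Blaschke factors would replace
  \<open>(1 - \<rho>) / \<rho>\<close> by \<open>1 / \<rho>\<close>; for small \<open>\<rho>\<close>
  the difference is immaterial.\<close>

lemma poly_norm_mult_power_card_roots_le:
  fixes R :: "complex poly"
  assumes "finite Z" "0 < \<rho>" "\<rho> < 1"
    and "\<And>z. z \<in> Z \<Longrightarrow> poly R z = 0 \<and> cmod z < \<rho>"
    and "\<And>z. cmod z \<le> 1 \<Longrightarrow> cmod (poly R z) \<le> M"
  shows "cmod (poly R 0) * ((1 - \<rho>) / \<rho>) ^ card Z \<le> M"
  using assms(1,4,5)
proof (induction Z arbitrary: R M rule: finite_induct)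
  case empty
  then show ?case by simp
next
  case (insert z Z)
  have "poly R z = 0" using insert.prems(1) by simp
  then obtain S where S: "R = [:-z, 1:] * S" by (auto simp: poly_eq_0_iff_dvd elim: dvdE)
  have z: "cmod z < \<rho>" using insert.prems(1) by simp
  have bnd: "cmod (poly S u) \<le> M / (1 - \<rho>)" if "cmod u \<le> 1" for u
  proof (rule maximum_modulus_frontier[of "poly S" "cball 0 1"])
    fix v :: complex assume "v \<in> frontier (cball 0 1)"
    then have v: "cmod v = 1" by simp
    have 1: "1 - \<rho> \<le> cmod (v - z)" using norm_triangle_ineq2[of v z] v z by linarith
    have "cmod (v - z) * cmod (poly S v) \<le> M"
      using insert.prems(2)[of v] v by (simp add: S left_diff_distrib flip: norm_mult)
    moreover have "(1 - \<rho>) * cmod (poly S v) \<le> cmod (v - z) * cmod (poly S v)"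
      using 1 by (intro mult_right_mono) auto
    ultimately show "cmod (poly S v) \<le> M / (1 - \<rho>)" using assms(3) by (simp add: field_simps)
  qed (use that in \<open>auto intro!: holomorphic_intros continuous_intros\<close>)
  have "cmod (poly S 0) * ((1 - \<rho>) / \<rho>) ^ card Z \<le> M / (1 - \<rho>)"
  proof (rule insert.IH)
    fix y assume y: "y \<in> Z"
    then have "y \<noteq> z" using insert.hyps by auto
    then show "poly S y = 0 \<and> cmod y < \<rho>" using insert.prems(1)[of y] y by (simp add: S)
  qed (rule bnd)
  then have IH: "(1 - \<rho>) * (cmod (poly S 0) * ((1 - \<rho>) / \<rho>) ^ card Z) \<le> M"
    using assms(3) by (simp add: field_simps)
  have "cmod (poly R 0) * ((1 - \<rho>) / \<rho>) ^ card (insert z Z) =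
      cmod z * (cmod (poly S 0) * ((1 - \<rho>) / \<rho>) ^ card Z * ((1 - \<rho>) / \<rho>))"
    using insert.hyps by (simp add: S norm_mult mult_ac)
  also have "\<dots> \<le> \<rho> * (cmod (poly S 0) * ((1 - \<rho>) / \<rho>) ^ card Z * ((1 - \<rho>) / \<rho>))"
    using z assms by (intro mult_right_mono) auto
  also have "\<dots> = (1 - \<rho>) * (cmod (poly S 0) * ((1 - \<rho>) / \<rho>) ^ card Z)"
    using assms(2) by simp
  also note IH
  finally show ?case .
qed

section \<open>Slit planes\<close>

text \<open>The half-line to the right of \<open>v\<close> with slope \<open>m\<close>. One slope is
  shared by all slits, so that translating backwards along it never runs into a slit.\<close>

definition ray :: "real \<Rightarrow> complex \<Rightarrow> complex set" where
  "ray m v = {z. Im z - m * Re z = Im v - m * Re v \<and> Re v \<le> Re z}"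

lemma closed_ray: "closed (ray m v)"
proof -
  have "ray m v = {z. Im z - m * Re z = Im v - m * Re v} \<inter> {z. Re v \<le> Re z}"
    by (auto simp: ray_def)
  also have "closed \<dots>" by (intro closed_Int closed_Collect_eq closed_Collect_le continuous_intros)
  finally show ?thesis .
qed

lemma convex_ray: "convex (ray m v)"
proof -
  have "ray m v = {z. Im z - m * Re z = Im v - m * Re v} \<inter> {z. Re v \<le> Re z}"
    by (auto simp: ray_def)
  also have "\<dots> = {z. Complex (- m) 1 \<bullet> z = Im v - m * Re v} \<inter> {z. 1 \<bullet> z \<ge> Re v}"
    by (auto simp: inner_complex_def algebra_simps)
  also have "convex \<dots>" by (intro convex_Int convex_hyperplane convex_halfspace_ge)
  finally show ?thesis .
qed

text \<open>Backward translation along the slope stays in \<open>U\<close> and ends in the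
  half-plane to the left of all tips, so \<open>U\<close> is connected. Every component of the
  complement contains a whole ray and is therefore unbounded, which gives simple
  connectivity.\<close>

lemma simply_connected_slit_plane:
  fixes m :: real
  assumes V: "finite V" "V \<noteq> {}"
  defines "U \<equiv> - (\<Union>v\<in>V. ray m v)"
  shows "open U" "simply_connected U" "U \<noteq> UNIV"
proof -
  have mem: "z \<in> U \<longleftrightarrow> (\<forall>v\<in>V. z \<notin> ray m v)" for z by (auto simp: U_def)
  show opn: "open U" unfolding U_def using V closed_ray by (intro open_Compl closed_UN) auto
  have self: "v \<in> ray m v" for v by (simp add: ray_def)
  show "U \<noteq> UNIV" using V self by (auto simp: U_def)
  define c where "c = Min (Re ` V)"
  have c: "c \<le> Re v" if "v \<in> V" for v using V that by (simp add: c_def)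
  have half: "{z. Re z < c} \<subseteq> U" using c by (force simp: mem ray_def)
  define e where "e = Complex 1 m"
  have shift: "z - of_real t * e \<in> U" if "z \<in> U" "t \<ge> 0" for z and t :: real
    unfolding mem
  proof (intro ballI notI)
    fix v assume v: "v \<in> V" "z - of_real t * e \<in> ray m v"
    then have "z \<in> ray m v" using that(2) by (auto simp: ray_def e_def algebra_simps)
    then show False using that(1) v(1) by (simp add: mem)
  qed
  have conn: "connected U"
    unfolding connected_iff_connected_component
  proof (intro ballI)
    have to_half: "\<exists>z'. Re z' < c \<and> connected_component U z z'" if z: "z \<in> U" for z
    proof -
      define t where "t = \<bar>Re z - c\<bar> + 1"
      have t: "t \<ge> 0" by (simp add: t_def)
      have "connected_component U z (z - of_real t * e)"
      proof (rule connected_componentI)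
        show "closed_segment z (z - of_real t * e) \<subseteq> U"
        proof
          fix y assume "y \<in> closed_segment z (z - of_real t * e)"
          then obtain u where u: "0 \<le> u" "u \<le> 1" "y = (1 - u) *\<^sub>R z + u *\<^sub>R (z - of_real t * e)"
            by (auto simp: closed_segment_def)
          then have "y = z - of_real (u * t) * e" by (simp add: algebra_simps scaleR_conv_of_real)
          then show "y \<in> U" using shift[OF z, of "u * t"] u t by simp
        qed
      qed auto
      moreover have "Re (z - of_real t * e) < c" by (simp add: e_def t_def)
      ultimately show ?thesis by blast
    qed
    fix x y assume "x \<in> U" "y \<in> U"
    then obtain x' y' where xy: "Re x' < c" "connected_component U x x'" "Re y' < c" "connected_component U y y'"
      using to_half by blast
    have "connected_component U x' y'"
    proof (rule connected_componentI[OF _ half])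
      show "connected {z. Re z < c}" by (intro convex_connected convex_halfspace_Re_lt)
    qed (use xy in auto)
    then show "connected_component U x y"
      using xy by (meson connected_component_sym connected_component_trans)
  qed
  have unb: "\<not> bounded (ray m v)" for v
  proof
    assume "bounded (ray m v)"
    then obtain B where B: "\<And>z. z \<in> ray m v \<Longrightarrow> cmod z \<le> B" by (auto simp: bounded_iff)
    define t where "t = \<bar>B\<bar> + \<bar>Re v\<bar> + 1"
    have "v + of_real t * e \<in> ray m v" by (auto simp: ray_def e_def t_def algebra_simps)
    then have "cmod (v + of_real t * e) \<le> B" by (rule B)
    moreover have "Re (v + of_real t * e) \<le> cmod (v + of_real t * e)" by (rule complex_Re_le_cmod)
    ultimately show False by (simp add: e_def t_def)
  qed
  show "simply_connected U"
    unfolding simply_connected_eq_unbounded_complement_components[OF opn]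
  proof (intro conjI conn ballI)
    fix C assume C: "C \<in> components (- U)"
    then obtain x where x: "x \<in> C" using in_components_nonempty by blast
    then have "x \<in> - U" using C in_components_subset by blast
    then obtain v where v: "v \<in> V" "x \<in> ray m v" by (auto simp: U_def)
    have "ray m v \<subseteq> C"
    proof (rule components_maximal[OF C])
      show "connected (ray m v)" by (intro convex_connected convex_ray)
      show "ray m v \<subseteq> - U" using v(1) by (auto simp: U_def)
      show "C \<inter> ray m v \<noteq> {}" using x v by blast
    qed
    then show "\<not> bounded C" using unb bounded_subset by blast
  qed
qed

text \<open>A disc automorphism is inserted so that 0 corresponds to \<open>w\<close>; an inverse
  branch over the domain can then be named by its value at 0, which is a preimage of
  \<open>w\<close>.\<close>

lemma Riemann_map_at:
  assumes U: "open U" "simply_connected U" "U \<noteq> UNIV" "w \<in> U"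
  obtains \<psi> \<psi>' where "\<psi> holomorphic_on ball 0 1" "\<psi>' holomorphic_on U" "\<psi> 0 = w"
    "\<And>z. z \<in> U \<Longrightarrow> \<psi>' z \<in> ball 0 1 \<and> \<psi> (\<psi>' z) = z"
    "\<And>u. u \<in> ball 0 1 \<Longrightarrow> \<psi> u \<in> U \<and> \<psi>' (\<psi> u) = u"
proof -
  obtain f g where fg: "f holomorphic_on U" "g holomorphic_on ball 0 1"
    "\<And>z. z \<in> U \<Longrightarrow> f z \<in> ball 0 1 \<and> g (f z) = z"
    "\<And>z. z \<in> ball 0 1 \<Longrightarrow> g z \<in> U \<and> f (g z) = z"
  proof -
    have "\<exists>f g. f holomorphic_on U \<and> g holomorphic_on ball 0 1 \<and>
           (\<forall>z\<in>U. f z \<in> ball 0 1 \<and> g (f z) = z) \<and> (\<forall>z\<in>ball 0 1. g z \<in> U \<and> f (g z) = z)"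
      using Riemann_mapping_theorem[of U] U by blast
    then show ?thesis using that by blast
  qed
  have "f w \<in> ball 0 1" using fg(3) U by blast
  then obtain F G where FG: "F (f w) = 0"
     "F holomorphic_on ball 0 1" "F ` ball 0 1 \<subseteq> ball 0 1"
     "G holomorphic_on ball 0 1" "G ` ball 0 1 \<subseteq> ball 0 1"
     "\<And>z. z \<in> ball 0 1 \<Longrightarrow> F (G z) = z" "\<And>z. z \<in> ball 0 1 \<Longrightarrow> G (F z) = z"
    by (rule ball_biholomorphism_exists) blast
  show ?thesis
  proof (rule that[of "g \<circ> G" "F \<circ> f"])
    show "g \<circ> G holomorphic_on ball 0 1" using FG fg by (intro holomorphic_on_compose_gen[of G _ g "ball 0 1"]) auto
    show "F \<circ> f holomorphic_on U" using FG fg by (intro holomorphic_on_compose_gen[of f _ F "ball 0 1"]) auto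
    have "G 0 = f w" using FG(1,7) \<open>f w \<in> ball 0 1\<close> by metis
    then show "(g \<circ> G) 0 = w" using fg(3) U by simp
    show "(F \<circ> f) z \<in> ball 0 1 \<and> (g \<circ> G) ((F \<circ> f) z) = z" if "z \<in> U" for z
      using fg(3)[OF that] FG(3,7) by (simp add: image_subset_iff)
    show "(g \<circ> G) u \<in> U \<and> (F \<circ> f) ((g \<circ> G) u) = u" if "u \<in> ball 0 1" for u
    proof -
      have "G u \<in> ball 0 1" using FG(5) that by blast
      then show ?thesis using fg(4) FG(6)[OF that] by simp
    qed
  qed
qed

section \<open>Measures on the Riemann sphere\<close>

lemma P1_continuous_bounded:
  assumes "P1_continuous \<phi>"
  obtains C where "C \<ge> 0" "\<And>x. \<bar>\<phi> x\<bar> \<le> C"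
proof -
  have c: "continuous_on UNIV (\<lambda>z. \<phi> (Some z))" and l: "((\<lambda>z. \<phi> (Some z)) \<longlongrightarrow> \<phi> None) at_infinity"
    using assms by (auto simp: P1_continuous_def)
  have "eventually (\<lambda>z. dist (\<phi> (Some z)) (\<phi> None) < 1) at_infinity" using tendstoD[OF l, of 1] by simp
  then obtain b where b: "\<And>z. b \<le> norm z \<Longrightarrow> dist (\<phi> (Some z)) (\<phi> None) < 1"
    unfolding eventually_at_infinity by blast
  have "bounded ((\<lambda>z. \<phi> (Some z)) ` cball 0 b)"
    by (intro compact_imp_bounded compact_continuous_image continuous_on_subset[OF c]) auto
  then obtain B where B: "\<And>z. norm z \<le> b \<Longrightarrow> \<bar>\<phi> (Some z)\<bar> \<le> B"
    unfolding bounded_iff by (metis image_eqI mem_cball_0 real_norm_def)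
  define C where "C = max \<bar>B\<bar> (\<bar>\<phi> None\<bar> + 1)"
  have "\<bar>\<phi> x\<bar> \<le> C" for x
  proof (cases x)
    case (Some z)
    show ?thesis
    proof (cases "norm z \<le> b")
      case True then show ?thesis using B[OF True] Some by (auto simp: C_def)
    next
      case False then show ?thesis using b[of z] Some by (auto simp: C_def dist_real_def)
    qed
  qed (auto simp: C_def)
  moreover have "C \<ge> 0" by (auto simp: C_def)
  ultimately show ?thesis using that by blast
qed

locale P1_prob = prob_space \<mu> for \<mu> :: "complex option measure" +
  assumes sets_eq: "sets \<mu> = P1_sets"
begin

lemma space_eq: "space \<mu> = UNIV"
proof -
  have "UNIV \<in> sets \<mu>" by (simp add: sets_eq P1_sets_def)
  then show ?thesis using sets.sets_into_space by blast
qed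

lemma measurable_iff: "f \<in> borel_measurable \<mu> \<longleftrightarrow> (\<lambda>z. f (Some z)) \<in> borel_measurable borel"
  by (auto simp: measurable_def space_eq sets_eq P1_sets_def vimage_def)

lemma Some_image_sets: "A \<in> sets borel \<Longrightarrow> Some ` A \<in> sets \<mu>"
proof -
  have "Some -` (Some ` A) = A" by auto
  then show "A \<in> sets borel \<Longrightarrow> Some ` A \<in> sets \<mu>" by (simp add: sets_eq P1_sets_def)
qed

lemma singleton_sets: "{x} \<in> sets \<mu>"
proof (cases x)
  case (Some a)
  then have "Some -` {x} = {a}" by auto
  then show ?thesis by (simp add: sets_eq P1_sets_def)
qed (simp add: sets_eq P1_sets_def vimage_def)

lemma P1_continuous_measurable: "P1_continuous \<phi> \<Longrightarrow> \<phi> \<in> borel_measurable \<mu>"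
  unfolding measurable_iff P1_continuous_def by (auto intro: borel_measurable_continuous_onI)

lemma P1_continuous_integrable:
  assumes "P1_continuous \<phi>"
  shows "integrable \<mu> \<phi>"
proof -
  obtain C where "\<And>x. \<bar>\<phi> x\<bar> \<le> C" using P1_continuous_bounded[OF assms] by blast
  then show ?thesis
    by (intro integrable_const_bound[of _ C]) (use P1_continuous_measurable[OF assms] in auto)
qed

text \<open>Rays from one tip with different slopes meet only in the tip, which has no mass, so at
  most countably many of them are charged. Viewing the slope as a random variable turns these into
  atoms of its law. Only finitely many slopes are spoiled by \<open>w\<close>.\<close>

lemma null_ray_direction:
  assumes atom: "\<And>a. measure \<mu> {a} = 0" and V: "finite V" "w \<notin> V"
  obtains m where "w \<notin> (\<Union>v\<in>V. ray m v)" "measure \<mu> (Some ` (\<Union>v\<in>V. ray m v)) = 0"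
proof -
  define sl where "sl = (\<lambda>v z. Im (z - v) / Re (z - v))"
  define sl' where "sl' = (\<lambda>v x. case x of None \<Rightarrow> 0 | Some z \<Rightarrow> sl v z)"
  have meas: "sl' v \<in> borel_measurable \<mu>" for v
    unfolding measurable_iff sl'_def sl_def by simp
  have "countable {s. measure (distr \<mu> borel (sl' v)) {s} \<noteq> 0}" for v
  proof -
    interpret D: prob_space "distr \<mu> borel (sl' v)" by (rule prob_space_distr[OF meas])
    show ?thesis by (rule D.countable_support)
  qed
  then have "countable ({0} \<union> (\<Union>v\<in>V. {s. measure (distr \<mu> borel (sl' v)) {s} \<noteq> 0} \<union> {sl v w}))"
    using V by (intro countable_Un countable_UN) (auto simp: countable_finite)
  then have "({0} \<union> (\<Union>v\<in>V. {s. measure (distr \<mu> borel (sl' v)) {s} \<noteq> 0} \<union> {sl v w})) \<noteq> UNIV"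
    using uncountable_UNIV_real by metis
  then obtain m where m: "m \<noteq> 0" "\<And>v. v \<in> V \<Longrightarrow> measure (distr \<mu> borel (sl' v)) {m} = 0"
     "\<And>v. v \<in> V \<Longrightarrow> m \<noteq> sl v w" by auto
  have slope: "sl v z = m" if "z \<in> ray m v" "z \<noteq> v" for v z
  proof -
    have eq: "Im (z - v) = m * Re (z - v)" using that by (auto simp: ray_def algebra_simps)
    have "Re (z - v) \<noteq> 0" using eq that(2) by (auto simp: complex_eq_iff)
    then show ?thesis using eq by (simp add: sl_def)
  qed
  show ?thesis
  proof (rule that)
    show "w \<notin> (\<Union>v\<in>V. ray m v)" using slope m(3) V(2) by blast
    have "Some ` ray m v \<in> null_sets \<mu>" if v: "v \<in> V" for v
    proof -
      have s1: "sl' v -` {m} \<inter> space \<mu> \<in> sets \<mu>" using meas by (rule measurable_sets) auto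
      have "measure \<mu> (sl' v -` {m} \<inter> space \<mu>) = 0"
        using m(2)[OF v] measure_distr[OF meas, of "{m}" v] by simp
      then have "sl' v -` {m} \<inter> space \<mu> \<in> null_sets \<mu>" using s1 by (auto simp: null_sets_def emeasure_eq_measure)
      moreover have "{Some v} \<in> null_sets \<mu>" using atom singleton_sets by (auto simp: null_sets_def emeasure_eq_measure)
      ultimately have "{Some v} \<union> (sl' v -` {m} \<inter> space \<mu>) \<in> null_sets \<mu>" by (rule null_sets.Un[rotated])
      moreover have "Some ` ray m v \<subseteq> {Some v} \<union> (sl' v -` {m} \<inter> space \<mu>)"
        using slope by (auto simp: sl'_def space_eq)
      moreover have "Some ` ray m v \<in> sets \<mu>" by (intro Some_image_sets borel_closed closed_ray)
      ultimately show ?thesis using null_sets_subset by blast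
    qed
    then have "(\<Union>v\<in>V. Some ` ray m v) \<in> null_sets \<mu>" using V(1)
      by (intro null_sets.finite_UN) auto
    then have "Some ` (\<Union>v\<in>V. ray m v) \<in> null_sets \<mu>" by (simp add: image_UN)
    then show "measure \<mu> (Some ` (\<Union>v\<in>V. ray m v)) = 0" by (simp add: null_sets_def emeasure_eq_measure)
  qed
qed

lemma cutoff_function:
  assumes U: "open U" "U \<noteq> UNIV" "measure \<mu> (- Some ` U) = 0"
    and \<phi>: "P1_continuous \<phi>" and e: "e > 0"
  obtains \<eta> K where "P1_continuous \<eta>" "compact K" "K \<subseteq> U" "\<And>x. 0 \<le> \<eta> x" "\<And>x. \<eta> x \<le> 1"
    "\<And>x. \<eta> x > 0 \<Longrightarrow> x \<in> Some ` K" "integral\<^sup>L \<mu> \<phi> - e \<le> integral\<^sup>L \<mu> (\<lambda>x. \<phi> x * \<eta> x)"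
proof -
  \<comment> \<open>The first factor is 0 up to distance \<open>1 / m\<close> from the complement of
    \<open>U\<close> and 1 from distance \<open>2 / m\<close> on; the second one cuts off near
    infinity. Together they tend to 1 pointwise on \<open>U\<close>, hence almost
    everywhere.\<close>
  define c where "c = (\<lambda>m z. max 0 (min 1 (real m * infdist z (- U) - 1)) * max 0 (min 1 (real m - cmod z)))"
  define \<eta> where "\<eta> = (\<lambda>m x. case x of None \<Rightarrow> 0 | Some z \<Rightarrow> c m z)"
  have ccont: "continuous_on UNIV (c m)" for m unfolding c_def by (intro continuous_intros)
  have c01: "0 \<le> c m z" "c m z \<le> 1" for m z by (auto simp: c_def intro!: mult_le_one)
  have \<eta>01: "0 \<le> \<eta> m x" "\<eta> m x \<le> 1" for m x using c01 by (auto simp: \<eta>_def split: option.split)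
  have \<eta>cont: "P1_continuous (\<eta> m)" for m
    unfolding P1_continuous_def
  proof
    show "continuous_on UNIV (\<lambda>z. \<eta> m (Some z))" using ccont by (simp add: \<eta>_def)
    have "eventually (\<lambda>z. c m z = 0) at_infinity"
      unfolding eventually_at_infinity by (rule exI[of _ "real m"]) (auto simp: c_def)
    then show "((\<lambda>z. \<eta> m (Some z)) \<longlongrightarrow> \<eta> m None) at_infinity"
      by (simp add: \<eta>_def tendsto_eventually)
  qed
  define K where "K = (\<lambda>m. {z. 1 \<le> real m * infdist z (- U)} \<inter> cball 0 (real m))"
  have "compact (K m)" for m
    unfolding K_def by (intro closed_Int_compact compact_cball closed_Collect_le continuous_intros)
  moreover have "K m \<subseteq> U" for m
  proof
    fix z assume "z \<in> K m"
    then have "infdist z (- U) \<noteq> 0" by (auto simp: K_def)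
    then show "z \<in> U" using infdist_zero[of z "- U"] by blast
  qed
  moreover have "x \<in> Some ` K m" if "\<eta> m x > 0" for m x
  proof (cases x)
    case (Some z)
    then have "c m z > 0" using that by (simp add: \<eta>_def)
    then have "real m * infdist z (- U) - 1 > 0" "real m - cmod z > 0"
      by (auto simp: c_def zero_less_mult_iff max_def split: if_splits)
    then show ?thesis using Some by (auto simp: K_def)
  qed (use that in \<open>simp add: \<eta>_def\<close>)
  moreover have "\<exists>m. integral\<^sup>L \<mu> \<phi> - e \<le> integral\<^sup>L \<mu> (\<lambda>x. \<phi> x * \<eta> m x)"
  proof -
    obtain C where C: "\<And>x. \<bar>\<phi> x\<bar> \<le> C" using P1_continuous_bounded[OF \<phi>] by blast
    have ptw: "(\<lambda>m. c m z) \<longlonglongrightarrow> 1" if z: "z \<in> U" for z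
    proof -
      have "closed (- U)" "- U \<noteq> {}" using U by auto
      then have d: "infdist z (- U) > 0" using z in_closed_iff_infdist_zero[of "- U" z] infdist_nonneg[of z "- U"]
        by (metis ComplD less_eq_real_def)
      obtain m0 :: nat where m0: "real m0 \<ge> 2 / infdist z (- U)" using real_arch_simple by blast
      obtain m1 :: nat where m1: "real m1 \<ge> cmod z + 1" using real_arch_simple by blast
      have "c m z = 1" if "m \<ge> max m0 m1" for m
      proof -
        have "2 / infdist z (- U) \<le> real m" using m0 that by linarith
        then have "2 \<le> real m * infdist z (- U)" using d by (simp add: field_simps)
        moreover have "cmod z + 1 \<le> real m" using m1 that by linarith
        ultimately show ?thesis by (simp add: c_def)
      qed
      then have "eventually (\<lambda>m. c m z = 1) sequentially" unfolding eventually_sequentially by blast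
      then show ?thesis by (rule tendsto_eventually)
    qed
    have "(\<lambda>m. integral\<^sup>L \<mu> (\<lambda>x. \<phi> x * \<eta> m x)) \<longlonglongrightarrow> integral\<^sup>L \<mu> \<phi>"
    proof (rule integral_dominated_convergence[where w = "\<lambda>_. C"])
      have "- Some ` U \<in> sets \<mu>" using Some_image_sets[of U] U(1) sets.compl_sets[of "Some ` U" \<mu>]
        by (simp add: space_eq Compl_eq_Diff_UNIV)
      then have "- Some ` U \<in> null_sets \<mu>" using U(3) by (auto simp: null_sets_def emeasure_eq_measure)
      then have "AE x in \<mu>. x \<notin> - Some ` U" by (rule AE_not_in)
      then show "AE x in \<mu>. (\<lambda>m. \<phi> x * \<eta> m x) \<longlonglongrightarrow> \<phi> x"
      proof eventually_elim
        case (elim x)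
        then obtain z where "z \<in> U" "x = Some z" by auto
        then show ?case using tendsto_mult[OF tendsto_const[of "\<phi> x"] ptw[of z]] by (simp add: \<eta>_def)
      qed
      show "AE x in \<mu>. norm (\<phi> x * \<eta> m x) \<le> C" for m
      proof (rule AE_I2)
        fix x
        have "\<bar>\<phi> x\<bar> * \<bar>\<eta> m x\<bar> \<le> C * 1" using C[of x] \<eta>01[of m x] by (intro mult_mono) auto
        then show "norm (\<phi> x * \<eta> m x) \<le> C" by (simp add: abs_mult)
      qed
    qed (use P1_continuous_measurable \<phi> \<eta>cont in auto)
    then have "eventually (\<lambda>m. dist (integral\<^sup>L \<mu> (\<lambda>x. \<phi> x * \<eta> m x)) (integral\<^sup>L \<mu> \<phi>) < e) sequentially"
      using e by (rule tendstoD)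
    then obtain m where "dist (integral\<^sup>L \<mu> (\<lambda>x. \<phi> x * \<eta> m x)) (integral\<^sup>L \<mu> \<phi>) < e"
      unfolding eventually_sequentially by blast
    then show ?thesis by (intro exI[of _ m]) (auto simp: dist_real_def)
  qed
  ultimately show ?thesis using that \<eta>cont \<eta>01 by metis
qed

end

section \<open>Iterates and inverse branches\<close>

lemma comp_seq_Nil [simp]: "comp_seq g [] = id"
  by (simp add: comp_seq_def)

text \<open>Prolonging a sequence at its head composes on the inside, so for inverse branches it
  amounts to one further lift by \<open>g j\<close>. This is the shape of the inductions over index
  sequences.\<close>

lemma comp_seq_Cons: "comp_seq g (j # js) = comp_seq g js \<circ> g j"
proof -
  have "fold (\<lambda>j f. g j \<circ> f) js h = fold (\<lambda>j f. g j \<circ> f) js id \<circ> h" for h :: "complex option \<Rightarrow> complex option"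
  proof (induction js arbitrary: h)
    case (Cons i js)
    show ?case using Cons[of "g i \<circ> h"] Cons[of "g i"] by (simp add: o_assoc)
  qed simp
  from this[of "g j"] show ?thesis by (simp add: comp_seq_def)
qed

lemma index_seqs_0 [simp]: "index_seqs N 0 = {[]}"
  by (auto simp: index_seqs_def)

lemma index_seqs_Suc: "index_seqs N (Suc n) = (\<lambda>(j, js). j # js) ` ({..<N} \<times> index_seqs N n)"
  by (auto simp: index_seqs_def length_Suc_conv image_iff)

lemma sum_index_seqs_Suc: "(\<Sum>js\<in>index_seqs N (Suc n). F js) = (\<Sum>j<N. \<Sum>js\<in>index_seqs N n. F (j # js))"
proof -
  have "inj_on (\<lambda>(j, js). j # js) ({..<N} \<times> index_seqs N n)" by (auto simp: inj_on_def)
  then show ?thesis unfolding index_seqs_Suc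
    by (simp add: sum.reindex sum.cartesian_product case_prod_unfold)
qed

lemma finite_index_seqs [simp]: "finite (index_seqs N n)"
  by (induction n) (auto simp: index_seqs_Suc)

lemma card_index_seqs: "card (index_seqs N n) = N ^ n"
proof (induction n)
  case (Suc n)
  then show ?case using sum_index_seqs_Suc[of "\<lambda>_. 1::nat" N n] by simp
qed simp

definition deg_seq :: "(nat \<Rightarrow> nat) \<Rightarrow> nat list \<Rightarrow> nat" where
  "deg_seq d js = prod_list (map d js)"

lemma sum_deg_seq: "(\<Sum>js\<in>index_seqs N n. deg_seq d js) = (\<Sum>j<N. d j) ^ n"
proof (induction n)
  case (Suc n)
  have "(\<Sum>js\<in>index_seqs N (Suc n). deg_seq d js) = (\<Sum>j<N. d j * (\<Sum>js\<in>index_seqs N n. deg_seq d js))"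
    by (simp add: sum_index_seqs_Suc deg_seq_def sum_distrib_left)
  then show ?case by (simp add: Suc sum_distrib_right)
qed (simp add: deg_seq_def)

text \<open>The default 0 at infinity is the one of \<open>chart\<close>, so that
  \<open>loc_rep\<close> between finite points is literally a composition with this
  function.\<close>

definition finite_part :: "complex option \<Rightarrow> complex" where
  "finite_part x = (case x of None \<Rightarrow> 0 | Some z \<Rightarrow> z)"

lemma finite_part_Some [simp]: "finite_part (Some z) = z" by (simp add: finite_part_def)

section \<open>Excluded points and regular orbits of a correspondence\<close>

locale correspondence =
  fixes g :: "nat \<Rightarrow> complex option \<Rightarrow> complex option"
    and p q :: "nat \<Rightarrow> complex poly" and d :: "nat \<Rightarrow> nat" and N :: nat
  assumes rational: "\<And>j. j < N \<Longrightarrow> rational_map (p j) (q j) (d j)"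
    and g: "\<And>j. j < N \<Longrightarrow> g j = rat_map_of (p j) (q j)"
    and big: "\<exists>j<N. d j \<ge> 2"
begin

definition d1 :: nat where "d1 = (\<Sum>j<N. d j)"

text \<open>The points 0 and 1 are included only to make Schottky's theorem applicable to inverse branches.\<close>

definition excluded :: "complex option set" where
  "excluded = {None, Some 0, Some 1} \<union> (\<Union>j<N. Some ` {z. poly (rational_map.wronskian (p j) (q j)) z = 0})"

lemma N_pos: "N \<ge> 1" using big by auto

lemma N_less_d1: "N < d1"
proof -
  obtain i where i: "i < N" "d i \<ge> 2" using big by auto
  have "(\<Sum>j<N. 1) < (\<Sum>j<N. d j)"
    by (rule sum_strict_mono_ex1) (use i rational rational_map.pos in \<open>force+\<close>)
  then show ?thesis by (simp add: d1_def)
qed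

lemma finite_excluded: "finite excluded"
proof -
  have "finite {z. poly (rational_map.wronskian (p j) (q j)) z = 0}" if "j < N" for j
    using rational_map.wronskian_nonzero[OF rational[OF that]] by (rule poly_roots_finite)
  then show ?thesis unfolding excluded_def by simp
qed

lemma None_excluded: "None \<in> excluded" and zero_excluded: "Some 0 \<in> excluded" and one_excluded: "Some 1 \<in> excluded"
  by (auto simp: excluded_def)

lemma wronskian_ne: "Some z \<notin> excluded \<Longrightarrow> j < N \<Longrightarrow> poly (rational_map.wronskian (p j) (q j)) z \<noteq> 0"
  by (auto simp: excluded_def)

text \<open>The condition is on values: no excluded point may lie in the same fibre of
  \<open>g j\<close>, although only \<open>x\<close> itself is followed. This is what puts
  \<open>g j x\<close> into the open set over which \<open>g j\<close> is an unbranched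
  covering.\<close>

primrec regular_orbit :: "nat list \<Rightarrow> complex option \<Rightarrow> bool" where
  "regular_orbit [] x \<longleftrightarrow> x \<notin> excluded"
| "regular_orbit (j # js) x \<longleftrightarrow> g j x \<notin> g j ` excluded \<and> regular_orbit js (g j x)"

lemma regular_orbit_not_excluded: "regular_orbit js x \<Longrightarrow> x \<notin> excluded"
  by (cases js) auto

lemma regular_orbit_of_value:
  assumes "\<And>is b. set is \<subseteq> {..<N} \<Longrightarrow> b \<in> excluded \<Longrightarrow> comp_seq g is b \<noteq> y"
    and "set js \<subseteq> {..<N}" "comp_seq g js x = y"
  shows "regular_orbit js x"
  using assms(2,3)
proof (induction js arbitrary: x)
  case Nil
  then show ?case using assms(1)[of "[]" x] by auto
next
  case (Cons j js)
  have "g j x \<notin> g j ` excluded"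
  proof
    assume "g j x \<in> g j ` excluded"
    then obtain b where "b \<in> excluded" "g j x = g j b" by auto
    then show False using assms(1)[of "j # js" b] Cons.prems by (simp add: comp_seq_Cons)
  qed
  then show ?case using Cons by (simp add: comp_seq_Cons)
qed

definition unbranched :: "nat \<Rightarrow> complex set" where
  "unbranched j = {c. Some c \<notin> g j ` excluded}"

lemma open_unbranched: "open (unbranched j)"
proof -
  have "unbranched j = - (Some -` (g j ` excluded))" by (auto simp: unbranched_def)
  moreover have "finite (Some -` (g j ` excluded))" using finite_excluded by (intro finite_vimageI) auto
  ultimately show ?thesis by (metis finite_imp_closed open_Compl)
qed

lemma unbranched_regular:
  assumes "j < N" "c \<in> unbranched j"
  shows "rational_map.regular_value (p j) (q j) c"
  unfolding rational_map.regular_value_def[OF rational[OF assms(1)]]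
proof (intro conjI allI impI)
  show "rat_map_of (p j) (q j) None \<noteq> Some c"
    using assms None_excluded g[OF assms(1)] by (force simp: unbranched_def)
  fix z assume "rat_map_of (p j) (q j) (Some z) = Some c"
  then have "Some z \<notin> excluded" using assms g[OF assms(1)] by (force simp: unbranched_def)
  then show "poly (rational_map.wronskian (p j) (q j)) z \<noteq> 0" using assms(1) by (rule wronskian_ne)
qed

lemma regular_orbit_Cons_Some:
  assumes "regular_orbit (j # js) (Some u)" "j < N"
  obtains v where "g j (Some u) = Some v" "v \<in> unbranched j" "v = poly (p j) u / poly (q j) u"
    "poly (q j) u \<noteq> 0" "poly (rational_map.wronskian (p j) (q j)) u \<noteq> 0" "regular_orbit js (Some v)"
proof -
  have "g j (Some u) \<notin> excluded" using assms regular_orbit_not_excluded by auto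
  then obtain v where v: "g j (Some u) = Some v" using None_excluded by (cases "g j (Some u)") auto
  have "Some u \<notin> excluded" using assms(1) by (rule regular_orbit_not_excluded)
  moreover have "poly (q j) u \<noteq> 0 \<and> v = poly (p j) u / poly (q j) u"
    using v g[OF assms(2)] by (auto simp: rat_map_of_def split: if_splits)
  moreover have "v \<in> unbranched j" using assms v by (auto simp: unbranched_def)
  ultimately show ?thesis using that v assms wronskian_ne by auto
qed

lemma regular_orbit_has_derivative:
  assumes "set js \<subseteq> {..<N}" "regular_orbit js (Some u)"
  shows "\<exists>D. D \<noteq> 0 \<and> ((\<lambda>v. finite_part (comp_seq g js (Some v))) has_field_derivative D) (at u)"
  using assms
proof (induction js arbitrary: u)
  case Nil
  then show ?case by (intro exI[of _ 1]) auto
next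
  case (Cons j js)
  have j: "j < N" using Cons.prems by simp
  interpret R: rational_map "p j" "q j" "d j" by (rule rational[OF j])
  obtain v where v: "g j (Some u) = Some v" "v = poly (p j) u / poly (q j) u"
    "poly (q j) u \<noteq> 0" "poly R.wronskian u \<noteq> 0" "regular_orbit js (Some v)"
    using regular_orbit_Cons_Some[OF Cons.prems(2) j] by metis
  obtain D where D: "D \<noteq> 0" "((\<lambda>v. finite_part (comp_seq g js (Some v))) has_field_derivative D) (at v)"
    using Cons.IH[OF _ v(5)] Cons.prems by auto
  let ?D = "D * (poly R.wronskian u / (poly (q j) u)\<^sup>2)"
  have "((\<lambda>z. finite_part (comp_seq g js (Some (poly (p j) z / poly (q j) z)))) has_field_derivative ?D) (at u)"
    using DERIV_chain2[OF D(2)[unfolded v(2)] R.has_derivative_quotient[OF v(3)]] .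
  moreover have "open {z. poly (q j) z \<noteq> 0}" by (intro open_Collect_neq continuous_intros)
  ultimately have "((\<lambda>z. finite_part (comp_seq g (j # js) (Some z))) has_field_derivative ?D) (at u)"
    by (rule has_field_derivative_transform_within_open)
       (use v(3) g[OF j] in \<open>auto simp: comp_seq_Cons rat_map_of_def\<close>)
  moreover have "?D \<noteq> 0" using D(1) v(3,4) by simp
  ultimately show ?case by blast
qed

lemma local_degree_regular_orbit:
  assumes "set js \<subseteq> {..<N}" "regular_orbit js (Some u)" "comp_seq g js (Some u) = Some y"
  shows "local_degree (comp_seq g js) (Some u) = 1"
proof -
  have eq: "loc_rep (comp_seq g js) (Some u) = (\<lambda>v. finite_part (comp_seq g js (Some v)))"
    using assms(3) by (auto simp: loc_rep_def chart_def chart_inv_def finite_part_def fun_eq_iff)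
  obtain D where D: "D \<noteq> 0" "((\<lambda>v. finite_part (comp_seq g js (Some v))) has_field_derivative D) (at u)"
    using regular_orbit_has_derivative[OF assms(1,2)] by blast
  have "chart_pt (Some u) = u" by (simp add: chart_pt_def chart_def)
  then have "(deriv ^^ 1) (loc_rep (comp_seq g js) (Some u)) (chart_pt (Some u)) \<noteq> 0"
    using D(1) DERIV_imp_deriv[OF D(2)] by (simp add: eq)
  then show ?thesis unfolding local_degree_def by (intro Least_equality) auto
qed

lemma repelling_of_expanding:
  assumes "((\<lambda>v. finite_part (comp_seq g js (Some v))) has_field_derivative D) (at x)"
    "comp_seq g js (Some x) = Some x" "cmod D > 1"
  shows "repelling_fixed_point (comp_seq g js) (Some x)"
proof -
  have eq: "loc_rep (comp_seq g js) (Some x) = (\<lambda>v. finite_part (comp_seq g js (Some v)))"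
    using assms(2) by (auto simp: loc_rep_def chart_def chart_inv_def finite_part_def fun_eq_iff)
  have "chart_pt (Some x) = x" by (simp add: chart_pt_def chart_def)
  then show ?thesis using assms unfolding repelling_fixed_point_def by (auto simp: eq)
qed

end

section \<open>Preimages of a point that no excluded orbit reaches\<close>

locale unramified_point = correspondence +
  fixes w :: complex
  assumes avoid: "\<And>js b. set js \<subseteq> {..<N} \<Longrightarrow> b \<in> excluded \<Longrightarrow> comp_seq g js b \<noteq> Some w"
begin

definition preimages :: "nat list \<Rightarrow> complex set" where
  "preimages js = {z. comp_seq g js (Some z) = Some w}"

lemma preimage_regular_orbit:
  assumes "set js \<subseteq> {..<N}" "comp_seq g js x = Some w"
  shows "regular_orbit js x" "x \<noteq> None"
proof -
  show r: "regular_orbit js x" using regular_orbit_of_value[OF avoid assms] .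
  show "x \<noteq> None" using regular_orbit_not_excluded[OF r] None_excluded by metis
qed

lemma preimages_Cons:
  assumes "set (j # js) \<subseteq> {..<N}"
  shows "preimages (j # js) = (\<Union>y\<in>preimages js. {z. g j (Some z) = Some y})"
proof -
  have "\<exists>y. g j (Some z) = Some y \<and> y \<in> preimages js" if "z \<in> preimages (j # js)" for z
  proof -
    have 1: "comp_seq g js (g j (Some z)) = Some w" using that by (simp add: preimages_def comp_seq_Cons)
    then have "g j (Some z) \<noteq> None" using preimage_regular_orbit(2)[OF _ 1] assms by simp
    then show ?thesis using 1 by (auto simp: preimages_def)
  qed
  then show ?thesis by (auto simp: preimages_def comp_seq_Cons)
qed

lemma fibre:
  assumes "j < N"
  shows "finite {z. g j (Some z) = Some y}" "card {z. g j (Some z) = Some y} \<le> d j"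
proof -
  interpret R: rational_map "p j" "q j" "d j" by (rule rational[OF assms])
  show "finite {z. g j (Some z) = Some y}" "card {z. g j (Some z) = Some y} \<le> d j"
    unfolding g[OF assms] by (rule R.fibre_finite, rule R.card_fibre_le)
qed

lemma card_fibres:
  assumes "j < N" "finite Y"
  shows "card (\<Union>y\<in>Y. {z. g j (Some z) = Some y}) \<le> d j * card Y"
proof -
  have "card (\<Union>y\<in>Y. {z. g j (Some z) = Some y}) \<le> (\<Sum>y\<in>Y. card {z. g j (Some z) = Some y})"
    by (rule card_UN_le[OF assms(2)])
  also have "\<dots> \<le> (\<Sum>y\<in>Y. d j)" using fibre(2)[OF assms(1)] by (rule sum_mono)
  finally show ?thesis by (simp add: mult.commute)
qed

lemma preimages_finite_card:
  assumes "set js \<subseteq> {..<N}"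
  shows "finite (preimages js) \<and> card (preimages js) \<le> deg_seq d js"
  using assms
proof (induction js)
  case Nil
  have "preimages [] = {w}" by (auto simp: preimages_def)
  then show ?case by (simp add: deg_seq_def)
next
  case (Cons j js)
  have j: "j < N" using Cons.prems by simp
  have IH: "finite (preimages js)" "card (preimages js) \<le> deg_seq d js" using Cons by auto
  have "card (preimages (j # js)) \<le> d j * card (preimages js)"
    unfolding preimages_Cons[OF Cons.prems] by (rule card_fibres[OF j IH(1)])
  also have "\<dots> \<le> d j * deg_seq d js" using IH(2) by simp
  finally show ?case using IH fibre(1)[OF j] preimages_Cons[OF Cons.prems] by (simp add: deg_seq_def)
qed

text \<open>Preimages of \<open>w\<close> have regular orbits, so they are finite points of local
  degree one and the multiplicities disappear from the sum.\<close>

lemma pullback_avg_eq: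
  "pullback_avg g N d1 (Some w) n \<phi> = 1 / real d1 ^ n * (\<Sum>js\<in>index_seqs N n. \<Sum>z\<in>preimages js. \<phi> (Some z))"
proof -
  have "(\<Sum>z\<in>{z. comp_seq g js z = Some w}. real (local_degree (comp_seq g js) z) * \<phi> z) = (\<Sum>z\<in>preimages js. \<phi> (Some z))"
    if "js \<in> index_seqs N n" for js
  proof -
    have js: "set js \<subseteq> {..<N}" using that by (simp add: index_seqs_def)
    have eq: "{z. comp_seq g js z = Some w} = Some ` preimages js"
    proof
      show "{z. comp_seq g js z = Some w} \<subseteq> Some ` preimages js"
      proof
        fix z assume "z \<in> {z. comp_seq g js z = Some w}"
        then have z: "comp_seq g js z = Some w" by simp
        then obtain u where "z = Some u" using preimage_regular_orbit(2)[OF js z] by blast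
        then show "z \<in> Some ` preimages js" using z by (simp add: preimages_def)
      qed
    qed (auto simp: preimages_def)
    have "local_degree (comp_seq g js) (Some z) = 1" if "z \<in> preimages js" for z
      using that local_degree_regular_orbit[OF js preimage_regular_orbit(1)[OF js]] by (simp add: preimages_def)
    then show ?thesis unfolding eq by (simp add: sum.reindex)
  qed
  then show ?thesis unfolding pullback_avg_def by simp
qed

end

section \<open>Inverse branches over a simply connected domain\<close>

locale inverse_branches = unramified_point +
  fixes \<psi> :: "complex \<Rightarrow> complex"
  assumes psi_hol: "\<psi> holomorphic_on ball 0 1" and psi_inj: "inj_on \<psi> (ball 0 1)"
    and psi_0: "\<psi> 0 = w"
begin

text \<open>An inverse branch of the composite over the image of \<open>\<psi>\<close>, pulled back
  to the unit disc, which is the setting of the theorems of Schottky and Bloch. Regularity keeps its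
  values away from the excluded points.\<close>

definition branch :: "nat list \<Rightarrow> (complex \<Rightarrow> complex) \<Rightarrow> bool" where
  "branch js H \<longleftrightarrow> H holomorphic_on ball 0 1 \<and>
     (\<forall>u\<in>ball 0 1. regular_orbit js (Some (H u)) \<and> comp_seq g js (Some (H u)) = Some (\<psi> u))"

text \<open>Since a branch is determined by its value at one point, branches are counted through the
  preimages of \<open>w\<close> at their centres.\<close>

definition good :: "nat list \<Rightarrow> complex set" where
  "good js = {z. \<exists>H. branch js H \<and> H 0 = z}"

definition bad :: "nat list \<Rightarrow> complex set" where
  "bad js = preimages js - good js"

lemma branch_step:
  assumes "branch (j # js) H" "j < N"
  defines "K \<equiv> (\<lambda>u. poly (p j) (H u) / poly (q j) (H u))"
  shows "branch js K" "\<And>u. u \<in> ball 0 1 \<Longrightarrow> g j (Some (H u)) = Some (K u)" "\<And>u. u \<in> ball 0 1 \<Longrightarrow> K u \<in> unbranched j"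
proof -
  have H: "H holomorphic_on ball 0 1" "\<And>u. u \<in> ball 0 1 \<Longrightarrow> regular_orbit (j # js) (Some (H u))"
    "\<And>u. u \<in> ball 0 1 \<Longrightarrow> comp_seq g (j # js) (Some (H u)) = Some (\<psi> u)"
    using assms(1) by (auto simp: branch_def)
  have 1: "g j (Some (H u)) = Some (K u) \<and> K u \<in> unbranched j \<and> poly (q j) (H u) \<noteq> 0 \<and> regular_orbit js (Some (K u))"
    if "u \<in> ball 0 1" for u
    using regular_orbit_Cons_Some[OF H(2)[OF that] assms(2)] unfolding K_def by metis
  then show "\<And>u. u \<in> ball 0 1 \<Longrightarrow> g j (Some (H u)) = Some (K u)" "\<And>u. u \<in> ball 0 1 \<Longrightarrow> K u \<in> unbranched j" by auto
  have "K holomorphic_on ball 0 1" unfolding K_def using H(1) 1 by (intro holomorphic_intros) auto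
  moreover have "comp_seq g js (Some (K u)) = Some (\<psi> u)" if "u \<in> ball 0 1" for u
    using H(3)[OF that] 1[OF that] by (simp add: comp_seq_Cons)
  ultimately show "branch js K" using 1 by (auto simp: branch_def)
qed

text \<open>After applying \<open>g j\<close> both branches become branches of the shorter sequence
  that agree at \<open>a\<close>, hence everywhere; then they are lifts of one and the same map
  through the covering.\<close>

lemma branch_unique:
  assumes "set js \<subseteq> {..<N}" "branch js H" "branch js K" "a \<in> ball 0 1" "H a = K a" "u \<in> ball 0 1"
  shows "H u = K u"
  using assms
proof (induction js arbitrary: H K u)
  case Nil
  then show ?case by (simp add: branch_def)
next
  case (Cons j js)
  have j: "j < N" using Cons.prems(1) by simp
  interpret R: rational_map "p j" "q j" "d j" by (rule rational[OF j])
  define H' where "H' = (\<lambda>u. poly (p j) (H u) / poly (q j) (H u))"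
  define K' where "K' = (\<lambda>u. poly (p j) (K u) / poly (q j) (K u))"
  note H' = branch_step[OF Cons.prems(2) j, folded H'_def]
  note K' = branch_step[OF Cons.prems(3) j, folded K'_def]
  have eq: "H' v = K' v" if "v \<in> ball 0 1" for v
    by (rule Cons.IH[OF _ H'(1) K'(1)]) (use Cons.prems that in \<open>auto simp: H'_def K'_def\<close>)
  show ?case
  proof (rule R.holomorphic_lift_unique[where U = "ball 0 1" and a = a and S = "unbranched j" and H = H' and K = H and L = K and x = u])
    show "open (unbranched j)" by (rule open_unbranched)
    show "R.regular_value c" if "c \<in> unbranched j" for c using unbranched_regular[OF j that] .
    show "continuous_on (ball 0 1) H'" "continuous_on (ball 0 1) H" "continuous_on (ball 0 1) K"
      using H'(1) Cons.prems(2,3) by (auto simp: branch_def holomorphic_on_imp_continuous_on)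
    show "rat_map_of (p j) (q j) (Some (H v)) = Some (H' v)" if "v \<in> ball 0 1" for v
      using H'(2)[OF that] by (simp add: H'_def g[OF j])
    show "rat_map_of (p j) (q j) (Some (K v)) = Some (H' v)" if "v \<in> ball 0 1" for v
      using K'(2)[OF that] eq[OF that] by (simp add: K'_def g[OF j])
    show "H' v \<in> unbranched j" if "v \<in> ball 0 1" for v using H'(3)[OF that] by (simp add: H'_def)
  qed (use Cons.prems in auto)
qed

text \<open>A common value has a single image under the composite, so injectivity of
  \<open>\<psi>\<close> makes both branches take it at the same parameter, and uniqueness identifies
  them.\<close>

lemma branch_disjoint:
  assumes "set js \<subseteq> {..<N}" "branch js H" "branch js K" "H 0 \<noteq> K 0"
  shows "H ` ball 0 1 \<inter> K ` ball 0 1 = {}"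
proof (rule ccontr)
  assume "H ` ball 0 1 \<inter> K ` ball 0 1 \<noteq> {}"
  then obtain u v where uv: "u \<in> ball 0 1" "v \<in> ball 0 1" "H u = K v" by auto
  then have "Some (\<psi> u) = Some (\<psi> v)" using assms(2,3) unfolding branch_def by metis
  then have "u = v" using psi_inj uv by (auto dest: inj_onD)
  then show False using branch_unique[OF assms(1-3) uv(1), of 0] uv assms(4) by simp
qed

lemma branch_extend:
  assumes j: "j < N" and K: "branch js K" "\<And>u. u \<in> ball 0 1 \<Longrightarrow> K u \<in> unbranched j"
    and z: "g j (Some z) = Some (K 0)"
  shows "z \<in> good (j # js)"
proof -
  interpret R: rational_map "p j" "q j" "d j" by (rule rational[OF j])
  obtain H where H: "H holomorphic_on ball 0 1" "H 0 = z"
    "\<And>u. u \<in> ball 0 1 \<Longrightarrow> rat_map_of (p j) (q j) (Some (H u)) = Some (K u)"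
  proof (rule R.holomorphic_lift[OF open_unbranched unbranched_regular[OF j], where U = "ball 0 1" and a = 0 and H = K and ?z0.0 = z])
    show "simply_connected (ball (0::complex) 1)" by (simp add: convex_imp_simply_connected)
  qed (use K z g[OF j] in \<open>auto simp: branch_def\<close>)
  have "branch (j # js) H"
    unfolding branch_def
  proof (intro conjI ballI H(1))
    fix u :: complex assume u: "u \<in> ball 0 1"
    have 1: "g j (Some (H u)) = Some (K u)" using H(3)[OF u] g[OF j] by simp
    show "regular_orbit (j # js) (Some (H u))" using K u 1 by (simp add: branch_def unbranched_def)
    show "comp_seq g (j # js) (Some (H u)) = Some (\<psi> u)" using K(1) u 1 by (simp add: branch_def comp_seq_Cons)
  qed
  then show ?thesis using H(2) by (auto simp: good_def)
qed

lemma good_subset_preimages: "good js \<subseteq> preimages js"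
  using psi_0 by (auto simp: good_def preimages_def branch_def)

text \<open>Branches along one sequence have disjoint images, so each excluded point obstructs the
  continuation of at most one of them.\<close>

lemma card_bad_Cons:
  assumes js: "set (j # js) \<subseteq> {..<N}"
  obtains m where "card (bad (j # js)) \<le> d j * card (bad js) + d j * m" "m \<le> card excluded"
    "(\<And>u b. u \<in> ball 0 1 \<Longrightarrow> b \<in> excluded \<Longrightarrow> comp_seq g (j # js) b \<noteq> Some (\<psi> u)) \<Longrightarrow> m = 0"
proof -
  have j: "j < N" and js': "set js \<subseteq> {..<N}" using js by auto
  define hits where "hits = (\<lambda>y. \<exists>K b. branch js K \<and> K 0 = y \<and> b \<in> excluded \<and> g j b \<in> Some ` K ` ball 0 1)"
  define Y where "Y = {y \<in> good js. hits y}"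
  have finpre: "finite (preimages js)" using preimages_finite_card[OF js'] by blast
  then have finY: "finite Y" "finite (bad js)"
    using good_subset_preimages[of js] by (auto simp: Y_def bad_def intro: finite_subset[of _ "preimages js"])
  \<comment> \<open>A preimage is bad only if it lies over a bad one or over the centre of a branch
    obstructed by the image of an excluded point. Each such point below accounts for at most
    \<open>d j\<close> bad preimages above.\<close>
  have "bad (j # js) \<subseteq> (\<Union>y\<in>bad js \<union> Y. {z. g j (Some z) = Some y})"
  proof
    fix z assume z: "z \<in> bad (j # js)"
    then obtain y where y: "y \<in> preimages js" "g j (Some z) = Some y" using preimages_Cons[OF js] by (auto simp: bad_def)
    have "y \<in> bad js \<union> Y"
    proof (rule ccontr)
      assume "y \<notin> bad js \<union> Y"
      then have y2: "y \<in> good js" "\<not> hits y" using y(1) by (auto simp: bad_def Y_def)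
      then obtain K where K: "branch js K" "K 0 = y" by (auto simp: good_def)
      have "K u \<in> unbranched j" if "u \<in> ball 0 1" for u
      proof (rule ccontr)
        assume "K u \<notin> unbranched j"
        then obtain b where b: "b \<in> excluded" "g j b = Some (K u)" by (auto simp: unbranched_def)
        have "hits y" unfolding hits_def
          by (rule exI[of _ K], rule exI[of _ b]) (use b K that in auto)
        then show False using y2(2) by simp
      qed
      then have "z \<in> good (j # js)" using branch_extend[OF j K(1)] y(2) K(2) by auto
      then show False using z by (simp add: bad_def)
    qed
    then show "z \<in> (\<Union>y\<in>bad js \<union> Y. {z. g j (Some z) = Some y})" using y(2) by blast
  qed
  then have "card (bad (j # js)) \<le> card (\<Union>y\<in>bad js \<union> Y. {z. g j (Some z) = Some y})"
    using finY fibre(1)[OF j] by (intro card_mono) auto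
  also have "\<dots> \<le> d j * card (bad js \<union> Y)" using finY by (intro card_fibres[OF j]) auto
  also have "\<dots> \<le> d j * (card (bad js) + card Y)" by (intro mult_left_mono card_Un_le) auto
  finally have main: "card (bad (j # js)) \<le> d j * card (bad js) + d j * card Y" by (simp add: algebra_simps)
  have "\<forall>y\<in>Y. \<exists>bK. branch js (snd bK) \<and> snd bK 0 = y \<and> fst bK \<in> excluded \<and> g j (fst bK) \<in> Some ` snd bK ` ball 0 1"
    unfolding Y_def hits_def by auto
  from bchoice[OF this] obtain F where
    F: "\<forall>y\<in>Y. branch js (snd (F y)) \<and> snd (F y) 0 = y \<and> fst (F y) \<in> excluded \<and> g j (fst (F y)) \<in> Some ` snd (F y) ` ball 0 1"
    by blast
  define b K where "b = (\<lambda>y. fst (F y))" and "K = (\<lambda>y. snd (F y))"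
  have bK: "branch js (K y) \<and> K y 0 = y \<and> b y \<in> excluded \<and> g j (b y) \<in> Some ` K y ` ball 0 1" if "y \<in> Y" for y
    using F that unfolding b_def K_def by blast
  have "card Y \<le> card excluded"
  proof (rule card_inj_on_le[of b])
    show "inj_on b Y"
    proof (rule inj_onI, rule ccontr)
      fix y y' assume y: "y \<in> Y" "y' \<in> Y" "b y = b y'" "y \<noteq> y'"
      have "K y ` ball 0 1 \<inter> K y' ` ball 0 1 = {}"
        by (rule branch_disjoint[OF js']) (use bK y in auto)
      moreover have "g j (b y) \<in> Some ` K y ` ball 0 1" "g j (b y) \<in> Some ` K y' ` ball 0 1"
        using bK[OF y(1)] bK[OF y(2)] y(3) by auto
      ultimately show False by (metis (no_types, lifting) disjoint_iff imageE option.inject)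
    qed
  qed (use bK finite_excluded in auto)
  moreover have "card Y = 0"
    if no: "\<And>u b. u \<in> ball 0 1 \<Longrightarrow> b \<in> excluded \<Longrightarrow> comp_seq g (j # js) b \<noteq> Some (\<psi> u)"
  proof -
    have False if y: "y \<in> Y" for y
    proof -
      from bK[OF y] obtain u where u: "u \<in> ball 0 1" "g j (b y) = Some (K y u)" by auto
      then have "comp_seq g (j # js) (b y) = Some (\<psi> u)" using bK[OF y] by (simp add: comp_seq_Cons branch_def)
      then show False using no[OF u(1)] bK[OF y] by blast
    qed
    then have "Y = {}" by blast
    then show ?thesis by simp
  qed
  ultimately show ?thesis using main that by blast
qed

text \<open>Passing from length \<open>n\<close> to \<open>Suc n\<close> multiplies the old bad
  preimages by \<open>d1\<close> in total and adds at most \<open>d1 * N ^ n * card excluded\<close>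
  new ones, none at all while \<open>n < l\<close>. Divided by \<open>d1 ^ Suc n\<close>, the new
  ones form the \<open>n\<close>-th term of a geometric series, of which only the tail from
  \<open>l\<close> occurs.\<close>

lemma sum_card_bad:
  assumes l: "\<And>js u b. set js \<subseteq> {..<N} \<Longrightarrow> length js \<le> l \<Longrightarrow> u \<in> ball 0 1 \<Longrightarrow> b \<in> excluded \<Longrightarrow>
      comp_seq g js b \<noteq> Some (\<psi> u)"
  shows "real (\<Sum>js\<in>index_seqs N n. card (bad js)) \<le> real d1 ^ n * (card excluded * (\<Sum>k\<in>{l..<n}. (N / d1) ^ k))"
proof (induction n)
  case 0
  have "Some (\<psi> u) \<notin> excluded" if "u \<in> ball 0 1" for u
    using l[of "[]" u "Some (\<psi> u)"] that by auto
  then have "branch [] \<psi>" unfolding branch_def using psi_hol by auto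
  then have "bad [] = {}" using psi_0 by (auto simp: bad_def preimages_def good_def)
  then show ?case by simp
next
  case (Suc n)
  have d1: "real d1 > 0" using N_less_d1 by simp
  let ?S = "\<Sum>js\<in>index_seqs N n. card (bad js)"
  \<comment> \<open>The threshold is \<open>n < l\<close> because the sequences being formed here
    have length \<open>Suc n\<close>, and those of length at most \<open>l\<close> obstruct
    nothing.\<close>
  define E where "E = (if n < l then 0 else card excluded)"
  have "(\<Sum>js\<in>index_seqs N (Suc n). card (bad js)) = (\<Sum>j<N. \<Sum>js\<in>index_seqs N n. card (bad (j # js)))"
    by (rule sum_index_seqs_Suc)
  also have "\<dots> \<le> (\<Sum>j<N. \<Sum>js\<in>index_seqs N n. d j * card (bad js) + d j * E)"
  proof (intro sum_mono)
    fix j js assume j: "j \<in> {..<N}" and js: "js \<in> index_seqs N n"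
    then have s: "set (j # js) \<subseteq> {..<N}" "length (j # js) = Suc n" by (auto simp: index_seqs_def)
    obtain m where m: "card (bad (j # js)) \<le> d j * card (bad js) + d j * m" "m \<le> card excluded"
      "(\<And>u b. u \<in> ball 0 1 \<Longrightarrow> b \<in> excluded \<Longrightarrow> comp_seq g (j # js) b \<noteq> Some (\<psi> u)) \<Longrightarrow> m = 0"
      by (rule card_bad_Cons[OF s(1)]) blast
    have "m \<le> E"
    proof (cases "n < l")
      case True
      then have "m = 0" using m(3) l[OF s(1)] s(2) by simp
      then show ?thesis by simp
    qed (use m(2) in \<open>simp add: E_def\<close>)
    then have "d j * m \<le> d j * E" by simp
    then show "card (bad (j # js)) \<le> d j * card (bad js) + d j * E" using m(1) by linarith
  qed
  also have "\<dots> = d1 * ?S + d1 * (N ^ n * E)"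
  proof -
    have "(\<Sum>j<N. \<Sum>js\<in>index_seqs N n. d j * card (bad js) + d j * E) = (\<Sum>j<N. d j * (?S + N ^ n * E))"
      by (simp add: sum.distrib card_index_seqs algebra_simps flip: sum_distrib_left)
    also have "\<dots> = d1 * (?S + N ^ n * E)" unfolding d1_def by (rule sum_distrib_right[symmetric])
    finally show ?thesis by (simp add: algebra_simps)
  qed
  finally have "real (\<Sum>js\<in>index_seqs N (Suc n). card (bad js)) \<le> real (d1 * ?S + d1 * (N ^ n * E))"
    by (simp only: of_nat_le_iff)
  also have "\<dots> = real d1 * real ?S + real d1 * (real N ^ n * real E)" by simp
  also have "\<dots> \<le> real d1 * (real d1 ^ n * (card excluded * (\<Sum>k\<in>{l..<n}. (N / d1) ^ k))) + real d1 * (real N ^ n * real E)"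
    using Suc.IH d1 by (intro add_right_mono mult_left_mono) auto
  also have "\<dots> = real d1 * (real d1 ^ n * (card excluded * (\<Sum>k\<in>{l..<n}. (N / d1) ^ k))) + real d1 ^ Suc n * ((N / d1) ^ n * real E)"
    using d1 by (simp add: power_divide)
  also have "\<dots> =
      real d1 ^ Suc n * (card excluded * (\<Sum>k\<in>{l..<n}. (N / d1) ^ k) + (N / d1) ^ n * real E)"
    by (simp add: algebra_simps)
  also have "card excluded * (\<Sum>k\<in>{l..<n}. (N / d1) ^ k) + (N / d1) ^ n * real E = card excluded * (\<Sum>k\<in>{l..<Suc n}. (N / d1) ^ k)"
    by (cases "n < l") (auto simp: E_def algebra_simps)
  finally show ?case .
qed

end

section \<open>The equilibrium measure has no atoms\<close>

context correspondence
begin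

text \<open>The pair \<open>R\<close> holds homogeneous coordinates of a curve; common factors are
  never cancelled, so that the degrees and the growth stay under control.\<close>

primrec comp_polys :: "nat list \<Rightarrow> complex poly \<times> complex poly \<Rightarrow> complex poly \<times> complex poly" where
  "comp_polys [] R = R"
| "comp_polys (j # js) R = comp_polys js (hcomp (d j) (p j) (fst R) (snd R), hcomp (d j) (q j) (fst R) (snd R))"

definition hnorm :: "complex poly \<times> complex poly \<Rightarrow> complex \<Rightarrow> real" where
  "hnorm R t = max (cmod (poly (fst R) t)) (cmod (poly (snd R) t))"

definition curve_pt :: "complex poly \<times> complex poly \<Rightarrow> complex \<Rightarrow> complex option" where
  "curve_pt R t = to_curve_pt (poly (fst R) t) (poly (snd R) t)"

lemma hnorm_pos_iff: "hnorm R t > 0 \<longleftrightarrow> poly (fst R) t \<noteq> 0 \<or> poly (snd R) t \<noteq> 0"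
  by (auto simp: hnorm_def less_max_iff_disj)

lemma comp_polys_curve_pt:
  assumes "set js \<subseteq> {..<N}" "hnorm R t > 0"
  shows "comp_seq g js (curve_pt R t) = curve_pt (comp_polys js R) t \<and> hnorm (comp_polys js R) t > 0"
  using assms
proof (induction js arbitrary: R)
  case (Cons j js)
  have j: "j < N" using Cons.prems by simp
  interpret R: rational_map "p j" "q j" "d j" by (rule rational[OF j])
  let ?R = "(hcomp (d j) (p j) (fst R) (snd R), hcomp (d j) (q j) (fst R) (snd R))"
  have nz: "poly (fst R) t \<noteq> 0 \<or> poly (snd R) t \<noteq> 0" using Cons.prems by (simp add: hnorm_pos_iff)
  have "g j (curve_pt R t) = curve_pt ?R t"
    using R.rat_map_of_to_curve_pt[OF nz] by (simp add: g[OF j] curve_pt_def poly_hcomp)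
  moreover have "hnorm ?R t > 0" using R.hval_ne[OF nz] by (simp add: hnorm_pos_iff poly_hcomp)
  ultimately show ?case using Cons.IH[of ?R] Cons.prems by (simp add: comp_seq_Cons)
qed simp

lemma comp_polys_degree:
  assumes "degree (fst R) \<le> m" "degree (snd R) \<le> m"
  shows "degree (fst (comp_polys js R)) \<le> deg_seq d js * m \<and> degree (snd (comp_polys js R)) \<le> deg_seq d js * m"
  using assms
proof (induction js arbitrary: R m)
  case (Cons j js)
  let ?R = "(hcomp (d j) (p j) (fst R) (snd R), hcomp (d j) (q j) (fst R) (snd R))"
  have "degree (fst (comp_polys js ?R)) \<le> deg_seq d js * (d j * m) \<and> degree (snd (comp_polys js ?R)) \<le> deg_seq d js * (d j * m)"
    by (rule Cons.IH) (use Cons.prems degree_hcomp_le in auto)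
  then show ?case by (simp add: deg_seq_def mult_ac)
qed (simp add: deg_seq_def)

text \<open>A multiplicative error made at one step is raised to the degree of all later steps. This
  is the total exponent of the errors along the sequence.\<close>

primrec weight :: "nat list \<Rightarrow> nat" where
  "weight [] = 0"
| "weight (j # js) = deg_seq d js + weight js"

text \<open>The accumulated exponents stay of the order of the total degree because
  \<open>N + 1 \<le> d1\<close>; if \<open>N\<close> equalled \<open>d1\<close>, the same recursion
  would produce an additional factor \<open>n\<close>.\<close>

lemma sum_weight: "(\<Sum>js\<in>index_seqs N n. weight js) \<le> N * d1 ^ n"
proof (induction n)
  case (Suc n)
  have "(\<Sum>js\<in>index_seqs N (Suc n). weight js) = N * (d1 ^ n + (\<Sum>js\<in>index_seqs N n. weight js))"
    by (simp add: sum_index_seqs_Suc sum.distrib sum_deg_seq d1_def)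
  also have "\<dots> \<le> N * (d1 ^ n + N * d1 ^ n)" using Suc by simp
  also have "\<dots> = N * ((1 + N) * d1 ^ n)" by simp
  also have "\<dots> \<le> N * (d1 * d1 ^ n)" using N_less_d1 by (intro mult_left_mono mult_right_mono) auto
  finally show ?case by simp
qed simp

lemma uniform_hval_bounds:
  obtains c where "c \<ge> 1"
    "\<And>j x y. j < N \<Longrightarrow> max (cmod (hval (d j) (p j) x y)) (cmod (hval (d j) (q j) x y)) \<le> c * max (cmod x) (cmod y) ^ d j"
    "\<And>j x y. j < N \<Longrightarrow> max (cmod x) (cmod y) ^ d j \<le> c * max (cmod (hval (d j) (p j) x y)) (cmod (hval (d j) (q j) x y))"
proof -
  have "\<forall>j\<in>{..<N}. \<exists>c. c \<ge> 1 \<and>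
    (\<forall>x y. max (cmod (hval (d j) (p j) x y)) (cmod (hval (d j) (q j) x y)) \<le> c * max (cmod x) (cmod y) ^ d j) \<and>
    (\<forall>x y. max (cmod x) (cmod y) ^ d j \<le> c * max (cmod (hval (d j) (p j) x y)) (cmod (hval (d j) (q j) x y)))"
  proof
    fix j assume "j \<in> {..<N}"
    then interpret R: rational_map "p j" "q j" "d j" by (simp add: rational)
    obtain c where "c \<ge> 1"
      "\<And>x y. max (cmod (hval (d j) (p j) x y)) (cmod (hval (d j) (q j) x y)) \<le> c * max (cmod x) (cmod y) ^ d j"
      "\<And>x y. max (cmod x) (cmod y) ^ d j \<le> c * max (cmod (hval (d j) (p j) x y)) (cmod (hval (d j) (q j) x y))"
      by (rule R.hval_bounds) blast
    then show "\<exists>c. c \<ge> 1 \<and>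
    (\<forall>x y. max (cmod (hval (d j) (p j) x y)) (cmod (hval (d j) (q j) x y)) \<le> c * max (cmod x) (cmod y) ^ d j) \<and>
    (\<forall>x y. max (cmod x) (cmod y) ^ d j \<le> c * max (cmod (hval (d j) (p j) x y)) (cmod (hval (d j) (q j) x y)))"
      by blast
  qed
  from bchoice[OF this] obtain C where C: "\<forall>j\<in>{..<N}. C j \<ge> 1 \<and>
    (\<forall>x y. max (cmod (hval (d j) (p j) x y)) (cmod (hval (d j) (q j) x y)) \<le> C j * max (cmod x) (cmod y) ^ d j) \<and>
    (\<forall>x y. max (cmod x) (cmod y) ^ d j \<le> C j * max (cmod (hval (d j) (p j) x y)) (cmod (hval (d j) (q j) x y)))"
    by blast
  define c where "c = Max (C ` {..<N})"
  have le: "C j \<le> c" if "j < N" for j using that by (simp add: c_def)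
  show ?thesis
  proof (rule that[of c])
    show "c \<ge> 1" using le[of 0] C N_pos by (metis lessThan_iff less_eq_Suc_le One_nat_def order_trans)
    fix j x y assume j: "j < N"
    have nn: "0 \<le> max (cmod x) (cmod y) ^ d j" "0 \<le> max (cmod (hval (d j) (p j) x y)) (cmod (hval (d j) (q j) x y))"
      by (simp_all add: le_max_iff_disj)
    have "max (cmod (hval (d j) (p j) x y)) (cmod (hval (d j) (q j) x y)) \<le> C j * max (cmod x) (cmod y) ^ d j"
      "max (cmod x) (cmod y) ^ d j \<le> C j * max (cmod (hval (d j) (p j) x y)) (cmod (hval (d j) (q j) x y))"
      using C j by blast+
    then show "max (cmod (hval (d j) (p j) x y)) (cmod (hval (d j) (q j) x y)) \<le> c * max (cmod x) (cmod y) ^ d j"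
      "max (cmod x) (cmod y) ^ d j \<le> c * max (cmod (hval (d j) (p j) x y)) (cmod (hval (d j) (q j) x y))"
      using mult_right_mono[OF le[OF j] nn(1)] mult_right_mono[OF le[OF j] nn(2)] by (blast intro: order_trans)+
  qed
qed

text \<open>One step raises the ratio of the norms at \<open>t\<close> and at 0 to the power
  \<open>d j\<close> and costs a factor \<open>c\<close> twice, for the upper bound at
  \<open>t\<close> and the lower bound at 0; hence \<open>L = 2 * ln c\<close>.\<close>

lemma hnorm_growth:
  obtains L :: real where "L \<ge> 0" "\<And>js R A. \<lbrakk>set js \<subseteq> {..<N}; hnorm R 0 > 0; \<And>t. cmod t \<le> 1 \<Longrightarrow> hnorm R t \<le> exp A * hnorm R 0\<rbrakk> \<Longrightarrow>
    \<forall>t. cmod t \<le> 1 \<longrightarrow> hnorm (comp_polys js R) t \<le> exp (A * real (deg_seq d js) + L * real (weight js)) * hnorm (comp_polys js R) 0"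
proof -
  obtain c where c: "c \<ge> 1"
    "\<And>j x y. j < N \<Longrightarrow> max (cmod (hval (d j) (p j) x y)) (cmod (hval (d j) (q j) x y)) \<le> c * max (cmod x) (cmod y) ^ d j"
    "\<And>j x y. j < N \<Longrightarrow> max (cmod x) (cmod y) ^ d j \<le> c * max (cmod (hval (d j) (p j) x y)) (cmod (hval (d j) (q j) x y))"
    by (rule uniform_hval_bounds) blast
  define L where "L = 2 * ln c"
  have eL: "exp L = c * c" using c(1) by (simp add: L_def exp_double power2_eq_square)
  show ?thesis
  proof (rule that[of L])
    show "L \<ge> 0" using c(1) by (simp add: L_def)
    fix js R A
    assume "set js \<subseteq> {..<N}" "hnorm R 0 > 0" "\<And>t. cmod t \<le> 1 \<Longrightarrow> hnorm R t \<le> exp A * hnorm R 0"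
    then show "\<forall>t. cmod t \<le> 1 \<longrightarrow> hnorm (comp_polys js R) t \<le> exp (A * real (deg_seq d js) + L * real (weight js)) * hnorm (comp_polys js R) 0"
    proof (induction js arbitrary: R A)
      case Nil
      then show ?case by (simp add: deg_seq_def)
    next
      case (Cons j js)
      have j: "j < N" using Cons.prems by simp
      let ?R = "(hcomp (d j) (p j) (fst R) (snd R), hcomp (d j) (q j) (fst R) (snd R))"
      have up: "hnorm ?R t \<le> c * hnorm R t ^ d j" and lo: "hnorm R t ^ d j \<le> c * hnorm ?R t" for t
        using c(2,3)[OF j] by (simp_all add: hnorm_def poly_hcomp)
      have pos: "hnorm ?R 0 > 0"
        using comp_polys_curve_pt[of "[j]" R 0] Cons.prems j by simp
      have "hnorm ?R t \<le> exp (A * real (d j) + L) * hnorm ?R 0" if t: "cmod t \<le> 1" for t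
      proof -
        have "hnorm ?R t \<le> c * hnorm R t ^ d j" by (rule up)
        also have "\<dots> \<le> c * (exp A * hnorm R 0) ^ d j"
          using c(1) Cons.prems(3)[OF t] by (intro mult_left_mono power_mono) (auto simp: hnorm_def le_max_iff_disj)
        also have "\<dots> = c * exp (A * real (d j)) * hnorm R 0 ^ d j"
          by (simp add: power_mult_distrib exp_of_nat2_mult mult.commute)
        also have "\<dots> \<le> c * exp (A * real (d j)) * (c * hnorm ?R 0)" using c(1) lo by (intro mult_left_mono) auto
        also have "\<dots> = exp (A * real (d j) + L) * hnorm ?R 0" by (simp add: exp_add eL)
        finally show ?thesis .
      qed
      from Cons.IH[OF _ pos this] Cons.prems(1)
      have "\<forall>t. cmod t \<le> 1 \<longrightarrow> hnorm (comp_polys js ?R) t \<le> exp ((A * real (d j) + L) * real (deg_seq d js) + L * real (weight js)) * hnorm (comp_polys js ?R) 0"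
        by simp
      moreover have "(A * real (d j) + L) * real (deg_seq d js) + L * real (weight js) = A * real (deg_seq d (j # js)) + L * real (weight (j # js))"
        by (simp add: deg_seq_def algebra_simps)
      ultimately show ?case by simp
    qed
  qed
qed

text \<open>The parameters of preimages of \<open>w\<close> near the centre are roots of
  \<open>S = P - smult w Q\<close>. The growth hypothesis bounds \<open>S\<close> above on the unit
  disc, the separation of \<open>w\<close> from the image of the centre bounds it below at 0, and
  the Jensen type lemma counts the roots.\<close>

lemma card_near_le:
  fixes \<rho> \<delta> E :: real
  assumes js: "set js \<subseteq> {..<N}" and pos: "\<And>t. hnorm R t > 0"
    and gr: "\<And>t. cmod t \<le> 1 \<Longrightarrow> hnorm (comp_polys js R) t \<le> exp E * hnorm (comp_polys js R) 0"
    and sep: "0 < \<delta>" "\<delta> \<le> 1" "\<And>y. comp_seq g js (curve_pt R 0) = Some y \<Longrightarrow> \<delta> \<le> dist w y"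
    and \<rho>: "0 < \<rho>" "\<rho> < 1" "\<rho> < 1 / 2"
  shows "finite {t. cmod t < \<rho> \<and> comp_seq g js (curve_pt R t) = Some w}"
    "card {t. cmod t < \<rho> \<and> comp_seq g js (curve_pt R t) = Some w} * ln ((1 - \<rho>) / \<rho>) \<le> E + 2 * ln (1 + cmod w) - ln \<delta>"
proof -
  define P Q where "P = fst (comp_polys js R)" and "Q = snd (comp_polys js R)"
  define S where "S = P - smult w Q"
  let ?Z = "{t. cmod t < \<rho> \<and> comp_seq g js (curve_pt R t) = Some w}"
  have curve_pt: "comp_seq g js (curve_pt R t) = to_curve_pt (poly P t) (poly Q t)" "max (cmod (poly P t)) (cmod (poly Q t)) > 0" for t
    using comp_polys_curve_pt[OF js pos] by (auto simp: curve_pt_def P_def Q_def hnorm_def)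
  define m where "m = max (cmod (poly P 0)) (cmod (poly Q 0))"
  have m: "m > 0" using curve_pt(2)[of 0] by (simp add: m_def)
  have w1: "1 + cmod w > 0" by (simp add: add_pos_nonneg)
  \<comment> \<open>Dividing by \<open>poly Q 0\<close> turns \<open>poly S 0\<close> into the
    difference between the image of the centre and \<open>w\<close>, which handles \<open>Q\<close>;
    the bound for \<open>P\<close> follows from \<open>P = S + smult w Q\<close>. If the image is
    infinity, \<open>Q\<close> vanishes and nothing is to be shown for it.\<close>
  have low: "m * \<delta> \<le> (1 + cmod w) * cmod (poly S 0)"
  proof -
    have Q: "cmod (poly Q 0) * \<delta> \<le> cmod (poly S 0)"
    proof (cases "poly Q 0 = 0")
      case False
      then have "\<delta> \<le> dist w (poly P 0 / poly Q 0)" using sep(3) curve_pt(1)[of 0] by (simp add: to_curve_pt_def)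
      also have "\<dots> = cmod (poly S 0) / cmod (poly Q 0)"
      proof -
        have "poly S 0 / poly Q 0 = poly P 0 / poly Q 0 - w" using False by (simp add: S_def diff_divide_distrib)
        then show ?thesis by (simp add: dist_norm norm_minus_commute flip: norm_divide)
      qed
      finally show ?thesis using False by (simp add: field_simps)
    qed simp
    have "cmod (poly P 0) \<le> cmod (poly S 0) + cmod w * cmod (poly Q 0)"
      using norm_triangle_ineq[of "poly S 0" "w * poly Q 0"] by (simp add: S_def norm_mult)
    then have "cmod (poly P 0) * \<delta> \<le> (cmod (poly S 0) + cmod w * cmod (poly Q 0)) * \<delta>"
      using sep by (intro mult_right_mono) auto
    also have "\<dots> = cmod (poly S 0) * \<delta> + cmod w * (cmod (poly Q 0) * \<delta>)" by (simp add: algebra_simps)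
    also have "\<dots> \<le> cmod (poly S 0) * 1 + cmod w * cmod (poly S 0)"
      using sep Q by (intro add_mono mult_left_mono) auto
    finally have P: "cmod (poly P 0) * \<delta> \<le> (1 + cmod w) * cmod (poly S 0)" by (simp add: algebra_simps)
    have "cmod (poly S 0) \<le> (1 + cmod w) * cmod (poly S 0)" by (simp add: algebra_simps)
    then show ?thesis using P Q by (auto simp: m_def max_def)
  qed
  then have S0: "cmod (poly S 0) > 0"
    using m sep(1) by (metis mult_eq_0_iff mult_pos_pos not_le zero_less_norm_iff norm_zero)
  then have "S \<noteq> 0" by auto
  have root: "poly S t = 0" if "comp_seq g js (curve_pt R t) = Some w" for t
    using that curve_pt(1)[of t] by (auto simp: to_curve_pt_def S_def split: if_splits)
  have "?Z \<subseteq> {t. poly S t = 0}" using root by auto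
  then show finite_part: "finite ?Z" using poly_roots_finite[OF \<open>S \<noteq> 0\<close>] finite_subset by blast
  have key: "cmod (poly S 0) * ((1 - \<rho>) / \<rho>) ^ card ?Z \<le> (1 + cmod w) * (exp E * m)"
  proof (rule poly_norm_mult_power_card_roots_le[OF finite_part \<rho>(1,2)])
    show "poly S t = 0 \<and> cmod t < \<rho>" if "t \<in> ?Z" for t using that root by simp
    fix t :: complex assume t: "cmod t \<le> 1"
    have "cmod (poly S t) \<le> cmod (poly P t) + cmod w * cmod (poly Q t)"
      using norm_triangle_ineq4[of "poly P t" "w * poly Q t"] by (simp add: S_def norm_mult)
    also have "\<dots> \<le> hnorm (comp_polys js R) t + cmod w * hnorm (comp_polys js R) t"
      by (intro add_mono mult_left_mono) (auto simp: hnorm_def P_def Q_def)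
    also have "\<dots> = (1 + cmod w) * hnorm (comp_polys js R) t" by (simp add: algebra_simps)
    also have "\<dots> \<le> (1 + cmod w) * (exp E * m)"
      using gr[OF t] by (intro mult_left_mono) (auto simp: m_def hnorm_def P_def Q_def)
    finally show "cmod (poly S t) \<le> (1 + cmod w) * (exp E * m)" .
  qed
  \<comment> \<open>Multiplying the lower by the upper bound cancels both \<open>m\<close> and the
    value of \<open>S\<close> at 0. Each of the two bounds contributes one factor
    \<open>1 + cmod w\<close>.\<close>
  have "(m * \<delta>) * (cmod (poly S 0) * ((1 - \<rho>) / \<rho>) ^ card ?Z) \<le> ((1 + cmod w) * cmod (poly S 0)) * ((1 + cmod w) * (exp E * m))"
    by (rule mult_mono[OF low key]) (use w1 S0 \<rho> in auto)
  then have "(m * cmod (poly S 0)) * (\<delta> * ((1 - \<rho>) / \<rho>) ^ card ?Z) \<le> (m * cmod (poly S 0)) * ((1 + cmod w)\<^sup>2 * exp E)"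
    by (simp add: power2_eq_square mult_ac)
  then have "\<delta> * ((1 - \<rho>) / \<rho>) ^ card ?Z \<le> (1 + cmod w)\<^sup>2 * exp E"
    using m S0 by simp
  then have "ln (\<delta> * ((1 - \<rho>) / \<rho>) ^ card ?Z) \<le> ln ((1 + cmod w)\<^sup>2 * exp E)"
    using sep(1) \<rho> w1 by (subst ln_le_cancel_iff) auto
  moreover have "ln (\<delta> * ((1 - \<rho>) / \<rho>) ^ card ?Z) = ln \<delta> + card ?Z * ln ((1 - \<rho>) / \<rho>)"
    using sep(1) \<rho> by (subst ln_mult) (auto simp: ln_realpow)
  moreover have "ln ((1 + cmod w)\<^sup>2 * exp E) = 2 * ln (1 + cmod w) + E"
    using w1 by (subst ln_mult) (auto simp: ln_realpow)
  ultimately show "card ?Z * ln ((1 - \<rho>) / \<rho>) \<le> E + 2 * ln (1 + cmod w) - ln \<delta>" by linarith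
qed

section \<open>Generic values and the absence of atoms\<close>

lemma finite_orbit_values:
  assumes "finite A"
  shows "finite {y. \<exists>js\<in>index_seqs N n. \<exists>b\<in>A. comp_seq g js b = Some y}"
    "card {y. \<exists>js\<in>index_seqs N n. \<exists>b\<in>A. comp_seq g js b = Some y} \<le> card A * N ^ n"
proof -
  let ?X = "{y. \<exists>js\<in>index_seqs N n. \<exists>b\<in>A. comp_seq g js b = Some y}"
  let ?F = "(\<lambda>(js, b). finite_part (comp_seq g js b)) ` (index_seqs N n \<times> A)"
  have sub: "?X \<subseteq> ?F"
  proof
    fix y assume "y \<in> ?X"
    then obtain js b where "js \<in> index_seqs N n" "b \<in> A" "comp_seq g js b = Some y" by auto
    then show "y \<in> ?F" by (intro image_eqI[of _ _ "(js, b)"]) auto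
  qed
  have finite_part: "finite ?F" using assms by simp
  show "finite ?X" using sub finite_part by (rule finite_subset)
  have "card ?X \<le> card ?F" using sub finite_part by (intro card_mono)
  also have "\<dots> \<le> card (index_seqs N n \<times> A)" using assms by (intro card_image_le) simp
  also have "\<dots> = card A * N ^ n" by (simp add: card_cartesian_product card_index_seqs)
  finally show "card ?X \<le> card A * N ^ n" .
qed

text \<open>Used with \<open>A\<close> the excluded points when domains are built, and with the
  point \<open>a\<close> added when \<open>a\<close> is tested for being an atom: the separation
  from the orbit of \<open>a\<close> is the lower bound that \<open>card_near_le\<close> asks
  for.\<close>

lemma generic_value:
  assumes "P1_polar E" "finite A"
  obtains w c where "Some w \<notin> E" "0 < c" "c \<le> 1"
    "\<And>js b y. set js \<subseteq> {..<N} \<Longrightarrow> b \<in> A \<Longrightarrow> comp_seq g js b = Some y \<Longrightarrow> c / (2 * real N) ^ length js \<le> dist w y"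
proof -
  obtain w c where w: "Some w \<notin> E" "0 < c" "c \<le> 1"
    "\<And>n y. y \<in> {y. \<exists>js\<in>index_seqs N n. \<exists>b\<in>A. comp_seq g js b = Some y} \<Longrightarrow> c / (2 * real N) ^ n \<le> dist w y"
    by (rule P1_polar_avoid[OF assms(1) finite_orbit_values[OF assms(2)] N_pos]) blast
  show ?thesis
  proof (rule that[OF w(1-3)])
    fix js b y assume "set js \<subseteq> {..<N}" "b \<in> A" "comp_seq g js b = Some y"
    then show "c / (2 * real N) ^ length js \<le> dist w y"
      by (intro w(4)) (auto simp: index_seqs_def)
  qed
qed

text \<open>The curves are \<open>[b + t : 1]\<close> at a finite point \<open>b\<close> and
  \<open>[1 : t]\<close> at infinity, so one estimate covers both. The number \<open>A\<close> is
  the initial logarithmic growth, and the test functions localize to parameters of modulus below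
  \<open>\<rho>\<close>.\<close>

lemma local_parametrization:
  obtains R :: "complex poly \<times> complex poly" and A :: real where "\<And>t. hnorm R t > 0" "curve_pt R 0 = a" "\<And>t. cmod t \<le> 1 \<Longrightarrow> hnorm R t \<le> exp A * hnorm R 0" "A \<ge> 0"
    "\<And>\<rho>. \<rho> > 0 \<Longrightarrow> \<exists>\<phi>. P1_continuous \<phi> \<and> \<phi> a = 1 \<and> (\<forall>x. 0 \<le> \<phi> x \<and> \<phi> x \<le> 1) \<and>
        (\<forall>x. \<phi> x > 0 \<longrightarrow> (\<exists>t. cmod t < \<rho> \<and> x = curve_pt R t))"
proof (cases a)
  case None
  define R where "R = ([:1:] :: complex poly, [:0, 1:] :: complex poly)"
  show ?thesis
  proof (rule that[of R 0])
    show "hnorm R t > 0" for t by (simp add: hnorm_pos_iff R_def)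
    show "curve_pt R 0 = a" by (simp add: curve_pt_def R_def to_curve_pt_def None)
    show "hnorm R t \<le> exp 0 * hnorm R 0" if "cmod t \<le> 1" for t using that by (simp add: hnorm_def R_def)
    fix \<rho> :: real assume \<rho>: "\<rho> > 0"
    define \<phi> where "\<phi> = (\<lambda>x. case x of None \<Rightarrow> 1 | Some z \<Rightarrow> max 0 (min 1 (\<rho> * cmod z - 1)))"
    have "P1_continuous \<phi>" unfolding P1_continuous_def
    proof
      show "continuous_on UNIV (\<lambda>z. \<phi> (Some z))" unfolding \<phi>_def by (auto intro!: continuous_intros)
      have "\<phi> (Some z) = 1" if "2 / \<rho> \<le> cmod z" for z
        using that \<rho> by (simp add: \<phi>_def field_simps)
      then have "eventually (\<lambda>z. \<phi> (Some z) = 1) at_infinity" unfolding eventually_at_infinity by blast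
      then show "((\<lambda>z. \<phi> (Some z)) \<longlongrightarrow> \<phi> None) at_infinity" by (simp add: tendsto_eventually \<phi>_def)
    qed
    moreover have "\<exists>t. cmod t < \<rho> \<and> x = curve_pt R t" if "\<phi> x > 0" for x
    proof (cases x)
      case None
      then show ?thesis using \<rho> by (intro exI[of _ 0]) (auto simp: curve_pt_def R_def to_curve_pt_def)
    next
      case (Some z)
      then have "\<rho> * cmod z > 1" using that by (auto simp: \<phi>_def max_def min_def split: if_splits)
      moreover from this have "z \<noteq> 0" by auto
      ultimately show ?thesis using Some
        by (intro exI[of _ "1 / z"]) (auto simp: curve_pt_def R_def to_curve_pt_def norm_divide field_simps)
    qed
    ultimately show "\<exists>\<phi>. P1_continuous \<phi> \<and> \<phi> a = 1 \<and> (\<forall>x. 0 \<le> \<phi> x \<and> \<phi> x \<le> 1) \<and>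
        (\<forall>x. \<phi> x > 0 \<longrightarrow> (\<exists>t. cmod t < \<rho> \<and> x = curve_pt R t))"
      by (intro exI[of _ \<phi>]) (auto simp: \<phi>_def None split: option.split)
  qed simp
next
  case (Some b)
  define R where "R = ([:b, 1:] :: complex poly, [:1:] :: complex poly)"
  show ?thesis
  proof (rule that[of R "ln (cmod b + 1)"])
    show "hnorm R t > 0" for t by (simp add: hnorm_pos_iff R_def)
    show "curve_pt R 0 = a" by (simp add: curve_pt_def R_def to_curve_pt_def Some)
    show "ln (cmod b + 1) \<ge> 0" by (intro ln_ge_zero) simp
    show "hnorm R t \<le> exp (ln (cmod b + 1)) * hnorm R 0" if "cmod t \<le> 1" for t
    proof -
      have "hnorm R t \<le> cmod b + 1" using norm_triangle_ineq[of b t] that by (auto simp: hnorm_def R_def)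
      also have "\<dots> \<le> (cmod b + 1) * hnorm R 0" 
        using mult_left_mono[of 1 "hnorm R 0" "cmod b + 1"] by (simp add: hnorm_def R_def le_max_iff_disj)
      also have "cmod b + 1 = exp (ln (cmod b + 1))" by (simp add: add_nonneg_pos)
      finally show ?thesis .
    qed
    fix \<rho> :: real assume \<rho>: "\<rho> > 0"
    define \<phi> where "\<phi> = (\<lambda>x. case x of None \<Rightarrow> 0 | Some z \<Rightarrow> max 0 (1 - cmod (z - b) / \<rho>))"
    have "P1_continuous \<phi>" unfolding P1_continuous_def
    proof
      show "continuous_on UNIV (\<lambda>z. \<phi> (Some z))" unfolding \<phi>_def using \<rho> by (auto intro!: continuous_intros)
      have "\<phi> (Some z) = 0" if "\<rho> + cmod b \<le> cmod z" for z
      proof -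
        have "\<rho> \<le> cmod (z - b)" using that norm_triangle_ineq2[of z b] by linarith
        then show ?thesis using \<rho> by (simp add: \<phi>_def field_simps)
      qed
      then have "eventually (\<lambda>z. \<phi> (Some z) = 0) at_infinity" unfolding eventually_at_infinity by blast
      then show "((\<lambda>z. \<phi> (Some z)) \<longlongrightarrow> \<phi> None) at_infinity" by (simp add: tendsto_eventually \<phi>_def)
    qed
    moreover have "\<exists>t. cmod t < \<rho> \<and> x = curve_pt R t" if "\<phi> x > 0" for x
    proof (cases x)
      case None
      then show ?thesis using that by (simp add: \<phi>_def)
    next
      case (Some z)
      then have "cmod (z - b) / \<rho> < 1" using that by (auto simp: \<phi>_def max_def split: if_splits)
      then have "cmod (z - b) < \<rho>" using \<rho> by (simp add: field_simps)
      then show ?thesis using Some by (intro exI[of _ "z - b"]) (auto simp: curve_pt_def R_def to_curve_pt_def)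
    qed
    ultimately show "\<exists>\<phi>. P1_continuous \<phi> \<and> \<phi> a = 1 \<and> (\<forall>x. 0 \<le> \<phi> x \<and> \<phi> x \<le> 1) \<and>
        (\<forall>x. \<phi> x > 0 \<longrightarrow> (\<exists>t. cmod t < \<rho> \<and> x = curve_pt R t))"
      using \<rho> by (intro exI[of _ \<phi>]) (auto simp: \<phi>_def Some split: option.split)
  qed
qed

lemma ratio: "0 \<le> real N / real d1" "real N / real d1 < 1"
  using N_less_d1 by auto

lemma P1_prob_of_equilibrium: "is_equilibrium_measure g N d1 \<mu> \<Longrightarrow> P1_prob \<mu>"
  by (simp add: is_equilibrium_measure_def P1_prob_def P1_prob_axioms_def)

text \<open>A test function concentrated on parameters of size about \<open>exp (- M)\<close> sees
  in the limit at most the share \<open>(A + L * N) / M\<close> of the preimages: \<open>A\<close>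
  comes from the curve and \<open>L * N\<close> from the accumulated errors. As \<open>M\<close> is
  arbitrary, no mass is left for the point.\<close>

lemma equilibrium_no_atom:
  assumes eqm: "is_equilibrium_measure g N d1 \<mu>"
  shows "measure \<mu> {a} = 0"
proof -
  interpret \<mu>: P1_prob \<mu> using eqm by (rule P1_prob_of_equilibrium)
  obtain E where E: "P1_polar E"
    "\<And>w \<phi>. w \<notin> E \<Longrightarrow> P1_continuous \<phi> \<Longrightarrow> (\<lambda>n. pullback_avg g N d1 w n \<phi>) \<longlonglongrightarrow> integral\<^sup>L \<mu> \<phi>"
    using eqm unfolding is_equilibrium_measure_def by blast
  obtain R and A :: real where R: "\<And>t. hnorm R t > 0" "curve_pt R 0 = a"
    "\<And>t. cmod t \<le> 1 \<Longrightarrow> hnorm R t \<le> exp A * hnorm R 0" "A \<ge> 0"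
    "\<And>\<rho>. \<rho> > 0 \<Longrightarrow> \<exists>\<phi>. P1_continuous \<phi> \<and> \<phi> a = 1 \<and> (\<forall>x. 0 \<le> \<phi> x \<and> \<phi> x \<le> 1) \<and>
        (\<forall>x. \<phi> x > 0 \<longrightarrow> (\<exists>t. cmod t < \<rho> \<and> x = curve_pt R t))"
    by (rule local_parametrization[of a]) blast
  obtain L :: real where L: "L \<ge> 0" "\<And>js R A. \<lbrakk>set js \<subseteq> {..<N}; hnorm R 0 > 0; \<And>t. cmod t \<le> 1 \<Longrightarrow> hnorm R t \<le> exp A * hnorm R 0\<rbrakk> \<Longrightarrow>
    \<forall>t. cmod t \<le> 1 \<longrightarrow> hnorm (comp_polys js R) t \<le> exp (A * real (deg_seq d js) + L * real (weight js)) * hnorm (comp_polys js R) 0"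
    by (rule hnorm_growth) blast
  obtain w c where w: "Some w \<notin> E" "0 < c" "c \<le> 1"
    "\<And>js b y. set js \<subseteq> {..<N} \<Longrightarrow> b \<in> insert a excluded \<Longrightarrow> comp_seq g js b = Some y \<Longrightarrow> c / (2 * real N) ^ length js \<le> dist w y"
    by (rule generic_value[OF E(1), of "insert a excluded"]) (use finite_excluded in blast)+
  have N1: "2 * real N \<ge> 1" using N_pos by simp
  interpret w: unramified_point g p q d N w
  proof unfold_locales
    fix js b assume js: "set js \<subseteq> {..<N}" "b \<in> excluded"
    show "comp_seq g js b \<noteq> Some w"
    proof
      assume "comp_seq g js b = Some w"
      then have "c / (2 * real N) ^ length js \<le> dist w w" using w(4) js by blast
      moreover have "c / (2 * real N) ^ length js > 0" using w(2) N_pos by simp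
      ultimately show False by simp
    qed
  qed
  define \<kappa> where "\<kappa> = 2 * ln (1 + cmod w) - ln c"
  have bound: "measure \<mu> {a} \<le> (A + L * N) / M" if M: "M > 0" for M :: real
  proof -
    \<comment> \<open>The radius for which \<open>ln ((1 - \<rho>) / \<rho>)\<close> is exactly
      \<open>M\<close>.\<close>
    define \<rho> where "\<rho> = 1 / (1 + exp M)"
    have e1: "exp M > 1" using M by simp
    have \<rho>: "0 < \<rho>" "\<rho> < 1" "\<rho> < 1 / 2" "(1 - \<rho>) / \<rho> = exp M"
    proof -
      define x where "x = exp M"
      have x: "x > 1" using e1 by (simp only: x_def)
      have \<rho>x: "\<rho> = 1 / (1 + x)" by (simp add: \<rho>_def x_def)
      show "0 < \<rho>" "\<rho> < 1" "\<rho> < 1 / 2" using x by (auto simp: \<rho>x field_simps)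
      have "1 - \<rho> = exp M * \<rho>" using x by (simp add: \<rho>x field_simps flip: x_def)
      then show "(1 - \<rho>) / \<rho> = exp M" using \<open>0 < \<rho>\<close> by simp
    qed
    obtain \<phi> where \<phi>: "P1_continuous \<phi>" "\<phi> a = 1" "\<And>x. 0 \<le> \<phi> x" "\<And>x. \<phi> x \<le> 1"
      "\<And>x. \<phi> x > 0 \<Longrightarrow> \<exists>t. cmod t < \<rho> \<and> x = curve_pt R t" using R(5)[OF \<rho>(1)] by blast
    have one: "M * (\<Sum>z\<in>w.preimages js. \<phi> (Some z)) \<le> A * real (deg_seq d js) + L * real (weight js) + \<kappa> + n * ln (2 * real N)"
      if "js \<in> index_seqs N n" for js n
    proof -
      have js: "set js \<subseteq> {..<N}" "length js = n" using that by (auto simp: index_seqs_def)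
      let ?T = "{t. cmod t < \<rho> \<and> comp_seq g js (curve_pt R t) = Some w}"
      define \<delta> where "\<delta> = c / (2 * real N) ^ n"
      have p1: "(2 * real N) ^ n \<ge> 1" using N1 by (rule one_le_power)
      have \<delta>: "0 < \<delta>" "\<delta> \<le> 1" "\<And>y. comp_seq g js (curve_pt R 0) = Some y \<Longrightarrow> \<delta> \<le> dist w y"
      proof -
        show "0 < \<delta>" using w(2) p1 by (simp add: \<delta>_def)
        show "\<delta> \<le> 1" using w(2,3) p1 by (simp add: \<delta>_def divide_le_eq)
        show "\<delta> \<le> dist w y" if "comp_seq g js (curve_pt R 0) = Some y" for y
          using w(4)[OF js(1) _ that] js(2) by (simp add: R(2) \<delta>_def)
      qed
      have gr: "hnorm (comp_polys js R) t \<le> exp (A * real (deg_seq d js) + L * real (weight js)) * hnorm (comp_polys js R) 0" if "cmod t \<le> 1" for t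
        using L(2)[OF js(1) R(1) R(3)] that by blast
      note near = card_near_le[OF js(1) R(1) gr \<delta> \<rho>(1-3)]
      have finp: "finite (w.preimages js)" using w.preimages_finite_card[OF js(1)] by blast
      let ?P = "{z \<in> w.preimages js. \<phi> (Some z) > 0}"
      have "(\<Sum>z\<in>w.preimages js. \<phi> (Some z)) = (\<Sum>z\<in>?P. \<phi> (Some z))"
        using finp \<phi>(3) by (intro sum.mono_neutral_right) (auto simp: less_le)
      also have "\<dots> \<le> (\<Sum>z\<in>?P. 1)" using \<phi>(4) by (intro sum_mono) auto
      also have "\<dots> = card ?P" by simp
      also have "card ?P \<le> card ?T"
      proof (rule card_inj_on_le[of "\<lambda>z. SOME t. cmod t < \<rho> \<and> Some z = curve_pt R t"])
        have sm: "cmod (SOME t. cmod t < \<rho> \<and> Some z = curve_pt R t) < \<rho> \<and> Some z = curve_pt R (SOME t. cmod t < \<rho> \<and> Some z = curve_pt R t)"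
          if "z \<in> ?P" for z
          using someI_ex[OF \<phi>(5)[of "Some z"]] that by simp
        show "inj_on (\<lambda>z. SOME t. cmod t < \<rho> \<and> Some z = curve_pt R t) ?P"
          by (rule inj_onI) (use sm in \<open>metis (no_types, lifting) option.inject\<close>)
        show "(\<lambda>z. SOME t. cmod t < \<rho> \<and> Some z = curve_pt R t) ` ?P \<subseteq> ?T"
        proof (rule image_subsetI)
          fix z assume z: "z \<in> ?P"
          then have "comp_seq g js (Some z) = Some w" by (simp add: w.preimages_def)
          then show "(SOME t. cmod t < \<rho> \<and> Some z = curve_pt R t) \<in> ?T" using sm[OF z] by simp
        qed
        show "finite ?T" by (rule near(1))
      qed
      finally have "M * (\<Sum>z\<in>w.preimages js. \<phi> (Some z)) \<le> M * card ?T" using M by simp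
      also have "\<dots> = card ?T * ln ((1 - \<rho>) / \<rho>)" by (simp add: \<rho>(4))
      also have "\<dots> \<le> A * real (deg_seq d js) + L * real (weight js) + 2 * ln (1 + cmod w) - ln \<delta>" by (rule near(2))
      also have "ln \<delta> = ln c - n * ln (2 * real N)"
      proof -
        have "(2 * real N) ^ n > 0" "2 * real N > 0" using N_pos by auto
        then have "ln \<delta> = ln c - ln ((2 * real N) ^ n)" unfolding \<delta>_def using w(2) by (simp add: ln_div)
        also have "ln ((2 * real N) ^ n) = n * ln (2 * real N)" by (rule ln_realpow)
        finally show ?thesis .
      qed
      finally show ?thesis by (simp add: \<kappa>_def)
    qed
    define r where "r = real N / real d1"
    have r: "0 \<le> r" "r < 1" using ratio by (simp_all add: r_def)
    have d1: "real d1 > 0" using N_less_d1 by simp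
    have "pullback_avg g N d1 (Some w) n \<phi> \<le> (A + L * N + r ^ n * \<kappa> + (real n * r ^ n) * ln (2 * real N)) / M" for n
    proof -
      have "M * (\<Sum>js\<in>index_seqs N n. \<Sum>z\<in>w.preimages js. \<phi> (Some z)) =
          (\<Sum>js\<in>index_seqs N n. M * (\<Sum>z\<in>w.preimages js. \<phi> (Some z)))" by (rule sum_distrib_left)
      also have "\<dots> \<le> (\<Sum>js\<in>index_seqs N n. A * real (deg_seq d js) + L * real (weight js) + \<kappa> + n * ln (2 * real N))"
        by (intro sum_mono one)
      also have "\<dots> = A * real (\<Sum>js\<in>index_seqs N n. deg_seq d js) + L * real (\<Sum>js\<in>index_seqs N n. weight js)
          + real N ^ n * (\<kappa> + n * ln (2 * real N))"
        by (simp add: sum.distrib sum_distrib_left card_index_seqs algebra_simps)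
      also have "real (\<Sum>js\<in>index_seqs N n. deg_seq d js) = real d1 ^ n" by (simp add: sum_deg_seq d1_def)
      also have "A * real d1 ^ n + L * real (\<Sum>js\<in>index_seqs N n. weight js) + real N ^ n * (\<kappa> + n * ln (2 * real N))
          \<le> A * real d1 ^ n + L * real (N * d1 ^ n) + real N ^ n * (\<kappa> + n * ln (2 * real N))"
        using L(1) sum_weight[of n]
        by (intro add_mono[OF add_mono[OF order_refl] order_refl] mult_left_mono) (simp_all only: of_nat_le_iff)
      also have "real N ^ n = real d1 ^ n * r ^ n" using d1 by (simp add: r_def power_divide)
      also have "A * real d1 ^ n + L * real (N * d1 ^ n) + real d1 ^ n * r ^ n * (\<kappa> + n * ln (2 * real N)) =
          real d1 ^ n * (A + L * N + r ^ n * \<kappa> + (real n * r ^ n) * ln (2 * real N))" by (simp add: algebra_simps)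
      finally show ?thesis using d1 M by (simp add: w.pullback_avg_eq field_simps)
    qed
    \<comment> \<open>The terms with \<open>\<kappa>\<close> and with the distance of
      \<open>w\<close> from the orbit of \<open>a\<close> occur once per sequence, so they carry
      \<open>r ^ n\<close>, which absorbs the factor \<open>n\<close> as well.\<close>
    moreover have "(\<lambda>n. (A + L * N + r ^ n * \<kappa> + (real n * r ^ n) * ln (2 * real N)) / M) \<longlonglongrightarrow>
        (A + L * N + 0 * \<kappa> + 0 * ln (2 * real N)) / M"
      using M r by (intro tendsto_intros LIMSEQ_power_zero powser_times_n_limit_0) auto
    ultimately have "integral\<^sup>L \<mu> \<phi> \<le> (A + L * N + 0 * \<kappa> + 0 * ln (2 * real N)) / M"
      using E(2)[OF w(1) \<phi>(1)] by (intro LIMSEQ_le) auto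
    moreover have "measure \<mu> {a} \<le> integral\<^sup>L \<mu> \<phi>"
    proof -
      have "measure \<mu> {a} = integral\<^sup>L \<mu> (indicator {a})" using \<mu>.singleton_sets by (simp add: \<mu>.space_eq)
      also have "\<dots> \<le> integral\<^sup>L \<mu> \<phi>"
        using \<mu>.singleton_sets \<mu>.P1_continuous_integrable[OF \<phi>(1)] \<phi>(2,3)
        by (intro integral_mono) (auto simp: indicator_def less_top[symmetric])
      finally show ?thesis .
    qed
    ultimately show ?thesis by simp
  qed
  have "(\<lambda>n. (A + L * N) / real (Suc n)) \<longlonglongrightarrow> 0"
    using tendsto_mult[OF tendsto_const[of "A + L * N"] LIMSEQ_inverse_real_of_nat] by (simp add: field_simps)
  then have "measure \<mu> {a} \<le> 0" using bound by (intro LIMSEQ_le_const) auto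
  then show ?thesis using measure_nonneg[of \<mu> "{a}"] by linarith
qed

end

section \<open>Repelling fixed points\<close>

lemma sum_geometric_tail_le:
  fixes r :: real
  assumes "0 \<le> r" "r < 1"
  shows "(\<Sum>k\<in>{l..<n}. r ^ k) \<le> r ^ l / (1 - r)"
proof (cases "l \<le> n")
  case True
  have "(1 - r) * (\<Sum>k\<in>{l..<n}. r ^ k) = r ^ l - r ^ n"
    using True
  proof (induction n rule: dec_induct)
    case (step n)
    have "(1 - r) * (\<Sum>k\<in>{l..<Suc n}. r ^ k) = (1 - r) * (\<Sum>k\<in>{l..<n}. r ^ k) + (1 - r) * r ^ n"
      using step by (simp add: distrib_left)
    also have "\<dots> = r ^ l - r ^ Suc n" unfolding step.IH by (simp add: algebra_simps)
    finally show ?case .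
  qed simp
  then have "(1 - r) * (\<Sum>k\<in>{l..<n}. r ^ k) \<le> r ^ l" using assms by simp
  then show ?thesis using assms by (simp add: field_simps)
qed (use assms in auto)

section \<open>Upper bound for the number of repelling fixed points\<close>

context correspondence
begin

text \<open>Finite fixed points are roots of a polynomial of degree at most one more than the
  composite, and infinity adds one. That polynomial can vanish identically, when the composite is
  the identity on the plane; then every finite point is fixed with multiplier 1 and none is
  repelling.\<close>

lemma repelling_finite_card:
  assumes js: "set js \<subseteq> {..<N}"
  shows "finite {x. repelling_fixed_point (comp_seq g js) x}"
    "card {x. repelling_fixed_point (comp_seq g js) x} \<le> deg_seq d js + 2"
proof -
  let ?X = "{x. repelling_fixed_point (comp_seq g js) x}"
  define R where "R = ([:0, 1:] :: complex poly, [:1:] :: complex poly)"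
  define P Q where "P = fst (comp_polys js R)" and "Q = snd (comp_polys js R)"
  have pos: "hnorm R t > 0" for t by (simp add: hnorm_pos_iff R_def)
  have ptR: "curve_pt R t = Some t" for t by (simp add: curve_pt_def R_def to_curve_pt_def)
  have val: "comp_seq g js (Some t) = to_curve_pt (poly P t) (poly Q t)" "poly P t \<noteq> 0 \<or> poly Q t \<noteq> 0" for t
    using comp_polys_curve_pt[OF js pos[of t]] unfolding ptR hnorm_pos_iff by (auto simp: curve_pt_def P_def Q_def)
  have deg: "degree P \<le> deg_seq d js" "degree Q \<le> deg_seq d js"
    using comp_polys_degree[of R 1 js] by (auto simp: R_def P_def Q_def)
  define S where "S = [:0, 1:] * Q - P"
  have dS: "degree S \<le> Suc (deg_seq d js)"
    unfolding S_def using deg degree_mult_le[of "[:0, 1:]" Q] by (intro degree_diff_le) auto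
  have root: "poly S z = 0" if "comp_seq g js (Some z) = Some z" for z
    using that val(1)[of z] by (auto simp: to_curve_pt_def S_def field_simps split: if_splits)
  have "finite ?X \<and> card ?X \<le> deg_seq d js + 2"
  proof (cases "S = 0")
    case False
    have sub: "?X \<subseteq> insert None (Some ` {z. poly S z = 0})"
    proof
      fix x assume "x \<in> ?X"
      then have "comp_seq g js x = x" by (simp add: repelling_fixed_point_def)
      then show "x \<in> insert None (Some ` {z. poly S z = 0})" using root by (cases x) auto
    qed
    have finite_part: "finite (insert None (Some ` {z. poly S z = 0}))" using poly_roots_finite[OF False] by simp
    have "card ?X \<le> card (insert None (Some ` {z. poly S z = 0}))" using sub finite_part by (intro card_mono)
    also have "\<dots> \<le> Suc (card {z. poly S z = 0})"
      using poly_roots_finite[OF False] by (metis card_image_le card_insert_le_m1 diff_Suc_1 finite_imageI zero_less_Suc)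
    also have "\<dots> \<le> Suc (degree S)" using card_poly_roots_bound[OF False] by simp
    finally show ?thesis using dS sub finite_part finite_subset by fastforce
  next
    case True
    have id: "comp_seq g js (Some z) = Some z" for z
    proof -
      have "P = [:0, 1:] * Q" using True unfolding S_def by (metis eq_iff_diff_eq_0)
      then have "poly P z = z * poly Q z" by simp
      then show ?thesis using val[of z] by (auto simp: to_curve_pt_def)
    qed
    have "?X \<subseteq> {None}"
    proof
      fix x assume x: "x \<in> ?X"
      show "x \<in> {None}"
      proof (cases x)
        case (Some z)
        have "loc_rep (comp_seq g js) (Some z) = (\<lambda>u. u)"
          by (auto simp: loc_rep_def chart_def chart_inv_def id fun_eq_iff)
        then obtain m where m: "((\<lambda>u. u) has_field_derivative m) (at (chart_pt (Some z)))" "cmod m > 1"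
          using x Some by (auto simp: repelling_fixed_point_def)
        have "m = 1" using DERIV_unique[OF m(1) DERIV_ident] .
        then show ?thesis using m(2) by simp
      qed simp
    qed
    then show ?thesis using finite_subset[of ?X "{None}"] card_mono[of "{None}" ?X] by simp
  qed
  then show "finite ?X" "card ?X \<le> deg_seq d js + 2" by auto
qed

lemma repelling_avg_one_le: "repelling_avg g N d1 n (\<lambda>_. 1) \<le> 1 + 2 * (real N / real d1) ^ n"
proof -
  have d1: "real d1 > 0" using N_less_d1 by simp
  have "(\<Sum>js\<in>index_seqs N n. \<Sum>x\<in>{x. repelling_fixed_point (comp_seq g js) x}. 1::real)
      \<le> (\<Sum>js\<in>index_seqs N n. real (deg_seq d js) + 2)"
  proof (rule sum_mono)
    fix js assume "js \<in> index_seqs N n"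
    then have "real (card {x. repelling_fixed_point (comp_seq g js) x}) \<le> real (deg_seq d js + 2)"
      using repelling_finite_card(2)[of js] by (simp only: of_nat_le_iff) (simp add: index_seqs_def)
    then show "(\<Sum>x\<in>{x. repelling_fixed_point (comp_seq g js) x}. 1::real) \<le> real (deg_seq d js) + 2" by simp
  qed
  also have "\<dots> = real (\<Sum>js\<in>index_seqs N n. deg_seq d js) + 2 * real N ^ n"
    by (simp add: sum.distrib card_index_seqs)
  also have "real (\<Sum>js\<in>index_seqs N n. deg_seq d js) = real d1 ^ n" by (simp add: sum_deg_seq d1_def)
  finally show ?thesis using d1 by (simp add: repelling_avg_def power_divide field_simps)
qed

end

section \<open>From contracting branches to repelling fixed points\<close>

context inverse_branches
begin

text \<open>On \<open>cball 0 r\<close> the branch stays within \<open>\<delta>\<close> of its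
  centre, so \<open>\<psi>'\<close> after \<open>H\<close> maps this disc into itself and Brouwer's
  theorem gives \<open>u\<close> with \<open>H u = \<psi> u\<close>. This point is fixed by the
  composite. Differentiating the identity between the composite of \<open>H\<close> and
  \<open>\<psi>\<close> gives \<open>deriv \<psi> u = D * deriv H u\<close>, and the bounds
  \<open>small\<close> and \<open>large\<close> force \<open>cmod D > 1\<close>.\<close>

lemma branch_repelling_fixed_point:
  assumes js: "set js \<subseteq> {..<N}" and H: "branch js H" and r: "0 < r" "r < 1"
    and inv: "continuous_on (\<psi> ` ball 0 1) \<psi>'" "\<And>u. u \<in> ball 0 1 \<Longrightarrow> \<psi>' (\<psi> u) = u"
    and room: "ball (H 0) \<delta> \<subseteq> \<psi> ` ball 0 r"
    and small: "\<And>u. cmod u \<le> r \<Longrightarrow> cmod (deriv H u) < \<delta>"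
    and large: "\<And>u. cmod u \<le> r \<Longrightarrow> \<delta> \<le> cmod (deriv \<psi> u)"
  obtains x where "repelling_fixed_point (comp_seq g js) (Some x)" "x \<in> H ` ball 0 1" "dist (H 0) x < \<delta>"
proof -
  have sub: "cball 0 r \<subseteq> ball (0::complex) 1" using r by auto
  have hol: "H holomorphic_on ball 0 1" using H by (simp add: branch_def)
  have derH: "(H has_field_derivative deriv H u) (at u)" if "u \<in> ball 0 1" for u
    using holomorphic_derivI[OF hol open_ball that] .
  have \<delta>: "\<delta> > 0" using le_less_trans[OF norm_ge_zero small[of 0]] r(1) by simp
  have near: "dist (H 0) (H u) < \<delta>" if u: "cmod u \<le> r" for u
  proof -
    have "cmod (H 0 - H u) \<le> \<delta> * cmod (0 - u)"
    proof (rule field_differentiable_bound[of "cball 0 r" H "deriv H" \<delta>])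
      show "(H has_field_derivative deriv H v) (at v within cball 0 r)" if "v \<in> cball 0 r" for v
        by (rule has_field_derivative_at_within[OF derH[OF subsetD[OF sub that]]])
      show "cmod (deriv H v) \<le> \<delta>" if "v \<in> cball 0 r" for v
        using small[of v] that by simp
    qed (use u r in auto)
    also have "\<dots> \<le> \<delta> * r" using u \<delta> by simp
    also have "\<dots> < \<delta>" using r \<delta> by simp
    finally show ?thesis by (simp add: dist_norm)
  qed
  have img: "H u \<in> \<psi> ` ball 0 r" if "cmod u \<le> r" for u using near[OF that] room by auto
  have T: "\<psi>' (H u) \<in> cball 0 r \<and> \<psi> (\<psi>' (H u)) = H u" if u: "cmod u \<le> r" for u
  proof -
    obtain v where v: "v \<in> ball 0 r" "H u = \<psi> v" using img[OF u] by auto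
    then show ?thesis using inv(2)[of v] r by auto
  qed
  have "continuous_on (cball 0 r) (\<lambda>u. \<psi>' (H u))"
  proof (rule continuous_on_compose2[OF inv(1)])
    show "continuous_on (cball 0 r) H"
      using holomorphic_on_imp_continuous_on[OF hol] sub by (rule continuous_on_subset)
    show "H ` cball 0 r \<subseteq> \<psi> ` ball 0 1" using img r by force
  qed
  then obtain u where u: "u \<in> cball 0 r" "\<psi>' (H u) = u"
    using brouwer_ball[of r 0 "\<lambda>u. \<psi>' (H u)"] r T by force
  have ur: "cmod u \<le> r" "u \<in> ball 0 1" using u(1) sub by auto
  have eq: "H u = \<psi> u" using T[OF ur(1)] u(2) by simp
  define x where "x = H u"
  have "comp_seq g js (Some (H u)) = Some (\<psi> u)" using H ur(2) unfolding branch_def by blast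
  then have fix_x: "comp_seq g js (Some x) = Some x" unfolding x_def eq[symmetric] .
  have "regular_orbit js (Some x)" using H ur(2) by (simp add: branch_def x_def)
  then obtain D where D: "((\<lambda>v. finite_part (comp_seq g js (Some v))) has_field_derivative D) (at x)"
    using regular_orbit_has_derivative[OF js] by blast
  have "((\<lambda>v. finite_part (comp_seq g js (Some (H v)))) has_field_derivative D * deriv H u) (at u)"
    using DERIV_chain2[OF D[unfolded x_def] derH[OF ur(2)]] .
  then have "(\<psi> has_field_derivative D * deriv H u) (at u)"
    by (rule has_field_derivative_transform_within_open[OF _ open_ball ur(2)]) (use H in \<open>auto simp: branch_def\<close>)
  then have der: "deriv \<psi> u = D * deriv H u" by (rule DERIV_imp_deriv)
  have "cmod D > 1"
  proof (rule ccontr)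
    assume "\<not> cmod D > 1"
    then have "cmod (deriv \<psi> u) \<le> 1 * cmod (deriv H u)" unfolding der norm_mult by (intro mult_right_mono) auto
    then show False using small[OF ur(1)] large[OF ur(1)] by simp
  qed
  then have "repelling_fixed_point (comp_seq g js) (Some x)" using repelling_of_expanding[OF D fix_x] by simp
  then show ?thesis using that[of x] near[OF ur(1)] ur(2) by (auto simp: x_def)
qed

lemma good_branch:
  obtains HH where "\<And>js z. z \<in> good js \<Longrightarrow> branch js (HH js z) \<and> HH js z 0 = z"
proof
  show "branch js ((\<lambda>js z. SOME H. branch js H \<and> H 0 = z) js z) \<and> (\<lambda>js z. SOME H. branch js H \<and> H 0 = z) js z 0 = z"
    if "z \<in> good js" for js z
    using someI_ex[of "\<lambda>H. branch js H \<and> H 0 = z"] that by (auto simp: good_def)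
qed

text \<open>Preimages in \<open>K\<close> are of three kinds: those without a branch, those whose
  branch has a large derivative somewhere on \<open>cball 0 r\<close>, and those that produce a
  repelling point at distance less than \<open>\<delta>\<close>. The first two cost at most
  \<open>C\<close> each, the last at most the oscillation \<open>e\<close>. The number
  \<open>k\<close> is chosen before the sequence.\<close>

lemma pullback_sum_le_repelling_sum:
  assumes r: "0 < r" "r < 1" and \<delta>: "0 < \<delta>"
    and inv: "continuous_on (\<psi> ` ball 0 1) \<psi>'" "\<And>u. u \<in> ball 0 1 \<Longrightarrow> \<psi>' (\<psi> u) = u"
    and room: "\<And>z. z \<in> K \<Longrightarrow> ball z \<delta> \<subseteq> \<psi> ` ball 0 r"
    and large: "\<And>u. cmod u \<le> r \<Longrightarrow> \<delta> \<le> cmod (deriv \<psi> u)"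
    and K: "\<And>z. z \<in> K \<Longrightarrow> cmod z \<le> \<rho>"
    and \<phi>: "\<And>x. 0 \<le> \<phi> x" "\<And>x. \<phi> x \<le> C" "\<And>z y. z \<in> K \<Longrightarrow> dist z y < \<delta> \<Longrightarrow> \<phi> (Some z) \<le> \<phi> (Some y) + e" "0 \<le> e"
    and \<eta>: "\<And>x. 0 \<le> \<eta> x" "\<And>x. \<eta> x \<le> 1" "\<And>z. \<eta> (Some z) > 0 \<Longrightarrow> z \<in> K"
  obtains k :: nat where "\<And>js. set js \<subseteq> {..<N} \<Longrightarrow>
    (\<Sum>z\<in>preimages js. \<phi> (Some z) * \<eta> (Some z)) \<le>
      (\<Sum>x\<in>{x. repelling_fixed_point (comp_seq g js) x}. \<phi> x) + e * real (deg_seq d js) + C * real (card (bad js) + k)"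
proof -
  obtain HH where HH: "\<And>js z. z \<in> good js \<Longrightarrow> branch js (HH js z) \<and> HH js z 0 = z"
    using good_branch by blast
  obtain k :: nat where k: "\<And>(Z :: complex set) H. \<lbrakk>\<And>z. z \<in> Z \<Longrightarrow> H z holomorphic_on ball 0 1;
       \<And>z u. z \<in> Z \<Longrightarrow> u \<in> ball 0 1 \<Longrightarrow> H z u \<noteq> 0 \<and> H z u \<noteq> 1;
       \<And>z. z \<in> Z \<Longrightarrow> cmod (H z 0) \<le> \<rho>;
       \<And>z. z \<in> Z \<Longrightarrow> \<exists>u\<in>cball 0 r. \<delta> \<le> cmod (deriv (H z) u);
       \<And>z y. z \<in> Z \<Longrightarrow> y \<in> Z \<Longrightarrow> z \<noteq> y \<Longrightarrow> H z ` ball 0 1 \<inter> H y ` ball 0 1 = {}\<rbrakk> \<Longrightarrow> card Z \<le> k"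
    by (rule card_large_derivative_le[OF r \<delta>, of \<rho>]) blast
  show ?thesis
  proof (rule that[of k])
    fix js assume js: "set js \<subseteq> {..<N}"
    let ?H = "HH js"
    let ?F = "\<lambda>z. \<phi> (Some z) * \<eta> (Some z)"
    have H: "branch js (?H z)" "?H z 0 = z" if "z \<in> good js" for z using HH[OF that] by auto
    have disj: "?H z ` ball 0 1 \<inter> ?H y ` ball 0 1 = {}" if "z \<in> good js" "y \<in> good js" "z \<noteq> y" for z y
      using branch_disjoint[OF js H(1) H(1)] H(2) that by metis
    have finite_part: "finite (preimages js)" "card (preimages js) \<le> deg_seq d js" using preimages_finite_card[OF js] by auto
    have C0: "0 \<le> C" using \<phi>(1,2) order_trans by blast
    define big where "big = (\<lambda>z. \<exists>u\<in>cball 0 r. \<delta> \<le> cmod (deriv (?H z) u))"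
    define B where "B = {z \<in> good js. z \<in> K \<and> big z}"
    define G where "G = {z \<in> good js. z \<in> K \<and> \<not> big z}"
    have finGB: "finite G" "finite B" "G \<subseteq> preimages js" "finite (bad js)"
      using finite_part(1) good_subset_preimages[of js] by (auto simp: G_def B_def bad_def intro: finite_subset[of _ "preimages js"])
    have "card B \<le> k"
    proof (rule k[of B ?H])
      fix z assume z: "z \<in> B"
      show "?H z holomorphic_on ball 0 1" using H(1) z by (simp add: B_def branch_def)
      show "cmod (?H z 0) \<le> \<rho>" using H(2) z K by (simp add: B_def)
      show "\<exists>u\<in>cball 0 r. \<delta> \<le> cmod (deriv (?H z) u)" using z by (simp add: B_def big_def)
    next
      fix z u :: complex assume z: "z \<in> B" "u \<in> ball 0 1"
      then have "regular_orbit js (Some (?H z u))" using H(1)[of z] by (auto simp: B_def branch_def)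
      then have "Some (?H z u) \<notin> excluded" by (rule regular_orbit_not_excluded)
      then show "?H z u \<noteq> 0 \<and> ?H z u \<noteq> 1" using zero_excluded one_excluded by auto
    next
      show "?H z ` ball 0 1 \<inter> ?H y ` ball 0 1 = {}" if "z \<in> B" "y \<in> B" "z \<noteq> y" for z y
        using disj that by (simp add: B_def)
    qed
    have F1: "0 \<le> ?F z" "?F z \<le> C" "?F z \<le> \<phi> (Some z)" for z
    proof -
      show "0 \<le> ?F z" using \<phi>(1) \<eta>(1) by simp
      show "?F z \<le> \<phi> (Some z)" using \<phi>(1)[of "Some z"] \<eta>(2)[of "Some z"] by (simp add: mult_left_le)
      then show "?F z \<le> C" using \<phi>(2)[of "Some z"] by linarith
    qed
    have zero: "?F z = 0" if "z \<notin> K" for z using \<eta>(1)[of "Some z"] \<eta>(3)[of z] that by force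
    have "(\<Sum>z\<in>preimages js. ?F z) \<le> (\<Sum>z\<in>G \<union> (bad js \<union> B). ?F z)"
    proof -
      have "(\<Sum>z\<in>preimages js. ?F z) = (\<Sum>z\<in>{z \<in> preimages js. z \<in> K}. ?F z)"
        using finite_part(1) zero by (intro sum.mono_neutral_right) auto
      also have "\<dots> \<le> (\<Sum>z\<in>G \<union> (bad js \<union> B). ?F z)"
        using finGB F1(1) by (intro sum_mono2) (auto simp: G_def B_def bad_def)
      finally show ?thesis .
    qed
    also have "\<dots> \<le> (\<Sum>z\<in>G. ?F z) + (\<Sum>z\<in>bad js \<union> B. ?F z)"
    proof -
      have "0 \<le> (\<Sum>z\<in>G \<inter> (bad js \<union> B). ?F z)" using F1(1) by (intro sum_nonneg)
      then show ?thesis using sum.union_inter[of G "bad js \<union> B" ?F] finGB by simp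
    qed
    finally have 2: "(\<Sum>z\<in>preimages js. ?F z) \<le> (\<Sum>z\<in>G. ?F z) + (\<Sum>z\<in>bad js \<union> B. ?F z)" .
    have "(\<Sum>z\<in>bad js \<union> B. ?F z) \<le> (\<Sum>z\<in>bad js \<union> B. C)" using F1(2) by (intro sum_mono)
    also have "\<dots> = C * real (card (bad js \<union> B))" by simp
    also have "\<dots> \<le> C * real (card (bad js) + k)"
    proof (rule mult_left_mono[OF _ C0])
      have "card (bad js \<union> B) \<le> card (bad js) + k" using card_Un_le[of "bad js" B] \<open>card B \<le> k\<close> by linarith
      then show "real (card (bad js \<union> B)) \<le> real (card (bad js) + k)" by (simp only: of_nat_le_iff)
    qed
    finally have 1: "(\<Sum>z\<in>preimages js. ?F z) \<le> (\<Sum>z\<in>G. ?F z) + C * real (card (bad js) + k)" using 2 by linarith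
    have "\<forall>z\<in>G. \<exists>x. repelling_fixed_point (comp_seq g js) (Some x) \<and> x \<in> ?H z ` ball 0 1 \<and> dist z x < \<delta>"
    proof
      fix z assume z: "z \<in> G"
      then have zg: "z \<in> good js" "z \<in> K" "\<not> big z" by (auto simp: G_def)
      obtain x where "repelling_fixed_point (comp_seq g js) (Some x)" "x \<in> ?H z ` ball 0 1" "dist (?H z 0) x < \<delta>"
      proof (rule branch_repelling_fixed_point[OF js H(1)[OF zg(1)] r inv])
        show "ball (?H z 0) \<delta> \<subseteq> \<psi> ` ball 0 r" using room zg H(2) by simp
        show "cmod (deriv (?H z) u) < \<delta>" if "cmod u \<le> r" for u
          using zg(3) that by (force simp: big_def)
      qed (use large in auto)
      then show "\<exists>x. repelling_fixed_point (comp_seq g js) (Some x) \<and> x \<in> ?H z ` ball 0 1 \<and> dist z x < \<delta>"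
        using H(2)[OF zg(1)] by auto
    qed
    from bchoice[OF this] obtain x where
      x: "\<forall>z\<in>G. repelling_fixed_point (comp_seq g js) (Some (x z)) \<and> x z \<in> ?H z ` ball 0 1 \<and> dist z (x z) < \<delta>" by blast
    \<comment> \<open>The repelling point lies in the image of its branch, so disjoint images
      prevent it from being counted twice.\<close>
    have inj: "inj_on (\<lambda>z. Some (x z)) G"
    proof (rule inj_onI, rule ccontr)
      fix z y assume zy: "z \<in> G" "y \<in> G" "Some (x z) = Some (x y)" "z \<noteq> y"
      have "x z \<in> ?H z ` ball 0 1" "x y \<in> ?H y ` ball 0 1" using x zy(1,2) by blast+
      moreover have "x z = x y" using zy(3) by simp
      moreover have "?H z ` ball 0 1 \<inter> ?H y ` ball 0 1 = {}"
        using zy by (intro disj) (auto simp: G_def)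
      ultimately show False by (metis IntI empty_iff)
    qed
    have "(\<Sum>z\<in>G. ?F z) \<le> (\<Sum>z\<in>G. \<phi> (Some (x z)) + e)"
    proof (rule sum_mono)
      fix z assume z: "z \<in> G"
      then have "\<phi> (Some z) \<le> \<phi> (Some (x z)) + e" using x \<phi>(3)[of z "x z"] by (simp add: G_def)
      then show "?F z \<le> \<phi> (Some (x z)) + e" using F1(3)[of z] by linarith
    qed
    also have "\<dots> = (\<Sum>z\<in>(\<lambda>z. Some (x z)) ` G. \<phi> z) + e * card G"
      using inj by (simp add: sum.distrib sum.reindex)
    also have "(\<Sum>z\<in>(\<lambda>z. Some (x z)) ` G. \<phi> z) \<le> (\<Sum>x\<in>{x. repelling_fixed_point (comp_seq g js) x}. \<phi> x)"
      using repelling_finite_card(1)[OF js] x \<phi>(1) by (intro sum_mono2) auto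
    also have "e * card G \<le> e * real (deg_seq d js)"
      using \<phi>(4) card_mono[OF finite_part(1) finGB(3)] finite_part(2) by (intro mult_left_mono) auto
    finally show "(\<Sum>z\<in>preimages js. ?F z) \<le>
      (\<Sum>x\<in>{x. repelling_fixed_point (comp_seq g js) x}. \<phi> x) + e * real (deg_seq d js) + C * real (card (bad js) + k)"
      using 1 by linarith
  qed
qed

end

section \<open>The lower bound and the convergence\<close>

context correspondence
begin

lemma repelling_avg_lower_bound:
  assumes eqm: "is_equilibrium_measure g N d1 \<mu>" and \<phi>: "P1_continuous \<phi>" "\<And>x. 0 \<le> \<phi> x"
    and \<epsilon>: "\<epsilon> > 0"
  shows "eventually (\<lambda>n. integral\<^sup>L \<mu> \<phi> - \<epsilon> \<le> repelling_avg g N d1 n \<phi>) sequentially"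
proof -
  interpret \<mu>: P1_prob \<mu> using eqm by (rule P1_prob_of_equilibrium)
  obtain E where E: "P1_polar E"
    "\<And>w \<phi>. w \<notin> E \<Longrightarrow> P1_continuous \<phi> \<Longrightarrow> (\<lambda>n. pullback_avg g N d1 w n \<phi>) \<longlonglongrightarrow> integral\<^sup>L \<mu> \<phi>"
    using eqm unfolding is_equilibrium_measure_def by blast
  obtain C where C: "C \<ge> 0" "\<And>x. \<phi> x \<le> C" using P1_continuous_bounded[OF \<phi>(1)] abs_le_D1 by metis
  \<comment> \<open>Five errors of size \<open>e\<close>: the cut-off, the convergence of the
    pull-backs, the oscillation of \<open>\<phi>\<close> at the repelling points, the bad branches,
    and the branches that do not contract.\<close>
  define e where "e = \<epsilon> / 5"
  have e: "e > 0" using \<epsilon> by (simp add: e_def)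
  define r where "r = real N / real d1"
  have r: "0 \<le> r" "r < 1" using ratio by (simp_all add: r_def)
  have d1: "real d1 > 0" using N_less_d1 by simp
  \<comment> \<open>This choice involves neither \<open>w\<close> nor the domain, so the slits can
    be built afterwards for this \<open>l\<close>. The bound \<open>k\<close>, which does depend on
    the domain, will be multiplied by \<open>r ^ n\<close> and vanish with \<open>n\<close>.\<close>
  obtain l where l: "C * (card excluded * (r ^ l / (1 - r))) \<le> e"
  proof -
    have "(\<lambda>l. C * (card excluded * (r ^ l / (1 - r)))) \<longlonglongrightarrow> C * (card excluded * (0 / (1 - r)))"
      using r by (intro tendsto_intros LIMSEQ_power_zero) auto
    then have "eventually (\<lambda>l. C * (card excluded * (r ^ l / (1 - r))) < e) sequentially"
      using e by (intro order_tendstoD) auto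
    then show ?thesis using that unfolding eventually_sequentially by (meson less_imp_le order_refl)
  qed
  obtain w c where w: "Some w \<notin> E" "0 < c"
    "\<And>js b y. set js \<subseteq> {..<N} \<Longrightarrow> b \<in> excluded \<Longrightarrow> comp_seq g js b = Some y \<Longrightarrow> c / (2 * real N) ^ length js \<le> dist w y"
    by (rule generic_value[OF E(1) finite_excluded]) blast
  interpret w: unramified_point g p q d N w
  proof unfold_locales
    fix js b assume js: "set js \<subseteq> {..<N}" "b \<in> excluded"
    show "comp_seq g js b \<noteq> Some w"
    proof
      assume "comp_seq g js b = Some w"
      then have "c / (2 * real N) ^ length js \<le> dist w w" using w(3) js by blast
      moreover have "c / (2 * real N) ^ length js > 0" using w(2) N_pos by simp
      ultimately show False by simp
    qed
  qed
  \<comment> \<open>Tips of the slits. The sequence of length 0 puts the finite excluded points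
    themselves among them, so \<open>V\<close> is nonempty and the domain omits 0 and 1.\<close>
  define V where "V = (\<Union>n\<le>l. {y. \<exists>js\<in>index_seqs N n. \<exists>b\<in>excluded. comp_seq g js b = Some y})"
  have finV: "finite V" unfolding V_def using finite_orbit_values[OF finite_excluded] by blast
  have inV: "y \<in> V" if "set js \<subseteq> {..<N}" "length js \<le> l" "b \<in> excluded" "comp_seq g js b = Some y" for js b y
    using that by (auto simp: V_def index_seqs_def)
  have "0 \<in> V" using inV[of "[]" "Some 0" 0] zero_excluded by simp
  then have V0: "V \<noteq> {}" by auto
  have "w \<notin> V" using w.avoid by (auto simp: V_def index_seqs_def)
  obtain m where m: "w \<notin> (\<Union>v\<in>V. ray m v)" "measure \<mu> (Some ` (\<Union>v\<in>V. ray m v)) = 0"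
    using \<mu>.null_ray_direction[OF equilibrium_no_atom[OF eqm] finV \<open>w \<notin> V\<close>] by blast
  define U where "U = - (\<Union>v\<in>V. ray m v)"
  have U: "open U" "simply_connected U" "U \<noteq> UNIV" "w \<in> U"
    using simply_connected_slit_plane[OF finV V0, of m] m(1) by (simp_all add: U_def)
  have VU: "v \<notin> U" if "v \<in> V" for v using that by (auto simp: U_def ray_def)
  have U0: "measure \<mu> (- Some ` U) = 0"
  proof -
    have "closed (\<Union>v\<in>V. ray m v)" using U(1) by (simp add: U_def open_closed)
    then have meas: "Some ` (\<Union>v\<in>V. ray m v) \<in> sets \<mu>" by (intro \<mu>.Some_image_sets borel_closed)
    have "- Some ` U \<subseteq> {None} \<union> Some ` (\<Union>v\<in>V. ray m v)"
    proof
      fix x assume "x \<in> - Some ` U"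
      show "x \<in> {None} \<union> Some ` (\<Union>v\<in>V. ray m v)"
      proof (cases x)
        case (Some a)
        then have "a \<notin> U" using \<open>x \<in> - Some ` U\<close> by blast
        then show ?thesis using Some unfolding U_def by blast
      qed simp
    qed
    then have "measure \<mu> (- Some ` U) \<le> measure \<mu> ({None} \<union> Some ` (\<Union>v\<in>V. ray m v))"
      using meas \<mu>.singleton_sets by (intro \<mu>.finite_measure_mono sets.Un) auto
    also have "\<dots> \<le> measure \<mu> {None} + measure \<mu> (Some ` (\<Union>v\<in>V. ray m v))"
      using meas \<mu>.singleton_sets by (intro measure_Un_le) auto
    finally show ?thesis using m(2) equilibrium_no_atom[OF eqm] measure_nonneg[of \<mu> "- Some ` U"] by simp
  qed
  obtain \<eta> K where \<eta>: "P1_continuous \<eta>" "compact K" "K \<subseteq> U" "\<And>x. 0 \<le> \<eta> x" "\<And>x. \<eta> x \<le> 1"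
    "\<And>x. \<eta> x > 0 \<Longrightarrow> x \<in> Some ` K" "integral\<^sup>L \<mu> \<phi> - e \<le> integral\<^sup>L \<mu> (\<lambda>x. \<phi> x * \<eta> x)"
    using \<mu>.cutoff_function[OF U(1,3) U0 \<phi>(1) e] by metis
  obtain \<psi> \<psi>' where \<psi>: "\<psi> holomorphic_on ball 0 1" "\<psi>' holomorphic_on U" "\<psi> 0 = w"
    "\<And>z. z \<in> U \<Longrightarrow> \<psi>' z \<in> ball 0 1 \<and> \<psi> (\<psi>' z) = z"
    "\<And>u. u \<in> ball 0 1 \<Longrightarrow> \<psi> u \<in> U \<and> \<psi>' (\<psi> u) = u"
    by (rule Riemann_map_at[OF U]) blast
  have inj: "inj_on \<psi> (ball 0 1)" using \<psi>(5) by (metis inj_onI)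
  interpret I: inverse_branches g p q d N w \<psi>
    by unfold_locales (use \<psi> inj in auto)
  have cont': "continuous_on U \<psi>'" using \<psi>(2) by (rule holomorphic_on_imp_continuous_on)
  have imU: "\<psi> ` ball 0 1 \<subseteq> U" using \<psi>(5) by auto
  obtain s where s: "0 < s" "s < 1" "\<psi>' ` K \<subseteq> ball 0 s"
  proof -
    have "compact (\<psi>' ` K)" by (rule compact_continuous_image[OF continuous_on_subset[OF cont' \<eta>(3)] \<eta>(2)])
    moreover have "\<psi>' ` K \<subseteq> ball 0 1" using \<psi>(4) \<eta>(3) by auto
    ultimately obtain t where t: "t > 0" "(\<Union>x\<in>\<psi>' ` K. cball x t) \<subseteq> ball 0 1"
      using compact_subset_open_imp_cball_epsilon_subset[OF _ open_ball] by metis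
    define s where "s = max (1/2) (1 - t / 2)"
    have "cmod (\<psi>' z) < s" if z: "z \<in> K" for z
    proof (cases "\<psi>' z = 0")
      case False
      have nz: "cmod (\<psi>' z) > 0" using False by simp
      \<comment> \<open>Pushing the point radially outwards by \<open>t\<close> keeps it in the unit
        disc, so its modulus is less than \<open>1 - t\<close>.\<close>
      have "\<psi>' z + of_real (t / cmod (\<psi>' z)) * \<psi>' z \<in> cball (\<psi>' z) t"
      proof -
        have "cmod (of_real (t / cmod (\<psi>' z)) * \<psi>' z) = t"
          using t(1) nz unfolding norm_mult norm_of_real by simp
        then show ?thesis unfolding mem_cball dist_norm
          by (metis add_diff_cancel_left' norm_minus_commute order_refl)
      qed
      then have "\<psi>' z + of_real (t / cmod (\<psi>' z)) * \<psi>' z \<in> ball 0 1" using t(2) z by blast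
      moreover have "\<psi>' z + of_real (t / cmod (\<psi>' z)) * \<psi>' z = of_real (1 + t / cmod (\<psi>' z)) * \<psi>' z"
        by (simp add: algebra_simps)
      moreover have "cmod (of_real (1 + t / cmod (\<psi>' z)) * \<psi>' z) = cmod (\<psi>' z) + t"
        using t(1) nz unfolding norm_mult norm_of_real by (simp add: field_simps)
      ultimately have "cmod (\<psi>' z) + t < 1" by simp
      then show ?thesis using t(1) by (auto simp: s_def less_max_iff_disj)
    qed (auto simp: s_def less_max_iff_disj)
    then have "\<psi>' ` K \<subseteq> ball 0 s" by auto
    moreover have "0 < s" "s < 1" using t(1) by (auto simp: s_def less_max_iff_disj)
    ultimately show ?thesis using that by blast
  qed
  define W where "W = U \<inter> \<psi>' -` ball 0 s"
  have openW: "open W" unfolding W_def using cont' U(1) by (intro continuous_open_preimage) auto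
  have WS: "W \<subseteq> \<psi> ` ball 0 s" using \<psi>(4) by (force simp: W_def)
  have "K \<subseteq> W" using \<eta>(3) s(3) by (auto simp: W_def)
  then obtain \<delta>1 where \<delta>1: "\<delta>1 > 0" "(\<Union>x\<in>K. ball x \<delta>1) \<subseteq> W"
    using compact_subset_open_imp_ball_epsilon_subset[OF \<eta>(2) openW] by metis
  obtain \<rho> where \<rho>: "\<And>z. z \<in> K \<Longrightarrow> cmod z \<le> \<rho>"
    using compact_imp_bounded[OF \<eta>(2)] unfolding bounded_iff by blast
  have "uniformly_continuous_on (cball 0 (\<rho> + 1)) (\<lambda>z. \<phi> (Some z))"
    using \<phi>(1) unfolding P1_continuous_def
    by (intro compact_uniformly_continuous) (auto intro: continuous_on_subset)
  then obtain \<delta>2 where \<delta>2: "\<delta>2 > 0" "\<And>x y. \<lbrakk>x \<in> cball 0 (\<rho> + 1); y \<in> cball 0 (\<rho> + 1); dist y x < \<delta>2\<rbrakk> \<Longrightarrow> dist (\<phi> (Some y)) (\<phi> (Some x)) < e"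
    using e unfolding uniformly_continuous_on_def by metis
  have sub: "cball 0 s \<subseteq> ball (0::complex) 1" using s by auto
  obtain \<delta>3 where \<delta>3: "\<delta>3 > 0" "\<And>u. cmod u \<le> s \<Longrightarrow> \<delta>3 \<le> cmod (deriv \<psi> u)"
  proof -
    have "continuous_on (cball 0 s) (\<lambda>u. cmod (deriv \<psi> u))"
      using holomorphic_on_imp_continuous_on[OF holomorphic_deriv[OF \<psi>(1) open_ball]] sub
      by (intro continuous_on_norm) (rule continuous_on_subset)
    then obtain a where a: "a \<in> cball 0 s" "\<And>u. u \<in> cball 0 s \<Longrightarrow> cmod (deriv \<psi> a) \<le> cmod (deriv \<psi> u)"
      using continuous_attains_inf[of "cball 0 s" "\<lambda>u. cmod (deriv \<psi> u)"] s by auto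
    have "deriv \<psi> a \<noteq> 0" by (rule holomorphic_injective_imp_regular[OF \<psi>(1) open_ball inj]) (use a sub in auto)
    then show ?thesis using that[of "cmod (deriv \<psi> a)"] a by auto
  qed
  \<comment> \<open>In this order: discs around \<open>K\<close> stay in the image of
    \<open>ball 0 s\<close>, \<open>\<phi>\<close> varies by less than \<open>e\<close>, the
    derivative of \<open>\<psi>\<close> is not smaller, and nearby points stay in the disc on which
    uniform continuity was taken.\<close>
  define \<delta> where "\<delta> = min (min \<delta>1 \<delta>2) (min \<delta>3 1)"
  have \<delta>: "\<delta> > 0" "\<delta> \<le> \<delta>1" "\<delta> \<le> \<delta>2" "\<delta> \<le> \<delta>3" "\<delta> \<le> 1" using \<delta>1 \<delta>2 \<delta>3 by (auto simp: \<delta>_def)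
  obtain k :: nat where k: "\<And>js. set js \<subseteq> {..<N} \<Longrightarrow>
    (\<Sum>z\<in>w.preimages js. \<phi> (Some z) * \<eta> (Some z)) \<le>
      (\<Sum>x\<in>{x. repelling_fixed_point (comp_seq g js) x}. \<phi> x) + e * deg_seq d js + C * (card (I.bad js) + k)"
  proof (rule I.pullback_sum_le_repelling_sum[OF s(1,2) \<delta>(1), of \<psi>' K \<rho> \<phi> C e \<eta>])
    show "continuous_on (\<psi> ` ball 0 1) \<psi>'" using cont' imU by (rule continuous_on_subset)
    show "ball z \<delta> \<subseteq> \<psi> ` ball 0 s" if "z \<in> K" for z
    proof -
      have "ball z \<delta> \<subseteq> ball z \<delta>1" using \<delta>(2) by auto
      then show ?thesis using \<delta>1(2) that WS by blast
    qed
    show "\<phi> (Some z) \<le> \<phi> (Some y) + e" if "z \<in> K" "dist z y < \<delta>" for z y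
    proof -
      have "cmod y \<le> \<rho> + 1" using \<rho>[OF that(1)] that(2) \<delta>(5) norm_triangle_sub[of y z]
        by (simp add: dist_norm norm_minus_commute)
      then have "dist (\<phi> (Some z)) (\<phi> (Some y)) < e"
        using \<rho>[OF that(1)] that(2) \<delta>(3) by (intro \<delta>2(2)) auto
      then show ?thesis by (simp add: dist_real_def)
    qed
    show "z \<in> K" if "\<eta> (Some z) > 0" for z using \<eta>(6)[OF that] by auto
    show "\<delta> \<le> cmod (deriv \<psi> u)" if "cmod u \<le> s" for u using \<delta>3(2)[OF that] \<delta>(4) by linarith
  qed (use \<psi>(5) \<rho> \<phi>(2) C \<eta> e in auto)
  have main: "pullback_avg g N d1 (Some w) n (\<lambda>x. \<phi> x * \<eta> x) \<le> repelling_avg g N d1 n \<phi> + 2 * e + C * k * r ^ n" for n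
  proof -
    let ?Rep = "\<Sum>js\<in>index_seqs N n. \<Sum>x\<in>{x. repelling_fixed_point (comp_seq g js) x}. \<phi> x"
    have "(\<Sum>js\<in>index_seqs N n. \<Sum>z\<in>w.preimages js. \<phi> (Some z) * \<eta> (Some z)) \<le>
       (\<Sum>js\<in>index_seqs N n. (\<Sum>x\<in>{x. repelling_fixed_point (comp_seq g js) x}. \<phi> x) + e * deg_seq d js + C * (card (I.bad js) + k))"
      by (intro sum_mono k) (auto simp: index_seqs_def)
    also have "\<dots> = ?Rep + e * real (\<Sum>js\<in>index_seqs N n. deg_seq d js)
        + C * (real (\<Sum>js\<in>index_seqs N n. card (I.bad js)) + real N ^ n * k)"
      by (simp add: sum.distrib sum_distrib_left card_index_seqs algebra_simps)
    also have "real (\<Sum>js\<in>index_seqs N n. deg_seq d js) = real d1 ^ n" by (simp add: sum_deg_seq d1_def)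
    also have "?Rep + e * real d1 ^ n + C * (real (\<Sum>js\<in>index_seqs N n. card (I.bad js)) + real N ^ n * k)
      \<le> ?Rep + e * real d1 ^ n + C * (real d1 ^ n * (card excluded * (r ^ l / (1 - r))) + real N ^ n * k)"
    proof -
      have "real (\<Sum>js\<in>index_seqs N n. card (I.bad js)) \<le> real d1 ^ n * (card excluded * (\<Sum>k\<in>{l..<n}. r ^ k))"
        unfolding r_def
      proof (rule I.sum_card_bad)
        fix js b and u :: complex assume a: "set js \<subseteq> {..<N}" "length js \<le> l" "u \<in> ball 0 1" "b \<in> excluded"
        show "comp_seq g js b \<noteq> Some (\<psi> u)"
          using inV[OF a(1,2,4)] VU \<psi>(5)[OF a(3)] by blast
      qed
      also have "\<dots> \<le> real d1 ^ n * (card excluded * (r ^ l / (1 - r)))"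
        using sum_geometric_tail_le[OF r] by (intro mult_left_mono) auto
      finally show ?thesis using C(1) by (intro add_left_mono mult_left_mono add_right_mono)
    qed
    also have "real N ^ n = real d1 ^ n * r ^ n" using d1 by (simp add: r_def power_divide)
    also have "?Rep + e * real d1 ^ n + C * (real d1 ^ n * (card excluded * (r ^ l / (1 - r))) + real d1 ^ n * r ^ n * k)
       = ?Rep + real d1 ^ n * (e + C * (card excluded * (r ^ l / (1 - r))) + C * k * r ^ n)"
      by (simp add: algebra_simps)
    also have "\<dots> \<le> ?Rep + real d1 ^ n * (e + e + C * k * r ^ n)"
      using l d1 by (intro add_left_mono mult_left_mono add_right_mono) auto
    finally have "(\<Sum>js\<in>index_seqs N n. \<Sum>z\<in>w.preimages js. \<phi> (Some z) * \<eta> (Some z)) \<le>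
      ?Rep + real d1 ^ n * (2 * e + C * k * r ^ n)" by simp
    then have "1 / real d1 ^ n * (\<Sum>js\<in>index_seqs N n. \<Sum>z\<in>w.preimages js. \<phi> (Some z) * \<eta> (Some z)) \<le>
      1 / real d1 ^ n * (?Rep + real d1 ^ n * (2 * e + C * k * r ^ n))"
      by (intro mult_left_mono) auto
    also have "\<dots> = 1 / real d1 ^ n * ?Rep + (2 * e + C * k * r ^ n)"
      using d1 by (simp add: distrib_left)
    finally show ?thesis unfolding w.pullback_avg_eq repelling_avg_def by linarith
  qed
  have "P1_continuous (\<lambda>x. \<phi> x * \<eta> x)"
    using \<phi>(1) \<eta>(1) unfolding P1_continuous_def by (auto intro: continuous_intros tendsto_mult)
  then have "(\<lambda>n. pullback_avg g N d1 (Some w) n (\<lambda>x. \<phi> x * \<eta> x)) \<longlonglongrightarrow> integral\<^sup>L \<mu> (\<lambda>x. \<phi> x * \<eta> x)"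
    by (rule E(2)[OF w(1)])
  then have "eventually (\<lambda>n. integral\<^sup>L \<mu> (\<lambda>x. \<phi> x * \<eta> x) - e < pullback_avg g N d1 (Some w) n (\<lambda>x. \<phi> x * \<eta> x)) sequentially"
    using e by (intro order_tendstoD(1)) auto
  moreover have "eventually (\<lambda>n. C * k * r ^ n < e) sequentially"
  proof -
    have "(\<lambda>n. C * k * r ^ n) \<longlonglongrightarrow> C * k * 0" using r by (intro tendsto_intros LIMSEQ_power_zero) auto
    then show ?thesis using e by (intro order_tendstoD(2)) auto
  qed
  ultimately show ?thesis
  proof eventually_elim
    case (elim n)
    then show ?case using main[of n] \<eta>(7) e by (simp add: e_def)
  qed
qed

lemma repelling_avg_linear:
  "repelling_avg g N d1 n (\<lambda>x. a * \<phi> x + b) = a * repelling_avg g N d1 n \<phi> + b * repelling_avg g N d1 n (\<lambda>_. 1)"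
proof -
  have "(\<Sum>js\<in>index_seqs N n. \<Sum>x\<in>{x. repelling_fixed_point (comp_seq g js) x}. a * \<phi> x + b) =
    a * (\<Sum>js\<in>index_seqs N n. \<Sum>x\<in>{x. repelling_fixed_point (comp_seq g js) x}. \<phi> x) +
    b * (\<Sum>js\<in>index_seqs N n. \<Sum>x\<in>{x. repelling_fixed_point (comp_seq g js) x}. 1)"
    unfolding sum_distrib_left sum.distrib by simp
  then show ?thesis unfolding repelling_avg_def by (simp only: algebra_simps)
qed

theorem repelling_avg_tendsto:
  assumes eqm: "is_equilibrium_measure g N d1 \<mu>" and \<phi>: "P1_continuous \<phi>"
  shows "(\<lambda>n. repelling_avg g N d1 n \<phi>) \<longlonglongrightarrow> integral\<^sup>L \<mu> \<phi>"
proof -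
  interpret \<mu>: P1_prob \<mu> using eqm by (rule P1_prob_of_equilibrium)
  obtain C where C: "C \<ge> 0" "\<And>x. \<bar>\<phi> x\<bar> \<le> C" using P1_continuous_bounded[OF \<phi>] by metis
  have cont: "P1_continuous (\<lambda>x. a * \<phi> x + b)" for a b
    using \<phi> unfolding P1_continuous_def by (auto intro!: continuous_intros tendsto_intros)
  have int: "integral\<^sup>L \<mu> (\<lambda>x. a * \<phi> x + b) = a * integral\<^sup>L \<mu> \<phi> + b" for a b
    using \<mu>.P1_continuous_integrable[OF \<phi>] by (simp add: \<mu>.prob_space)
  define r where "r = real N / real d1"
  have r: "0 \<le> r" "r < 1" using ratio by (simp_all add: r_def)
  let ?M = "\<lambda>n. repelling_avg g N d1 n (\<lambda>_. 1)"
  have lower: "eventually (\<lambda>n. a * integral\<^sup>L \<mu> \<phi> + C - \<epsilon> \<le> a * repelling_avg g N d1 n \<phi> + C * ?M n) sequentially"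
    if a: "\<bar>a\<bar> = 1" and \<epsilon>: "\<epsilon> > 0" for a \<epsilon>
  proof -
    have "0 \<le> a * \<phi> x + C" for x
    proof -
      have "\<bar>a * \<phi> x\<bar> \<le> C" using C(2)[of x] a by (simp add: abs_mult)
      then show ?thesis by linarith
    qed
    from repelling_avg_lower_bound[OF eqm cont this \<epsilon>] show ?thesis by (simp add: int repelling_avg_linear)
  qed
  show ?thesis
  proof (rule tendstoI)
    fix \<epsilon> :: real assume \<epsilon>: "\<epsilon> > 0"
    have "(\<lambda>n. C * (2 * r ^ n)) \<longlonglongrightarrow> C * (2 * 0)" using r by (intro tendsto_intros LIMSEQ_power_zero) auto
    then have "eventually (\<lambda>n. C * (2 * r ^ n) < \<epsilon> / 2) sequentially" using \<epsilon> by (intro order_tendstoD(2)) auto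
    moreover have "eventually (\<lambda>n. 1 * integral\<^sup>L \<mu> \<phi> + C - \<epsilon> / 4 \<le> 1 * repelling_avg g N d1 n \<phi> + C * ?M n) sequentially"
      using \<epsilon> by (intro lower) auto
    moreover have "eventually (\<lambda>n. - 1 * integral\<^sup>L \<mu> \<phi> + C - \<epsilon> / 4 \<le> - 1 * repelling_avg g N d1 n \<phi> + C * ?M n) sequentially"
      using \<epsilon> by (intro lower) auto
    ultimately show "eventually (\<lambda>n. dist (repelling_avg g N d1 n \<phi>) (integral\<^sup>L \<mu> \<phi>) < \<epsilon>) sequentially"
    proof eventually_elim
      case (elim n)
      \<comment> \<open>The bound on the total repelling mass turns the lower bound for
        \<open>C - \<phi>\<close> into an upper bound for \<open>\<phi>\<close>, and it also removes
        the constant from the lower bound for \<open>C + \<phi>\<close>.\<close>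
      have "C * ?M n \<le> C * (1 + 2 * r ^ n)" using repelling_avg_one_le C(1) unfolding r_def by (intro mult_left_mono) auto
      then have "C * ?M n \<le> C + C * (2 * r ^ n)" by (simp add: algebra_simps)
      then have "\<bar>repelling_avg g N d1 n \<phi> - integral\<^sup>L \<mu> \<phi>\<bar> < \<epsilon>" using elim \<epsilon> by linarith
      then show ?case by (simp add: dist_real_def)
    qed
  qed
qed

end

theorem theorem4p2:
  fixes g :: "nat \<Rightarrow> complex option \<Rightarrow> complex option"
    and deg :: "nat \<Rightarrow> nat"
    and N :: nat
    and \<mu> :: "complex option measure"
  assumes rat: "\<And>j. j < N \<Longrightarrow> is_rational_map (g j) (deg j)"
    and nonconst: "\<And>j. j < N \<Longrightarrow> deg j \<ge> 1"
    and big: "\<exists>j<N. deg j \<ge> 2"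
    and eq: "is_equilibrium_measure g N (\<Sum>j<N. deg j) \<mu>"
  shows "\<forall>\<phi>. P1_continuous \<phi> \<longrightarrow>
           (\<lambda>n. repelling_avg g N (\<Sum>j<N. deg j) n \<phi>) \<longlonglongrightarrow> integral\<^sup>L \<mu> \<phi>"
proof -
  have "\<forall>j\<in>{..<N}. \<exists>pq. coprime (fst pq) (snd pq) \<and> max (degree (fst pq)) (degree (snd pq)) = deg j \<and>
      g j = rat_map_of (fst pq) (snd pq)"
    using rat unfolding is_rational_map_def by fastforce
  from bchoice[OF this] obtain pq where pq: "\<forall>j\<in>{..<N}. coprime (fst (pq j)) (snd (pq j)) \<and>
      max (degree (fst (pq j))) (degree (snd (pq j))) = deg j \<and> g j = rat_map_of (fst (pq j)) (snd (pq j))" by blast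
  interpret correspondence g "\<lambda>j. fst (pq j)" "\<lambda>j. snd (pq j)" deg N
    by unfold_locales (use pq nonconst big in auto)
  show ?thesis using repelling_avg_tendsto eq unfolding d1_def by blast
qed

end
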